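(* For any integer $c\ge0$, the set $\{\mathsf{E}_0,\dots,\mathsf{E}_c\}$ is a minimal generating set of the operad $\mathbf{Hi}_{\underline{c}}$. The space of the nontrivial relations of $\mathbf{Hi}_{\underline{c}}$ is generated by $$\mathsf{E}_a\circ_1\mathsf{E}_b-\mathsf{E}_b\circ_2\mathsf{E}_{a'},\qquad b\in\{0,\dots,c\},\ a,a'\in\{0,\dots,b\},$$ $$\mathsf{E}_b\circ_1\mathsf{E}_a-\mathsf{E}_a\circ_2\mathsf{E}_b,\qquad b\in\{0,\dots,c\},\ a\in\{0,\dots,b-1\}$$ (for $b=0$ the second family is empty). Moreover, $\mathbf{Hi}_{\underline{c}}$ is a Koszul operad.
   Context: $\mathbb{N}=\{0,1,2,\dots\}$ and $\mathbb{K}$ is a field of characteristic zero. All operads are nonsymmetric operads in $\mathbb{K}$-vector spaces. Fix $c\ge0$. For a word $w$ on $\mathbb{N}$, $\ell(w)$ is its length, $w(i)$ its $i$-th letter, $\epsilon$ the empty word, $|w|:=\ell(w)+1$. $\mathsf{Cl}_{\underline{c}}$ is the set of all words on $\{0,\dots,c\}$ (the cliffs for the constant map $\underline{c}$ equal to $c$), and $\mathsf{Hi}_{\underline{c}}$ is its subset of weakly increasing words. $\mathbf{Cl}_{\underline{c}}$ is the operad with basis $\{\mathsf{E}_w:w\in\mathsf{Cl}_{\underline{c}}\}$, $\mathsf{E}_w$ of arity $|w|$, with $\mathsf{E}_u\circ_i\mathsf{E}_v:=\mathsf{E}_{u(1)\cdots u(i-1)\,v\,u(i)\cdots u(\ell(u))}$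 for $1\le i\le|u|$, and unit $\mathsf{E}_\epsilon$. For words of the same length, $u\preccurlyeq v$ iff $u(j)\le v(j)$ for all $j$. The $\mathsf{F}$-basis of $\mathbf{Cl}_{\underline{c}}$ is defined by $\mathsf{F}_w:=\sum_{w\preccurlyeq w'}\mu_\preccurlyeq(w,w')\mathsf{E}_{w'}$ (sum over $w'\in\mathsf{Cl}_{\underline{c}}$, $\mu_\preccurlyeq$ the Möbius function), equivalently $\mathsf{E}_w=\sum_{w'\in\mathsf{Cl}_{\underline{c}},\,w\preccurlyeq w'}\mathsf{F}_{w'}$. The span of $\{\mathsf{F}_w:w\in\mathsf{Cl}_{\underline{c}}\setminus\mathsf{Hi}_{\underline{c}}\}$ is an operad ideal, and $\mathbf{Hi}_{\underline{c}}$ is the quotient operad. For $w\in\mathsf{Hi}_{\underline{c}}$, $\mathsf{E}_w\in\mathbf{Hi}_{\underline{c}}$ denotes the image of $\mathsf{E}_w\in\mathbf{Cl}_{\underline{c}}$; $\{\mathsf{E}_w:w\in\mathsf{Hi}_{\underline{c}}\}$ is a basis of $\mathbf{Hi}_{\underline{c}}$. For $a\in\{0,\dots,c\}$, $\mathsf{E}_a$ is indexed by the one-letter word $a$ and has arity $2$. A generating set is minimal if no proper subset of it generates the operad. That the space of nontrivial relations is generated by the given elements means: the kernel of the canonical operad morphism from the free operad on the generators $\mathsf{E}_0,\dots,\mathsf{E}_c$ (of arity $2$) to $\mathbf{Hi}_{\underline{c}}$ is the operad ideal generated by these elements, viewed in the free operad. *)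

theory Defs
  imports
    "HOL-Algebra.Module"
    "HOL-Algebra.AbelCoset"
    "HOL-Algebra.Algebraic_Closure_Type"
    "HOL-Library.Poly_Mapping"
begin

section \<open>Vector spaces on explicit carriers\<close>

text \<open>
  A vector space over the field type \<open>'k\<close> is a record of type \<open>('k, 'v) module\<close> satisfying
  \<open>Module.module ring_of_type_algebra\<close>.  The fields \<open>mult\<close> and \<open>one\<close>, which that record
  inherits from rings, are irrelevant and left \<open>undefined\<close>.
\<close>

abbreviation scalars :: "'k::field ring" where
  "scalars \<equiv> ring_of_type_algebra"

definition linear_on :: "('k::field, 'v) module \<Rightarrow> ('k, 'w) module \<Rightarrow> ('v \<Rightarrow> 'w) \<Rightarrow> bool" where
  "linear_on M N f \<longleftrightarrow>
     f \<in> carrier M \<rightarrow> carrier N \<and>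
     (\<forall>x\<in>carrier M. \<forall>y\<in>carrier M. f (x \<oplus>\<^bsub>M\<^esub> y) = f x \<oplus>\<^bsub>N\<^esub> f y) \<and>
     (\<forall>a. \<forall>x\<in>carrier M. f (a \<odot>\<^bsub>M\<^esub> x) = a \<odot>\<^bsub>N\<^esub> f x)"

definition span_in :: "('k::field, 'v) module \<Rightarrow> 'v set \<Rightarrow> 'v set" where
  "span_in M S = \<Inter>{H. submodule H scalars M \<and> S \<subseteq> H}"

definition quotient_module :: "('k::field, 'v) module \<Rightarrow> 'v set \<Rightarrow> ('k, 'v set) module" where
  "quotient_module M H =
     \<lparr>carrier = a_rcosets\<^bsub>M\<^esub> H, monoid.mult = undefined, one = undefined,
      zero = H, add = set_add M,
      module.smult = (\<lambda>a A. \<Union>x\<in>A. H +>\<^bsub>M\<^esub> (a \<odot>\<^bsub>M\<^esub> x))\<rparr>"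

definition free_module :: "'b set \<Rightarrow> ('k::field, 'b \<Rightarrow>\<^sub>0 'k) module" where
  "free_module B =
     \<lparr>carrier = {f. Poly_Mapping.keys f \<subseteq> B}, monoid.mult = undefined, one = undefined,
      zero = 0, add = (+), module.smult = (\<lambda>a. Poly_Mapping.map ((*) a))\<rparr>"


section \<open>Nonsymmetric operads\<close>

text \<open>
  \<open>pcomp P m n i x y\<close> is the partial composition of \<open>x\<close> (of arity \<open>m\<close>) with \<open>y\<close>
  (of arity \<open>n\<close>) at the input \<open>i\<close>, where \<open>1 \<le> i \<le> m\<close>.
\<close>

record ('k, 'v) ns_operad =
  component :: "nat \<Rightarrow> ('k, 'v) module"
  pcomp :: "nat \<Rightarrow> nat \<Rightarrow> nat \<Rightarrow> 'v \<Rightarrow> 'v \<Rightarrow> 'v"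
  ounit :: 'v

abbreviation elems :: "('k, 'v) ns_operad \<Rightarrow> nat \<Rightarrow> 'v set" where
  "elems P n \<equiv> carrier (component P n)"

locale nonsymmetric_operad =
  fixes P :: "('k::field, 'v) ns_operad"
  assumes component_module: "Module.module scalars (component P n)"
    and pcomp_linear_left:
      "1 \<le> i \<Longrightarrow> i \<le> m \<Longrightarrow> y \<in> elems P n \<Longrightarrow>
       linear_on (component P m) (component P (m + n - 1)) (\<lambda>x. pcomp P m n i x y)"
    and pcomp_linear_right:
      "1 \<le> i \<Longrightarrow> i \<le> m \<Longrightarrow> x \<in> elems P m \<Longrightarrow>
       linear_on (component P n) (component P (m + n - 1)) (pcomp P m n i x)"
    and ounit_closed: "ounit P \<in> elems P 1"
    and ounit_left: "x \<in> elems P n \<Longrightarrow> pcomp P 1 n 1 (ounit P) x = x"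
    and ounit_right: "1 \<le> i \<Longrightarrow> i \<le> n \<Longrightarrow> x \<in> elems P n \<Longrightarrow> pcomp P n 1 i x (ounit P) = x"
    and pcomp_sequential:
      "x \<in> elems P l \<Longrightarrow> y \<in> elems P m \<Longrightarrow> z \<in> elems P n \<Longrightarrow>
       1 \<le> i \<Longrightarrow> i \<le> l \<Longrightarrow> 1 \<le> j \<Longrightarrow> j \<le> m \<Longrightarrow>
       pcomp P (l + m - 1) n (i + j - 1) (pcomp P l m i x y) z =
       pcomp P l (m + n - 1) i x (pcomp P m n j y z)"
    and pcomp_parallel:
      "x \<in> elems P l \<Longrightarrow> y \<in> elems P m \<Longrightarrow> z \<in> elems P n \<Longrightarrow>
       1 \<le> i \<Longrightarrow> i < j \<Longrightarrow> j \<le> l \<Longrightarrow>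
       pcomp P (l + m - 1) n (j + m - 1) (pcomp P l m i x y) z =
       pcomp P (l + n - 1) m i (pcomp P l n j x z) y"

definition operad_hom ::
  "('k::field, 'v) ns_operad \<Rightarrow> ('k, 'w) ns_operad \<Rightarrow> (nat \<Rightarrow> 'v \<Rightarrow> 'w) \<Rightarrow> bool" where
  "operad_hom P Q \<phi> \<longleftrightarrow>
     (\<forall>n. linear_on (component P n) (component Q n) (\<phi> n)) \<and>
     \<phi> 1 (ounit P) = ounit Q \<and>
     (\<forall>m n i. \<forall>x\<in>elems P m. \<forall>y\<in>elems P n. 1 \<le> i \<longrightarrow> i \<le> m \<longrightarrow>
        \<phi> (m + n - 1) (pcomp P m n i x y) = pcomp Q m n i (\<phi> m x) (\<phi> n y))"

definition suboperad :: "('k::field, 'v) ns_operad \<Rightarrow> (nat \<Rightarrow> 'v set) \<Rightarrow> bool" where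
  "suboperad P S \<longleftrightarrow>
     (\<forall>n. submodule (S n) scalars (component P n)) \<and>
     ounit P \<in> S 1 \<and>
     (\<forall>m n i. \<forall>x\<in>S m. \<forall>y\<in>S n. 1 \<le> i \<longrightarrow> i \<le> m \<longrightarrow>
        pcomp P m n i x y \<in> S (m + n - 1))"

definition operad_ideal :: "('k::field, 'v) ns_operad \<Rightarrow> (nat \<Rightarrow> 'v set) \<Rightarrow> bool" where
  "operad_ideal P I \<longleftrightarrow>
     (\<forall>n. submodule (I n) scalars (component P n)) \<and>
     (\<forall>m n i. \<forall>x\<in>elems P m. \<forall>y\<in>elems P n. 1 \<le> i \<longrightarrow> i \<le> m \<longrightarrow> x \<in> I m \<or> y \<in> I n \<longrightarrow>
        pcomp P m n i x y \<in> I (m + n - 1))"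

text \<open>Below, graded subsets of an operad are sets of pairs of an arity and an element.\<close>

definition generates :: "('k::field, 'v) ns_operad \<Rightarrow> (nat \<times> 'v) set \<Rightarrow> bool" where
  "generates P G \<longleftrightarrow>
     (\<forall>(n, x)\<in>G. x \<in> elems P n) \<and>
     (\<forall>S. suboperad P S \<and> (\<forall>(n, x)\<in>G. x \<in> S n) \<longrightarrow> (\<forall>n. S n = elems P n))"

definition minimal_generating_set :: "('k::field, 'v) ns_operad \<Rightarrow> (nat \<times> 'v) set \<Rightarrow> bool" where
  "minimal_generating_set P G \<longleftrightarrow> generates P G \<and> (\<forall>H. H \<subset> G \<longrightarrow> \<not> generates P H)"

definition generated_ideal :: "('k::field, 'v) ns_operad \<Rightarrow> (nat \<times> 'v) set \<Rightarrow> nat \<Rightarrow> 'v set" where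
  "generated_ideal P R n = \<Inter>{I n | I. operad_ideal P I \<and> (\<forall>(m, x)\<in>R. x \<in> I m)}"

text \<open>For an operad ideal \<open>I\<close>, the union in \<open>pcomp\<close> is over equal cosets.\<close>

definition quotient_operad ::
  "('k::field, 'v) ns_operad \<Rightarrow> (nat \<Rightarrow> 'v set) \<Rightarrow> ('k, 'v set) ns_operad" where
  "quotient_operad P I =
     \<lparr>component = (\<lambda>n. quotient_module (component P n) (I n)),
      pcomp = (\<lambda>m n i A B. \<Union>x\<in>A. \<Union>y\<in>B.
        I (m + n - 1) +>\<^bsub>component P (m + n - 1)\<^esub> pcomp P m n i x y),
      ounit = I 1 +>\<^bsub>component P 1\<^esub> ounit P\<rparr>"

text \<open>
  The operad whose component of arity \<open>n\<close> has the basis \<open>B n\<close> and whose partial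
  compositions extend \<open>c i\<close> bilinearly.
\<close>

definition based_operad ::
  "(nat \<Rightarrow> 'b set) \<Rightarrow> (nat \<Rightarrow> 'b \<Rightarrow> 'b \<Rightarrow> 'b) \<Rightarrow> 'b \<Rightarrow> ('k::field, 'b \<Rightarrow>\<^sub>0 'k) ns_operad" where
  "based_operad B c e =
     \<lparr>component = (\<lambda>n. free_module (B n)),
      pcomp = (\<lambda>m n i f g.
        \<Sum>x\<in>Poly_Mapping.keys f. \<Sum>y\<in>Poly_Mapping.keys g.
          Poly_Mapping.single (c i x y)
            (Poly_Mapping.lookup f x * Poly_Mapping.lookup g y)),
      ounit = Poly_Mapping.single e 1\<rparr>"


section \<open>Planar trees and free operads\<close>

datatype 'g ptree = Leaf | Node 'g "'g ptree list"

fun leaves :: "'g ptree \<Rightarrow> nat" where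
  "leaves Leaf = 1"
| "leaves (Node g ts) = sum_list (map leaves ts)"

fun nodes :: "'g ptree \<Rightarrow> nat" where
  "nodes Leaf = 0"
| "nodes (Node g ts) = Suc (sum_list (map nodes ts))"

text \<open>Trees in which a node with \<open>k\<close> children carries a label \<open>g\<close> with \<open>(k, g) \<in> Sig\<close>.\<close>

fun tree_over :: "(nat \<times> 'g) set \<Rightarrow> 'g ptree \<Rightarrow> bool" where
  "tree_over Sig Leaf \<longleftrightarrow> True"
| "tree_over Sig (Node g ts) \<longleftrightarrow> (length ts, g) \<in> Sig \<and> (\<forall>t\<in>set ts. tree_over Sig t)"

text \<open>\<open>graft i s t\<close> replaces the \<open>i\<close>-th leaf of \<open>s\<close> from the left, counted from 1, by \<open>t\<close>.\<close>

fun graft :: "nat \<Rightarrow> 'g ptree \<Rightarrow> 'g ptree \<Rightarrow> 'g ptree"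
  and graft_forest :: "nat \<Rightarrow> 'g ptree list \<Rightarrow> 'g ptree \<Rightarrow> 'g ptree list" where
  "graft i Leaf t = t"
| "graft i (Node g ts) t = Node g (graft_forest i ts t)"
| "graft_forest i [] t = []"
| "graft_forest i (s # ss) t =
     (if i \<le> leaves s then graft i s t # ss else s # graft_forest (i - leaves s) ss t)"

definition free_operad :: "(nat \<times> 'g) set \<Rightarrow> ('k::field, 'g ptree \<Rightarrow>\<^sub>0 'k) ns_operad" where
  "free_operad Sig = based_operad (\<lambda>n. {t. tree_over Sig t \<and> leaves t = n}) graft Leaf"

definition free_gen :: "nat \<Rightarrow> 'g \<Rightarrow> 'g ptree \<Rightarrow>\<^sub>0 'k::field" where
  "free_gen k g = Poly_Mapping.single (Node g (replicate k Leaf)) 1"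

text \<open>By the universal property of the free operad, at most one morphism satisfies this.\<close>

definition canonical_hom ::
  "(nat \<times> 'g) set \<Rightarrow> (nat \<Rightarrow> 'g \<Rightarrow> 'v) \<Rightarrow> ('k::field, 'v) ns_operad \<Rightarrow>
   (nat \<Rightarrow> ('g ptree \<Rightarrow>\<^sub>0 'k) \<Rightarrow> 'v) \<Rightarrow> bool" where
  "canonical_hom Sig \<gamma> P \<phi> \<longleftrightarrow>
     operad_hom (free_operad Sig) P \<phi> \<and> (\<forall>(k, g)\<in>Sig. \<phi> k (free_gen k g) = \<gamma> k g)"


section \<open>The bar construction and Koszul operads\<close>

text \<open>
  Let \<open>P\<close> be an operad with \<open>P(0) = 0\<close> and \<open>P(1)\<close> spanned by the unit.  The part of arity \<open>n\<close>
  and degree \<open>k\<close> of its bar construction is the sum, over all planar trees with \<open>n\<close> leaves and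
  \<open>k\<close> nodes, each with at least two children, of the tensor product of the spaces \<open>P(j)\<close>, one
  for each node with \<open>j\<close> children.  It is represented as the quotient of the free module on
  \<open>bar_trees P n k\<close> by the subspace \<open>bar_null P n k\<close>, which expresses multilinearity in the
  labels of the nodes.
\<close>

definition bar_trees :: "('k::field, 'v) ns_operad \<Rightarrow> nat \<Rightarrow> nat \<Rightarrow> 'v ptree set" where
  "bar_trees P n k =
     {t. tree_over {(j, x). 2 \<le> j \<and> x \<in> elems P j} t \<and> leaves t = n \<and> nodes t = k}"

text \<open>
  \<open>linear_node P a b t t1 t2\<close>: the three trees differ only in the label of one node, and
  there the label of \<open>t\<close> is \<open>a\<close> times that of \<open>t1\<close> plus \<open>b\<close> times that of \<open>t2\<close>.
\<close>

inductive linear_node ::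
  "('k::field, 'v) ns_operad \<Rightarrow> 'k \<Rightarrow> 'k \<Rightarrow> 'v ptree \<Rightarrow> 'v ptree \<Rightarrow> 'v ptree \<Rightarrow> bool"
  for P :: "('k::field, 'v) ns_operad" and a b :: 'k where
  root: "M = component P (length ts) \<Longrightarrow> x \<in> carrier M \<Longrightarrow> y \<in> carrier M \<Longrightarrow>
    linear_node P a b
      (Node ((a \<odot>\<^bsub>M\<^esub> x) \<oplus>\<^bsub>M\<^esub> (b \<odot>\<^bsub>M\<^esub> y)) ts) (Node x ts) (Node y ts)"
| child: "linear_node P a b s s1 s2 \<Longrightarrow>
    linear_node P a b
      (Node x (ts @ s # us)) (Node x (ts @ s1 # us)) (Node x (ts @ s2 # us))"

definition bar_null :: "('k::field, 'v) ns_operad \<Rightarrow> nat \<Rightarrow> nat \<Rightarrow> ('v ptree \<Rightarrow>\<^sub>0 'k) set" where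
  "bar_null P n k = span_in (free_module (bar_trees P n k))
     {Poly_Mapping.single t 1 - Poly_Mapping.single t1 a - Poly_Mapping.single t2 b | t t1 t2 a b.
        linear_node P a b t t1 t2 \<and>
        t \<in> bar_trees P n k \<and> t1 \<in> bar_trees P n k \<and> t2 \<in> bar_trees P n k}"

text \<open>
  All trees obtained from a tree by contracting one edge between two nodes and composing
  their labels, listed in the preorder of the lower node of the contracted edge.
\<close>

function contractions :: "('k, 'v) ns_operad \<Rightarrow> 'v ptree \<Rightarrow> 'v ptree list" where
  "contractions P Leaf = []"
| "contractions P (Node x ts) =
     concat (map (\<lambda>i.
       (case ts ! i of
          Leaf \<Rightarrow> []
        | Node y us \<Rightarrow>
            [Node (pcomp P (length ts) (length us) (Suc i) x y)
               (take i ts @ us @ drop (Suc i) ts)]) @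
       map (\<lambda>t. Node x (ts[i := t])) (contractions P (ts ! i)))
     [0..<length ts])"
  by pat_completeness auto
termination
  by (relation "measure (\<lambda>(P, t). size t)")
     (auto simp: less_Suc_eq_le intro!: size_list_estimation'[OF nth_mem])

text \<open>
  Each node has degree 1.  If the nodes are tensored in preorder, numbered from 0, then moving the
  label of the lower node \<open>q\<close> of an edge next to that of its parent \<open>p\<close> costs the sign
  \<open>(-1) ^ (q - p - 1)\<close> and applying the operation of degree -1 there costs \<open>(-1) ^ p\<close>.  The
  lower nodes of the edges are the nodes 1, 2, ..., so the edge at position \<open>j\<close> of
  \<^const>\<open>contractions\<close> gets the sign \<open>(-1) ^ j\<close>.
\<close>

definition bar_diff ::
  "('k::field, 'v) ns_operad \<Rightarrow> ('v ptree \<Rightarrow>\<^sub>0 'k) \<Rightarrow> ('v ptree \<Rightarrow>\<^sub>0 'k)" where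
  "bar_diff P z =
     (\<Sum>t\<in>Poly_Mapping.keys z. \<Sum>j<length (contractions P t).
        Poly_Mapping.single (contractions P t ! j) ((-1) ^ j * Poly_Mapping.lookup z t))"

text \<open>
  Vanishing of the homology of the bar construction in arity \<open>n\<close> and degree \<open>k\<close>, stated with
  representatives modulo \<^const>\<open>bar_null\<close>.
\<close>

definition bar_acyclic_at :: "('k::field, 'v) ns_operad \<Rightarrow> nat \<Rightarrow> nat \<Rightarrow> bool" where
  "bar_acyclic_at P n k \<longleftrightarrow>
     (\<forall>z\<in>carrier (free_module (bar_trees P n k)).
        bar_diff P z \<in> bar_null P n (k - 1) \<longrightarrow>
        (\<exists>y\<in>carrier (free_module (bar_trees P n (Suc k))). z - bar_diff P y \<in> bar_null P n k))"

text \<open>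
  An operad generated in arity 2 is weighted by the arity minus 1, so the diagonal of its bar
  construction, where the degree equals the weight, consists of the pairs \<open>n\<close>, \<open>k\<close> with
  \<open>k = n - 1\<close>.  The operad is Koszul if the homology of its bar construction is concentrated on
  the diagonal.  Vanishing in degrees 1 and 2 off the diagonal already says that the operad is
  generated in arity 2, with quadratic relations.
\<close>

definition koszul :: "('k::field, 'v) ns_operad \<Rightarrow> bool" where
  "koszul P \<longleftrightarrow>
     nonsymmetric_operad P \<and>
     elems P 0 = {\<zero>\<^bsub>component P 0\<^esub>} \<and>
     elems P 1 = span_in (component P 1) {ounit P} \<and> ounit P \<noteq> \<zero>\<^bsub>component P 1\<^esub> \<and>
     (\<forall>n k. Suc k \<noteq> n \<longrightarrow> bar_acyclic_at P n k)"


section \<open>Cliffs, hills and their operads\<close>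

definition cliffs :: "nat \<Rightarrow> nat list set" where
  "cliffs c = {w. set w \<subseteq> {0..c}}"

definition hills :: "nat \<Rightarrow> nat list set" where
  "hills c = {w \<in> cliffs c. sorted w}"

definition arity :: "nat list \<Rightarrow> nat" where
  "arity w = length w + 1"

abbreviation word_le :: "nat list \<Rightarrow> nat list \<Rightarrow> bool" (infix \<open>\<preceq>\<close> 50) where
  "u \<preceq> v \<equiv> list_all2 (\<le>) u v"

text \<open>
  Intervals may be taken among all words: a word below a word on \<open>{0..c}\<close> is itself a word
  on \<open>{0..c}\<close>.
\<close>

function moebius :: "nat list \<Rightarrow> nat list \<Rightarrow> int" where
  "moebius u v =
     (if u = v then 1
      else if u \<preceq> v then - (\<Sum>w\<in>{w. u \<preceq> w \<and> w \<preceq> v \<and> w \<noteq> v}. moebius u w)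
      else 0)"
  by pat_completeness auto

lemma sum_list_less_if_word_less:
  assumes "w \<preceq> v" "w \<noteq> v"
  shows "sum_list w < sum_list v"
proof -
  have "sum_list w \<le> sum_list v \<and> (w \<noteq> v \<longrightarrow> sum_list w < sum_list v)"
    using assms(1) by (induction rule: list_all2_induct) auto
  with assms(2) show ?thesis by blast
qed

termination moebius
  by (relation "measure (\<lambda>(u, v). sum_list v)") (auto intro: sum_list_less_if_word_less)

declare moebius.simps [simp del]

definition E_cl :: "nat list \<Rightarrow> nat list \<Rightarrow>\<^sub>0 'k::field" where
  "E_cl w = Poly_Mapping.single w 1"

definition F_cl :: "nat \<Rightarrow> nat list \<Rightarrow> nat list \<Rightarrow>\<^sub>0 'k::field" where
  "F_cl c w = (\<Sum>w'\<in>{w' \<in> cliffs c. w \<preceq> w'}. Poly_Mapping.single w' (of_int (moebius w w')))"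

definition Cl :: "nat \<Rightarrow> ('k::field, nat list \<Rightarrow>\<^sub>0 'k) ns_operad" where
  "Cl c = based_operad (\<lambda>n. {w \<in> cliffs c. arity w = n})
     (\<lambda>i u v. take (i - 1) u @ v @ drop (i - 1) u) []"

definition hill_ideal :: "nat \<Rightarrow> nat \<Rightarrow> (nat list \<Rightarrow>\<^sub>0 'k::field) set" where
  "hill_ideal c n = span_in (component (Cl c) n) {F_cl c w | w. w \<in> cliffs c - hills c \<and> arity w = n}"

definition Hi :: "nat \<Rightarrow> ('k::field, (nat list \<Rightarrow>\<^sub>0 'k) set) ns_operad" where
  "Hi c = quotient_operad (Cl c) (hill_ideal c)"

definition E_hi :: "nat \<Rightarrow> nat list \<Rightarrow> (nat list \<Rightarrow>\<^sub>0 'k::field) set" where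
  "E_hi c w = hill_ideal c (arity w) +>\<^bsub>component (Cl c) (arity w)\<^esub> E_cl w"


section \<open>The relations between the generators\<close>

text \<open>The generator of the free operad corresponding to \<open>E_hi c [a]\<close> is the symbol \<open>a\<close>, of arity 2.\<close>

definition letters :: "nat \<Rightarrow> (nat \<times> nat) set" where
  "letters c = {(2, a) | a. a \<in> {0..c}}"

definition free_pair :: "nat \<Rightarrow> nat \<Rightarrow> nat \<Rightarrow> nat \<Rightarrow> nat ptree \<Rightarrow>\<^sub>0 'k::field" where
  "free_pair c i a b = pcomp (free_operad (letters c)) 2 2 i (free_gen 2 a) (free_gen 2 b)"

definition hill_relators :: "nat \<Rightarrow> (nat \<times> (nat ptree \<Rightarrow>\<^sub>0 'k::field)) set" where
  "hill_relators c =
     {(3, free_pair c 1 a b - free_pair c 2 b a') | a a' b. b \<in> {0..c} \<and> a \<in> {0..b} \<and> a' \<in> {0..b}} \<union>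
     {(3, free_pair c 1 b a - free_pair c 2 a b) | a b. b \<in> {0..c} \<and> a < b}"

end

theory Submission
  imports Defs
begin

text \<open>
  Modulo the ideal, \<open>E_w\<close> equals \<open>E_h\<close> for the least hill \<open>h\<close> above \<open>w\<close>, the word of running
  maxima of \<open>w\<close>: the Moebius function cancels on all other words.  So the operad is the
  linearization of a set operad on hills, in which one inserts words and takes running maxima.

  In the free operad, the relations identify a tree with its left rotation and allow to replace a
  letter by a larger letter on its left.  The first kind of move turns a tree into the right comb of
  its in-order word, the second one turns this word into its running maxima; right combs of hills are
  therefore normal forms.

  Koszulness is the PBW argument in the form of an algebraic discrete Morse matching.  Refining each
  node of a bar tree into its normal form gives binary trees whose right edges \<open>a \<rightarrow> b\<close> with
  \<open>a \<le> b\<close> may be joined or cut.  Contracting a cut edge of this kind joins it, and all other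
  contractions lower a rank.  Toggling the first joinable edge matches all trees except those
  without joinable edges, and those lie on the diagonal.
\<close>


section \<open>Linear extension\<close>

text \<open>The hull enters because \<open>E_w\<close> is the sum of the \<open>F_v\<close> with v
  above w: only hills v survive in the quotient, and a hill lies above w exactly when it lies above
  the running maxima of w.

  In the bar construction labels are arbitrary vectors and tensor products are given by generators
  modulo \<open>bar_null\<close>, so no basis is at hand. Bar trees have to be expanded into trees
  labelled by hills, and dual coefficients have to show that these stay independent modulo
  \<open>bar_null\<close>. The binary refinement lists contractions in the order of the bar
  differential, so signs are never compared.

  The rank falls for two reasons. Contracting a left edge is a rotation and shrinks a left subtree;
  contracting a right edge from a to b with a > b raises b, and letters are bounded by
  \<open>c\<close>. No contracting homotopy is built: modulo boundaries every chain below the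
  diagonal is supported on cut trees, and a cycle supported on cut trees is 0, by its terms of
  maximal rank. A tree without joinable edges has a separate node for each letter, so its degree is
  its arity minus 1.\<close>

abbreviation keys :: "('a \<Rightarrow>\<^sub>0 'b::zero) \<Rightarrow> 'a set" where
  "keys \<equiv> Poly_Mapping.keys"

abbreviation lookup :: "('a \<Rightarrow>\<^sub>0 'b::zero) \<Rightarrow> 'a \<Rightarrow> 'b" where
  "lookup \<equiv> Poly_Mapping.lookup"

abbreviation single :: "'a \<Rightarrow> 'b \<Rightarrow> 'a \<Rightarrow>\<^sub>0 'b::zero" where
  "single \<equiv> Poly_Mapping.single"

definition scale :: "'k::field \<Rightarrow> ('b \<Rightarrow>\<^sub>0 'k) \<Rightarrow> ('b \<Rightarrow>\<^sub>0 'k)" where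
  "scale a = Poly_Mapping.map ((*) a)"

lemma lookup_scale [simp]:
  "lookup (scale a f) x = a * lookup f x"
  by (simp add: scale_def Poly_Mapping.map.rep_eq when_def)

lemma scale_single [simp]: "scale a (single x b) = single x (a * b)"
  by (simp add: scale_def map_single)

lemma scale_add: "scale a (f + g) = scale a f + scale a g"
  and scale_diff: "scale a (f - g) = scale a f - scale a g"
  and scale_add_left: "scale (a + b) f = scale a f + scale b f"
  and scale_scale [simp]: "scale a (scale b f) = scale (a * b) f"
  and scale_one [simp]: "scale 1 f = f"
  and scale_zero_left [simp]: "scale 0 f = 0"
  and scale_zero_right [simp]: "scale a 0 = 0"
  and scale_minus_one: "scale (- 1) f = - f"
  and scale_uminus: "scale (- a) f = - scale a f"
  by (rule poly_mapping_eqI; simp add: lookup_add lookup_minus algebra_simps)+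

lemma scale_sum: "scale a (\<Sum>x\<in>A. f x) = (\<Sum>x\<in>A. scale a (f x))"
  by (rule poly_mapping_eqI) (simp add: lookup_sum sum_distrib_left)

lemma keys_scale: "keys (scale a f) \<subseteq> keys f"
  by (auto simp: in_keys_iff)

lemma keys_subset:
  "keys f \<subseteq> B \<Longrightarrow> keys g \<subseteq> B \<Longrightarrow> keys (f + g) \<subseteq> B"
  "keys f \<subseteq> B \<Longrightarrow> keys g \<subseteq> B \<Longrightarrow> keys (f - g) \<subseteq> B"
  "keys f \<subseteq> B \<Longrightarrow> keys (scale a f) \<subseteq> B"
  using Poly_Mapping.keys_add[of f g] keys_diff[of f g] keys_scale[of a f] by auto

definition lext :: "('a \<Rightarrow> 'b \<Rightarrow>\<^sub>0 'k::field) \<Rightarrow> ('a \<Rightarrow>\<^sub>0 'k) \<Rightarrow> 'b \<Rightarrow>\<^sub>0 'k" where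
  "lext g f = (\<Sum>x\<in>keys f. scale (lookup f x) (g x))"

lemma lext_superset:
  assumes "finite A" "keys f \<subseteq> A"
  shows "lext g f = (\<Sum>x\<in>A. scale (lookup f x) (g x))"
  unfolding lext_def using assms by (intro sum.mono_neutral_left) (auto simp: in_keys_iff)

lemma lext_add: "lext g (f + f') = lext g f + lext g f'"
proof -
  let ?A = "keys f \<union> keys f'"
  have "lext g h = (\<Sum>x\<in>?A. scale (lookup h x) (g x))"
    if "h \<in> {f, f', f + f'}" for h
    using that Poly_Mapping.keys_add[of f f'] by (intro lext_superset) auto
  then show ?thesis
    by (simp add: lookup_add scale_add_left sum.distrib)
qed

lemma lext_scale: "lext g (scale a f) = scale a (lext g f)"
  by (subst lext_superset[OF finite_keys keys_scale]) (simp add: lext_def scale_sum)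

lemma lext_zero [simp]: "lext g 0 = 0"
  by (simp add: lext_def)

lemma lext_single [simp]: "lext g (single x a) = scale a (g x)"
  by (subst lext_superset[of "{x}"]) auto

lemma lext_uminus: "lext g (- f) = - lext g f"
  using lext_scale[of g "- 1" f] by (simp add: scale_minus_one)

lemma lext_diff: "lext g (f - f') = lext g f - lext g f'"
  using lext_add[of g f "- f'"] by (simp add: lext_uminus)

lemma lext_sum: "lext g (\<Sum>x\<in>A. f x) = (\<Sum>x\<in>A. lext g (f x))"
  by (induction A rule: infinite_finite_induct) (auto simp: lext_add)

lemma lext_cong:
  "(\<And>x. x \<in> keys f \<Longrightarrow> g x = g' x) \<Longrightarrow> lext g f = lext g' f"
  by (simp add: lext_def)

lemma lext_lext: "lext g (lext h f) = lext (\<lambda>x. lext g (h x)) f"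
  by (simp add: lext_def[of h] lext_def[of "\<lambda>x. lext g (h x)"] lext_sum lext_scale)

lemma lext_fun_add: "lext (\<lambda>x. g x + h x) f = lext g f + lext h f"
  and lext_fun_scale: "lext (\<lambda>x. scale a (g x)) f = scale a (lext g f)"
  by (simp_all add: lext_def scale_add sum.distrib scale_sum mult.commute)

lemma lext_fun_diff: "lext (\<lambda>x. g x - h x) f = lext g f - lext h f"
  by (simp add: lext_def scale_diff sum_subtractf)

lemma lext_fun_zero [simp]: "lext (\<lambda>x. 0) f = 0"
  by (simp add: lext_def)

lemma single_expansion: "f = lext (\<lambda>x. single x 1) f"
proof (rule poly_mapping_eqI)
  fix y
  show "lookup f y = lookup (lext (\<lambda>x. single x 1) f) y"
    by (cases "y \<in> keys f")
      (simp_all add: lext_def lookup_sum lookup_single when_def in_keys_iff if_distrib cong: if_cong)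
qed

lemma lookup_lext:
  "lookup (lext g f) y =
     (\<Sum>x\<in>keys f. lookup f x * lookup (g x) y)"
  by (simp add: lext_def lookup_sum)

lemma lext_swap:
  "lext (\<lambda>x. lext (\<lambda>y. h x y) g) f = lext (\<lambda>y. lext (\<lambda>x. h x y) f) g"
  by (simp add: lext_def scale_sum sum.swap[of _ "keys g"] mult.commute)

definition push :: "('a \<Rightarrow> 'b) \<Rightarrow> ('a \<Rightarrow>\<^sub>0 'k::field) \<Rightarrow> 'b \<Rightarrow>\<^sub>0 'k" where
  "push e = lext (\<lambda>x. single (e x) 1)"

lemma push_add: "push e (f + g) = push e f + push e g"
  and push_diff: "push e (f - g) = push e f - push e g"
  and push_scale: "push e (scale a f) = scale a (push e f)"
  and push_zero [simp]: "push e 0 = 0"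
  and push_single [simp]: "push e (single x a) = single (e x) a"
  by (simp_all add: push_def lext_add lext_diff lext_scale)

lemma keys_push: "keys (push e f) \<subseteq> e ` keys f"
  unfolding push_def lext_def
  by (rule order_trans[OF keys_sum]) (auto simp: map_single split: if_splits)

lemma push_push: "push e (push e' f) = push (e \<circ> e') f"
  unfolding push_def by (simp add: lext_lext)

lemma push_ident: "(\<And>x. x \<in> keys f \<Longrightarrow> e x = x) \<Longrightarrow> push e f = f"
  unfolding push_def by (subst (2) single_expansion[of f], rule lext_cong) simp


section \<open>Vector spaces on explicit carriers\<close>

lemma carrier_scalars [simp]: "carrier (scalars :: 'k::field ring) = UNIV"
  by (simp add: ring_of_type_algebra_def)

lemma free_module_simps [simp]:
  "carrier (free_module B) = {f. keys f \<subseteq> B}"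
  "\<zero>\<^bsub>free_module B\<^esub> = 0"
  "f \<oplus>\<^bsub>free_module B\<^esub> g = f + g"
  "a \<odot>\<^bsub>free_module B\<^esub> f = scale a f"
  by (simp_all add: free_module_def scale_def)

lemma moduleI_scalars:
  fixes M :: "('k::field, 'v) module"
  assumes "abelian_group M"
    and "\<And>a x. x \<in> carrier M \<Longrightarrow> a \<odot>\<^bsub>M\<^esub> x \<in> carrier M"
    and "\<And>a b x. x \<in> carrier M \<Longrightarrow> (a + b) \<odot>\<^bsub>M\<^esub> x = (a \<odot>\<^bsub>M\<^esub> x) \<oplus>\<^bsub>M\<^esub> (b \<odot>\<^bsub>M\<^esub> x)"
    and "\<And>a x y. x \<in> carrier M \<Longrightarrow> y \<in> carrier M \<Longrightarrow>
           a \<odot>\<^bsub>M\<^esub> (x \<oplus>\<^bsub>M\<^esub> y) = (a \<odot>\<^bsub>M\<^esub> x) \<oplus>\<^bsub>M\<^esub> (a \<odot>\<^bsub>M\<^esub> y)"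
    and "\<And>a b x. x \<in> carrier M \<Longrightarrow> (a * b) \<odot>\<^bsub>M\<^esub> x = a \<odot>\<^bsub>M\<^esub> (b \<odot>\<^bsub>M\<^esub> x)"
    and "\<And>x. x \<in> carrier M \<Longrightarrow> 1 \<odot>\<^bsub>M\<^esub> x = x"
  shows "Module.module scalars M"
  using assms cring_from_type_algebra
  by (intro moduleI) (auto simp: ring_of_type_algebra_def)

lemma module_free_module: "Module.module scalars (free_module B)"
proof (rule moduleI_scalars)
  show "abelian_group (free_module B)"
  proof (rule abelian_groupI)
    fix f assume "f \<in> carrier (free_module B)"
    then show "\<exists>g\<in>carrier (free_module B). g \<oplus>\<^bsub>free_module B\<^esub> f = \<zero>\<^bsub>free_module B\<^esub>"
      by (intro bexI[of _ "- f"]) auto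
  qed (use Poly_Mapping.keys_add in \<open>fastforce simp: ac_simps\<close>)+
qed (use keys_scale in \<open>force simp: scale_add scale_add_left\<close>)+

lemma smult_scalars:
  fixes M :: "('k::field, 'v) module"
  assumes "Module.module scalars M"
  shows "x \<in> carrier M \<Longrightarrow> a \<odot>\<^bsub>M\<^esub> x \<in> carrier M"
    and "x \<in> carrier M \<Longrightarrow> (a + b) \<odot>\<^bsub>M\<^esub> x = (a \<odot>\<^bsub>M\<^esub> x) \<oplus>\<^bsub>M\<^esub> (b \<odot>\<^bsub>M\<^esub> x)"
    and "x \<in> carrier M \<Longrightarrow> y \<in> carrier M \<Longrightarrow>
           a \<odot>\<^bsub>M\<^esub> (x \<oplus>\<^bsub>M\<^esub> y) = (a \<odot>\<^bsub>M\<^esub> x) \<oplus>\<^bsub>M\<^esub> (a \<odot>\<^bsub>M\<^esub> y)"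
    and "x \<in> carrier M \<Longrightarrow> (a * b) \<odot>\<^bsub>M\<^esub> x = a \<odot>\<^bsub>M\<^esub> (b \<odot>\<^bsub>M\<^esub> x)"
    and "x \<in> carrier M \<Longrightarrow> 1 \<odot>\<^bsub>M\<^esub> x = x"
    and "x \<in> carrier M \<Longrightarrow> 0 \<odot>\<^bsub>M\<^esub> x = \<zero>\<^bsub>M\<^esub>"
    and "x \<in> carrier M \<Longrightarrow> (- 1) \<odot>\<^bsub>M\<^esub> x = \<ominus>\<^bsub>M\<^esub> x"
proof -
  interpret Module.module scalars M by fact
  show "x \<in> carrier M \<Longrightarrow> a \<odot>\<^bsub>M\<^esub> x \<in> carrier M"
    by simp
  show distr: "(a + b) \<odot>\<^bsub>M\<^esub> x = (a \<odot>\<^bsub>M\<^esub> x) \<oplus>\<^bsub>M\<^esub> (b \<odot>\<^bsub>M\<^esub> x)" if "x \<in> carrier M" for a b x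
    using smult_l_distr[of a b x] that by (simp add: ring_of_type_algebra_def)
  show "x \<in> carrier M \<Longrightarrow> y \<in> carrier M \<Longrightarrow>
           a \<odot>\<^bsub>M\<^esub> (x \<oplus>\<^bsub>M\<^esub> y) = (a \<odot>\<^bsub>M\<^esub> x) \<oplus>\<^bsub>M\<^esub> (a \<odot>\<^bsub>M\<^esub> y)"
    by (simp add: smult_r_distr)
  show "x \<in> carrier M \<Longrightarrow> (a * b) \<odot>\<^bsub>M\<^esub> x = a \<odot>\<^bsub>M\<^esub> (b \<odot>\<^bsub>M\<^esub> x)"
    using smult_assoc1[of a b x] by (simp add: ring_of_type_algebra_def)
  show one: "1 \<odot>\<^bsub>M\<^esub> x = x" if "x \<in> carrier M" for x
    using smult_one[of x] that by (simp add: ring_of_type_algebra_def)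
  show zero: "0 \<odot>\<^bsub>M\<^esub> x = \<zero>\<^bsub>M\<^esub>" if "x \<in> carrier M" for x
    using smult_l_null[of x] that by (simp add: ring_of_type_algebra_def)
  show "(- 1) \<odot>\<^bsub>M\<^esub> x = \<ominus>\<^bsub>M\<^esub> x" if x: "x \<in> carrier M"
    using distr[of x "- 1" 1] x by (simp add: one zero minus_equality)
qed

lemma submodule_iff:
  fixes M :: "('k::field, 'v) module"
  assumes M: "Module.module scalars M"
  shows "submodule H scalars M \<longleftrightarrow>
    H \<subseteq> carrier M \<and> \<zero>\<^bsub>M\<^esub> \<in> H \<and> (\<forall>x\<in>H. \<forall>y\<in>H. x \<oplus>\<^bsub>M\<^esub> y \<in> H) \<and> (\<forall>a. \<forall>x\<in>H. a \<odot>\<^bsub>M\<^esub> x \<in> H)"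
    (is "_ \<longleftrightarrow> ?R")
proof
  interpret Module.module scalars M by fact
  assume H: "submodule H scalars M"
  then obtain x where x: "x \<in> H" "x \<in> carrier M"
    using submoduleE(1,2) by blast
  then have "0 \<odot>\<^bsub>M\<^esub> x \<in> H"
    using submoduleE(4)[OF H] by simp
  then have "\<zero>\<^bsub>M\<^esub> \<in> H"
    using smult_scalars(6)[OF M] x by simp
  then show ?R
    using submoduleE[OF H] by auto
next
  assume R: ?R
  then show "submodule H scalars M"
    using smult_scalars(7)[OF M] by (intro Module.module.submoduleI[OF M]) (auto, metis subsetD)
qed

lemma submodule_free_module_iff:
  "submodule H scalars (free_module B) \<longleftrightarrow>
    (\<forall>f\<in>H. keys f \<subseteq> B) \<and> 0 \<in> H \<and> (\<forall>f\<in>H. \<forall>g\<in>H. f + g \<in> H) \<and>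
    (\<forall>a. \<forall>f\<in>H. scale a f \<in> H)"
  by (auto simp: submodule_iff[OF module_free_module])

lemma submodule_free_module_closed:
  assumes H: "submodule H scalars (free_module B)"
  shows "0 \<in> H" "f \<in> H \<Longrightarrow> g \<in> H \<Longrightarrow> f + g \<in> H" "f \<in> H \<Longrightarrow> scale a f \<in> H"
    "f \<in> H \<Longrightarrow> - f \<in> H"
    "f \<in> H \<Longrightarrow> g \<in> H \<Longrightarrow> f - g \<in> H" "(\<And>x. x \<in> A \<Longrightarrow> h x \<in> H) \<Longrightarrow> sum h A \<in> H"
    "(\<And>x. x \<in> keys u \<Longrightarrow> k x \<in> H) \<Longrightarrow> lext k u \<in> H"
proof -
  show *: "0 \<in> H" "\<And>f g. f \<in> H \<Longrightarrow> g \<in> H \<Longrightarrow> f + g \<in> H" "\<And>f a. f \<in> H \<Longrightarrow> scale a f \<in> H"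
    using H by (auto simp: submodule_free_module_iff)
  show neg: "- f \<in> H" if "f \<in> H" for f
    using *(3)[OF that, of "- 1"] by (simp add: scale_minus_one)
  show "f \<in> H \<Longrightarrow> g \<in> H \<Longrightarrow> f - g \<in> H"
    using *(2)[OF _ neg, of f g] by simp
  show **: "(\<And>x. x \<in> A \<Longrightarrow> h x \<in> H) \<Longrightarrow> sum h A \<in> H" for h :: "'z \<Rightarrow> _" and A
    by (induction A rule: infinite_finite_induct) (auto simp: *)
  show "(\<And>x. x \<in> keys u \<Longrightarrow> k x \<in> H) \<Longrightarrow> lext k u \<in> H"
    unfolding lext_def by (rule **) (simp add: *)
qed

lemma lext_closed: "(\<And>x. x \<in> keys f \<Longrightarrow> keys (g x) \<subseteq> B) \<Longrightarrow> keys (lext g f) \<subseteq> B"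
  using submodule_free_module_closed(7)[of "{f. keys f \<subseteq> B}" B f g]
    Module.module.carrier_is_submodule[OF module_free_module, of B] by auto

text \<open>Approximation modulo a subspace is linear, so approximating basis vectors is enough.
  Each reduction argument ends here: words modulo the ideal, binary trees modulo boundaries, bar
  trees modulo \<open>bar_null\<close>.\<close>

lemma lext_approximation:
  assumes H: "submodule H scalars (free_module B)"
    and f: "\<And>x. x \<in> keys f \<Longrightarrow> \<exists>y. keys y \<subseteq> A \<and> single x 1 - lext h y \<in> H"
  shows "\<exists>y. keys y \<subseteq> A \<and> f - lext h y \<in> H"
proof -
  obtain y where y: "\<And>x. x \<in> keys f \<Longrightarrow> keys (y x) \<subseteq> A"
    "\<And>x. x \<in> keys f \<Longrightarrow> single x 1 - lext h (y x) \<in> H"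
    using bchoice[of "keys f" "\<lambda>x y. keys y \<subseteq> A \<and> single x 1 - lext h y \<in> H"] f by blast
  have "f - lext h (lext y f) = lext (\<lambda>x. single x 1 - lext h (y x)) f"
    by (simp add: lext_fun_diff lext_lext single_expansion[symmetric])
  also have "\<dots> \<in> H"
    using y(2) by (rule submodule_free_module_closed(7)[OF H])
  finally show ?thesis
    by (intro exI[of _ "lext y f"] conjI lext_closed y(1))
qed

lemma submodule_span_in:
  assumes M: "Module.module scalars M" and S: "S \<subseteq> carrier M"
  shows "submodule (span_in M S) scalars M"
proof -
  interpret Module.module scalars M by fact
  show ?thesis
    unfolding submodule_iff[OF M] span_in_def
    using carrier_is_submodule S by (auto simp: submodule_iff[OF M])
qed

lemma span_in_superset: "S \<subseteq> span_in M S"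
  and span_in_minimal: "submodule H scalars M \<Longrightarrow> S \<subseteq> H \<Longrightarrow> span_in M S \<subseteq> H"
  by (auto simp: span_in_def)


section \<open>Operads with a basis closed under composition\<close>

lemma component_based_operad [simp]: "component (based_operad B c e) n = free_module (B n)"
  and ounit_based_operad [simp]: "ounit (based_operad B c e) = single e 1"
  by (simp_all add: based_operad_def)

lemma pcomp_based_operad:
  "pcomp (based_operad B c e) m n i f g = lext (\<lambda>x. lext (\<lambda>y. single (c i x y) 1) g) f"
  by (simp add: based_operad_def lext_def scale_sum)

lemma pcomp_based_operad_single [simp]:
  "pcomp (based_operad B c e) m n i (single x a) (single y b) =
     single (c i x y) (a * b)"
  by (simp add: pcomp_based_operad)

lemma pcomp_based_operad_add:
  "pcomp (based_operad B c e) m n i (f + f') g =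
     pcomp (based_operad B c e) m n i f g + pcomp (based_operad B c e) m n i f' g"
  "pcomp (based_operad B c e) m n i f (g + g') =
     pcomp (based_operad B c e) m n i f g + pcomp (based_operad B c e) m n i f g'"
  by (simp_all add: pcomp_based_operad lext_add lext_fun_add)

lemma pcomp_based_operad_diff:
  "pcomp (based_operad B c e) m n i (f - f') g =
     pcomp (based_operad B c e) m n i f g - pcomp (based_operad B c e) m n i f' g"
  "pcomp (based_operad B c e) m n i f (g - g') =
     pcomp (based_operad B c e) m n i f g - pcomp (based_operad B c e) m n i f g'"
  by (simp_all add: pcomp_based_operad lext_diff lext_fun_diff)

lemma pcomp_based_operad_scale:
  "pcomp (based_operad B c e) m n i (scale a f) g = scale a (pcomp (based_operad B c e) m n i f g)"
  "pcomp (based_operad B c e) m n i f (scale a g) = scale a (pcomp (based_operad B c e) m n i f g)"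
  by (simp_all add: pcomp_based_operad lext_scale lext_fun_scale)

lemma pcomp_based_operad_closed:
  assumes "\<And>x y. x \<in> B m \<Longrightarrow> y \<in> B n \<Longrightarrow> c i x y \<in> B (m + n - 1)"
    and "f \<in> elems (based_operad B c e) m" "g \<in> elems (based_operad B c e) n"
  shows "pcomp (based_operad B c e) m n i f g \<in> elems (based_operad B c e) (m + n - 1)"
  using assms unfolding pcomp_based_operad
  by (auto intro!: lext_closed simp del: One_nat_def) (metis subsetD)

text \<open>The axioms are multilinear, so basis elements suffice. In the parallel axiom the sums
  over \<open>g\<close> and \<open>h\<close> are nested in opposite orders on the two sides, whence
  \<open>lext_swap\<close>.\<close>

lemma nonsymmetric_operad_based_operad:
  assumes closed: "\<And>m n i x y. x \<in> B m \<Longrightarrow> y \<in> B n \<Longrightarrow> 1 \<le> i \<Longrightarrow> i \<le> m \<Longrightarrow> c i x y \<in> B (m + n - 1)"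
    and unit: "e \<in> B 1"
    and left: "\<And>n x. x \<in> B n \<Longrightarrow> c 1 e x = x"
    and right: "\<And>n i x. x \<in> B n \<Longrightarrow> 1 \<le> i \<Longrightarrow> i \<le> n \<Longrightarrow> c i x e = x"
    and sequential: "\<And>l m n i j x y z. x \<in> B l \<Longrightarrow> y \<in> B m \<Longrightarrow> z \<in> B n \<Longrightarrow>
       1 \<le> i \<Longrightarrow> i \<le> l \<Longrightarrow> 1 \<le> j \<Longrightarrow> j \<le> m \<Longrightarrow> c (i + j - 1) (c i x y) z = c i x (c j y z)"
    and parallel: "\<And>l m n i j x y z. x \<in> B l \<Longrightarrow> y \<in> B m \<Longrightarrow> z \<in> B n \<Longrightarrow>
       1 \<le> i \<Longrightarrow> i < j \<Longrightarrow> j \<le> l \<Longrightarrow> c (j + m - 1) (c i x y) z = c i (c j x z) y"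
  shows "nonsymmetric_operad (based_operad B c e :: ('k::field, 'b \<Rightarrow>\<^sub>0 'k) ns_operad)"
    (is "nonsymmetric_operad ?P")
proof (rule nonsymmetric_operad.intro)
  show "Module.module scalars (component ?P n)" for n
    by (simp add: module_free_module)
  show "linear_on (component ?P m) (component ?P (m + n - 1)) (\<lambda>x. pcomp ?P m n i x y)"
    if "1 \<le> i" "i \<le> m" "y \<in> elems ?P n" for i m n y
    unfolding linear_on_def using that pcomp_based_operad_closed[where B = B and c = c and m = m and i = i, OF closed[OF _ _ that(1,2)]]
    by (auto simp: pcomp_based_operad_add pcomp_based_operad_scale; blast)
  show "linear_on (component ?P n) (component ?P (m + n - 1)) (pcomp ?P m n i x)"
    if "1 \<le> i" "i \<le> m" "x \<in> elems ?P m" for i m n x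
    unfolding linear_on_def using that pcomp_based_operad_closed[where B = B and c = c and m = m and i = i, OF closed[OF _ _ that(1,2)]]
    by (auto simp: pcomp_based_operad_add pcomp_based_operad_scale; blast)
  show "ounit ?P \<in> elems ?P 1"
    using unit by simp
  show "pcomp ?P 1 n 1 (ounit ?P) f = f" if "f \<in> elems ?P n" for n f
    using that left[of _ n] unfolding pcomp_based_operad
    by (subst (2) single_expansion[of f]) (auto intro!: lext_cong)
  show "pcomp ?P n 1 i f (ounit ?P) = f" if "1 \<le> i" "i \<le> n" "f \<in> elems ?P n" for n i f
    using that right[of _ n i] unfolding pcomp_based_operad
    by (subst (2) single_expansion[of f]) (auto intro!: lext_cong)
  show "pcomp ?P (l + m - 1) n (i + j - 1) (pcomp ?P l m i f g) h =
      pcomp ?P l (m + n - 1) i f (pcomp ?P m n j g h)"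
    if "f \<in> elems ?P l" "g \<in> elems ?P m" "h \<in> elems ?P n" "1 \<le> i" "i \<le> l" "1 \<le> j" "j \<le> m"
    for f g h l m n i j
  proof -
    have "c (i + j - 1) (c i x y) z = c i x (c j y z)"
      if "x \<in> keys f" "y \<in> keys g" "z \<in> keys h" for x y z
      using that \<open>f \<in> _\<close> \<open>g \<in> _\<close> \<open>h \<in> _\<close> \<open>1 \<le> i\<close> \<open>i \<le> l\<close> \<open>1 \<le> j\<close> \<open>j \<le> m\<close>
      by (intro sequential[of x l y m z n]) auto
    then show ?thesis
      unfolding pcomp_based_operad by (auto simp: lext_lext simp del: One_nat_def intro!: lext_cong)
  qed
  show "pcomp ?P (l + m - 1) n (j + m - 1) (pcomp ?P l m i f g) h =
      pcomp ?P (l + n - 1) m i (pcomp ?P l n j f h) g"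
    if "f \<in> elems ?P l" "g \<in> elems ?P m" "h \<in> elems ?P n" "1 \<le> i" "i < j" "j \<le> l"
    for f g h l m n i j
  proof -
    have *: "c (j + m - 1) (c i x y) z = c i (c j x z) y"
      if "x \<in> keys f" "y \<in> keys g" "z \<in> keys h" for x y z
      using that \<open>f \<in> _\<close> \<open>g \<in> _\<close> \<open>h \<in> _\<close> \<open>1 \<le> i\<close> \<open>i < j\<close> \<open>j \<le> l\<close>
      by (intro parallel[of x l y m z n]) auto
    show ?thesis
      unfolding pcomp_based_operad
      by (simp add: lext_lext lext_swap[of _ g] * cong: lext_cong del: One_nat_def)
  qed
qed

lemma operad_hom_push:
  assumes closed: "\<And>n x. x \<in> B n \<Longrightarrow> h x \<in> B' n"
    and unit: "h e = e'"
    and comp: "\<And>m n i x y. x \<in> B m \<Longrightarrow> y \<in> B n \<Longrightarrow> 1 \<le> i \<Longrightarrow> i \<le> m \<Longrightarrow> h (c i x y) = c' i (h x) (h y)"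
  shows "operad_hom (based_operad B c e) (based_operad B' c' e' :: ('k::field, _) ns_operad) (\<lambda>n. push h)"
  unfolding operad_hom_def
proof (intro conjI allI ballI impI)
  show "linear_on (component (based_operad B c e) n)
      (component (based_operad B' c' e' :: ('k::field, _) ns_operad) n) (push h)" for n
    unfolding linear_on_def using closed keys_push[of h] by (fastforce simp: push_add push_scale)
  fix m n i and f g :: "_ \<Rightarrow>\<^sub>0 'k"
  assume *: "f \<in> elems (based_operad B c e) m" "g \<in> elems (based_operad B c e) n" "1 \<le> i" "i \<le> m"
  have "h (c i x y) = c' i (h x) (h y)" if "x \<in> keys f" "y \<in> keys g" for x y
    using * that by (intro comp[of x m y n]) auto
  then show "push h (pcomp (based_operad B c e) m n i f g) =
      pcomp (based_operad B' c' e') m n i (push h f) (push h g)"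
    unfolding pcomp_based_operad push_def by (auto simp: lext_lext intro!: lext_cong)
qed (simp add: unit)


section \<open>Running maxima\<close>

text \<open>\<open>m\<close> is the maximum of the letters read so far; 0 can stand for the empty
  prefix because letters are natural numbers.\<close>

fun rmax :: "nat \<Rightarrow> nat list \<Rightarrow> nat list" where
  "rmax m [] = []"
| "rmax m (x # w) = max m x # rmax (max m x) w"

abbreviation hill_hull :: "nat list \<Rightarrow> nat list" where
  "hill_hull \<equiv> rmax 0"

section \<open>Insertion of words and its compatibility with running maxima\<close>

definition insert_word :: "nat \<Rightarrow> nat list \<Rightarrow> nat list \<Rightarrow> nat list" where
  "insert_word i u v = take (i - 1) u @ v @ drop (i - 1) u"

definition hill_comp :: "nat \<Rightarrow> nat list \<Rightarrow> nat list \<Rightarrow> nat list" where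
  "hill_comp i u v = hill_hull (insert_word i u v)"

lemma length_rmax [simp]: "length (rmax m w) = length w"
  by (induction w arbitrary: m) auto

lemma rmax_rmax [simp]: "rmax m (rmax m' w) = rmax (max m m') w"
  by (induction w arbitrary: m m') (auto simp: max.assoc max.left_commute)

lemma rmax_append: "rmax m (u @ v) = rmax m u @ rmax (foldl max m u) v"
  by (induction u arbitrary: m) auto

lemma le_foldl_max: "m \<le> foldl max m (u :: nat list)"
proof (induction u arbitrary: m)
  case (Cons x u)
  from Cons[of "max m x"] show ?case by simp
qed simp

lemma foldl_max_max: "foldl max (max m m') u = max m (foldl max m' (u :: nat list))"
  by (induction u arbitrary: m') (simp_all add: max.assoc)

lemma foldl_max_rmax: "foldl max m (rmax m' u) = (if u = [] then m else max m (foldl max m' u))"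
proof (induction u arbitrary: m m')
  case (Cons x u)
  show ?case
    using Cons[of "max m (max m' x)" "max m' x"] le_foldl_max[of "max m' x" u]
    by (simp add: foldl_max_max max.absorb1 max.absorb2 max.assoc)
qed simp

lemma set_rmax_ge: "x \<in> set (rmax m w) \<Longrightarrow> m \<le> x"
  by (induction w arbitrary: m) fastforce+

lemma sorted_rmax [simp]: "sorted (rmax m w)"
  by (induction w arbitrary: m) (auto dest: set_rmax_ge)

lemma rmax_id: "sorted w \<Longrightarrow> (\<And>x. x \<in> set w \<Longrightarrow> m \<le> x) \<Longrightarrow> rmax m w = w"
  by (induction w arbitrary: m) (auto simp: max_def)

lemma rmax_Cons_sorted: "sorted (x # w) \<Longrightarrow> rmax m (x # w) = max m x # rmax m w"
proof -
  assume w: "sorted (x # w)"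
  then have "rmax x w = w" by (intro rmax_id) auto
  then have "rmax (max m x) w = rmax m w" by (metis rmax_rmax)
  then show ?thesis by simp
qed

lemma set_rmax_le: "set w \<subseteq> {0..c} \<Longrightarrow> m \<le> c \<Longrightarrow> set (rmax m w) \<subseteq> {0..c}"
  by (induction w arbitrary: m) auto

text \<open>A weakly increasing word that bounds each letter of \<open>w\<close> also bounds all
  earlier letters of \<open>w\<close> at each place. So \<open>hill_hull\<close> is the closure
  operator onto hills, which is what makes the Moebius sums cancel.\<close>

lemma rmax_word_le_iff:
  "sorted h \<Longrightarrow> (\<And>x. x \<in> set h \<Longrightarrow> m \<le> x) \<Longrightarrow> rmax m w \<preceq> h \<longleftrightarrow> w \<preceq> h"
proof (induction w arbitrary: m h)
  case (Cons x w)
  show ?case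
  proof (cases h)
    case (Cons y h')
    with Cons.prems have "x \<le> y \<Longrightarrow> rmax (max m x) w \<preceq> h' \<longleftrightarrow> w \<preceq> h'"
      by (intro Cons.IH) auto
    then show ?thesis using Cons Cons.prems by auto
  qed simp
qed simp

lemma take_rmax: "take k (rmax m w) = rmax m (take k w)"
  and drop_rmax: "drop k (rmax m w) = rmax (foldl max m (take k w)) (drop k w)"
proof -
  have "rmax m w = rmax m (take k w) @ rmax (foldl max m (take k w)) (drop k w)"
    by (metis append_take_drop_id rmax_append)
  moreover have "length (rmax m (take k w)) = length (take k (rmax m w))"
    by simp
  ultimately show "take k (rmax m w) = rmax m (take k w)"
    "drop k (rmax m w) = rmax (foldl max m (take k w)) (drop k w)"
    by (metis append_eq_append_conv append_take_drop_id)+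
qed

lemma hull_append_hull: "rmax m (u @ hill_hull v @ w) = rmax m (u @ v @ w)"
  using foldl_max_max[of "foldl max m u" 0 v] by (simp add: rmax_append foldl_max_rmax)

text \<open>A word and its hull pass on the same maximum to whatever follows. Hence equality of
  hulls is a congruence for insertion, and hills inherit a composition.\<close>

lemma hull_insert_word: "hill_hull (insert_word i (hill_hull u) (hill_hull v)) = hill_hull (insert_word i u v)"
proof -
  let ?u = "take (i - 1) u" and ?w = "drop (i - 1) u"
  have "hill_hull (insert_word i (hill_hull u) (hill_hull v)) = rmax 0 (hill_hull ?u @ v @ rmax (foldl max 0 ?u) ?w)"
    by (simp add: insert_word_def take_rmax drop_rmax hull_append_hull)
  also have "\<dots> = hill_hull ?u @ rmax (foldl max 0 ?u) v @
      rmax (max (foldl max (foldl max 0 ?u) v) (foldl max 0 ?u)) ?w"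
    by (simp add: rmax_append foldl_max_rmax)
  \<comment> \<open>The tail of the hull of \<open>u\<close> was raised by the maximum of the head
    of \<open>u\<close>, which the running maximum has already reached there.\<close>
  also have "max (foldl max (foldl max 0 ?u) v) (foldl max 0 ?u) = foldl max (foldl max 0 ?u) v"
    using le_foldl_max[of "foldl max 0 ?u" v] by (simp add: max_def)
  finally show ?thesis
    by (simp add: insert_word_def rmax_append)
qed

lemma length_insert_word [simp]: "length (insert_word i u v) = length u + length v"
  by (simp add: insert_word_def)

lemma set_insert_word [simp]: "set (insert_word i u v) = set u \<union> set v"
  by (metis Un_assoc Un_commute append_take_drop_id insert_word_def set_append)

lemma insert_word_sequential:
  assumes "1 \<le> i" "i \<le> Suc (length u)" "1 \<le> j" "j \<le> Suc (length v)"
  shows "insert_word (i + j - 1) (insert_word i u v) w = insert_word i u (insert_word j v w)"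
proof -
  obtain i' j' where "i = Suc i'" "j = Suc j'" using assms by (metis Suc_le_D One_nat_def)
  with assms show ?thesis by (simp add: insert_word_def min_def)
qed

lemma insert_word_parallel:
  assumes "1 \<le> i" "i < j" "j \<le> Suc (length u)"
  shows "insert_word (j + length v) (insert_word i u v) w = insert_word i (insert_word j u w) v"
proof -
  obtain i' j' where ij: "i = Suc i'" "j = Suc j'"
    using assms by (metis Suc_le_D One_nat_def less_imp_le order_trans)
  \<comment> \<open>Cutting \<open>u\<close> at both positions turns either order of insertion into
    \<open>a @ v @ b @ w @ d\<close>.\<close>
  define a b d where "a = take i' u" and "b = drop i' (take j' u)" and "d = drop j' u"
  have u: "u = a @ b @ d" "length a = i'" "length (a @ b) = j'"
    using assms ij by (auto simp: a_def b_def d_def append_take_drop_id)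
      (metis append_take_drop_id append.assoc min_absorb1 nless_le take_take)
  then show ?thesis
    using ij by (auto simp: insert_word_def)
qed

lemma hill_comp_hull: "hill_comp i (hill_hull u) (hill_hull v) = hill_hull (insert_word i u v)"
  by (simp add: hill_comp_def hull_insert_word)

lemma hillsD: "w \<in> hills c \<Longrightarrow> hill_hull w = w" "w \<in> hills c \<Longrightarrow> w \<in> cliffs c"
  by (auto simp: hills_def intro: rmax_id)

lemma hull_in_hills: "w \<in> cliffs c \<Longrightarrow> hill_hull w \<in> hills c"
  using set_rmax_le[of w c 0] by (simp add: hills_def cliffs_def)

lemma hill_comp_in_hills: "u \<in> hills c \<Longrightarrow> v \<in> hills c \<Longrightarrow> hill_comp i u v \<in> hills c"
  unfolding hill_comp_def by (intro hull_in_hills) (auto simp: hills_def cliffs_def)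

lemma arity_insert_word [simp]: "arity (insert_word i u v) = arity u + arity v - 1"
  and arity_rmax [simp]: "arity (rmax m w) = arity w"
  by (simp_all add: arity_def)

definition cliff_basis :: "nat \<Rightarrow> nat \<Rightarrow> nat list set" where
  "cliff_basis c n = {w \<in> cliffs c. arity w = n}"

definition hill_basis :: "nat \<Rightarrow> nat \<Rightarrow> nat list set" where
  "hill_basis c n = {w \<in> hills c. arity w = n}"

text \<open>A model of \<open>Hi c\<close> with an honest basis in place of cosets.\<close>

definition Hill :: "nat \<Rightarrow> ('k::field, nat list \<Rightarrow>\<^sub>0 'k) ns_operad" where
  "Hill c = based_operad (hill_basis c) hill_comp []"

lemma Cl_eq: "Cl c = based_operad (cliff_basis c) insert_word []"
  by (simp add: Cl_def cliff_basis_def[abs_def] insert_word_def[abs_def])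

text \<open>By \<open>hill_comp_hull\<close> all hulls can be postponed to the end, which leaves the
  axioms for insertion of words.\<close>

lemma nonsymmetric_operad_Hill: "nonsymmetric_operad (Hill c :: ('k::field, _) ns_operad)"
  unfolding Hill_def
proof (rule nonsymmetric_operad_based_operad)
  have h: "hill_hull w = w" "arity w = n" if "w \<in> hill_basis c n" for w n
    using that hillsD by (auto simp: hill_basis_def)
  show "hill_comp i x y \<in> hill_basis c (m + n - 1)"
    if "x \<in> hill_basis c m" "y \<in> hill_basis c n" for m n i x y
    using that hill_comp_in_hills by (auto simp: hill_basis_def hill_comp_def)
  show "[] \<in> hill_basis c 1"
    by (simp add: hill_basis_def hills_def cliffs_def arity_def)
  show "hill_comp 1 [] x = x" if "x \<in> hill_basis c n" for n x
    using h[OF that] by (simp add: hill_comp_def insert_word_def)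
  show "hill_comp i x [] = x" if "x \<in> hill_basis c n" for n i x
    using h[OF that] by (simp add: hill_comp_def insert_word_def)
  show "hill_comp (i + j - 1) (hill_comp i x y) z = hill_comp i x (hill_comp j y z)"
    if "x \<in> hill_basis c l" "y \<in> hill_basis c m" "z \<in> hill_basis c n"
      "1 \<le> i" "i \<le> l" "1 \<le> j" "j \<le> m" for l m n i j x y z
  proof -
    have "hill_comp (i + j - 1) (hill_comp i x y) z = hill_hull (insert_word (i + j - 1) (insert_word i x y) z)"
      using hill_comp_hull[of _ "insert_word i x y" z] h(1)[OF that(3)] by (simp add: hill_comp_def[of i])
    also have "insert_word (i + j - 1) (insert_word i x y) z = insert_word i x (insert_word j y z)"
      using h(2)[OF that(1)] h(2)[OF that(2)] that(4-) by (intro insert_word_sequential) (auto simp: arity_def)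
    also have "hill_hull \<dots> = hill_comp i x (hill_comp j y z)"
      using hill_comp_hull[of i x "insert_word j y z"] h(1)[OF that(1)] by (simp add: hill_comp_def[of j])
    finally show ?thesis .
  qed
  show "hill_comp (j + m - 1) (hill_comp i x y) z = hill_comp i (hill_comp j x z) y"
    if "x \<in> hill_basis c l" "y \<in> hill_basis c m" "z \<in> hill_basis c n"
      "1 \<le> i" "i < j" "j \<le> l" for l m n i j x y z
  proof -
    have "hill_comp (j + m - 1) (hill_comp i x y) z = hill_hull (insert_word (j + m - 1) (insert_word i x y) z)"
      using hill_comp_hull[of _ "insert_word i x y" z] h(1)[OF that(3)] by (simp add: hill_comp_def[of i])
    also have "insert_word (j + m - 1) (insert_word i x y) z = insert_word i (insert_word j x z) y"
      using h(2)[OF that(1)] h(2)[OF that(2)] that(4-) insert_word_parallel[of i j x y z]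
      by (auto simp: arity_def)
    also have "hill_hull \<dots> = hill_comp i (hill_comp j x z) y"
      using hill_comp_hull[of i "insert_word j x z" y] h(1)[OF that(2)] by (simp add: hill_comp_def[of j])
    finally show ?thesis .
  qed
qed

lemma operad_hom_hull:
  "operad_hom (Cl c) (Hill c :: ('k::field, _) ns_operad) (\<lambda>n. push hill_hull)"
  unfolding Cl_eq Hill_def
  by (rule operad_hom_push)
    (auto simp: cliff_basis_def hill_basis_def hull_in_hills hill_comp_hull)

section \<open>The ideal of hills as a kernel\<close>

lemma finite_word_ge: "finite {w' \<in> cliffs c. w \<preceq> w'}"
  by (rule finite_subset[OF _ finite_lists_length_eq[of "{0..c}" "length w"]])
    (auto simp: cliffs_def dest: list_all2_lengthD)

lemma word_le_trans: "u \<preceq> v \<Longrightarrow> v \<preceq> w \<Longrightarrow> u \<preceq> w"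
  by (rule list_all2_trans[where ?P1.0 = "(\<le>)" and ?P2.0 = "(\<le>)"]) auto

lemma word_le_refl [simp]: "w \<preceq> (w :: nat list)"
  by (simp add: list_all2_refl)

lemma cliffs_down: "u \<preceq> v \<Longrightarrow> v \<in> cliffs c \<Longrightarrow> u \<in> cliffs c"
  by (induction rule: list_all2_induct) (auto simp: cliffs_def)

lemma finite_interval: "finite {w. u \<preceq> w \<and> w \<preceq> v}"
proof -
  have "v \<in> cliffs (Max (insert 0 (set v)))"
    by (auto simp: cliffs_def)
  then have "{w. u \<preceq> w \<and> w \<preceq> v} \<subseteq> {w' \<in> cliffs (Max (insert 0 (set v))). u \<preceq> w'}"
    using cliffs_down by blast
  then show ?thesis using finite_word_ge finite_subset by blast
qed

lemma sum_moebius: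
  assumes "u \<preceq> v" "u \<noteq> v"
  shows "(\<Sum>w\<in>{w. u \<preceq> w \<and> w \<preceq> v}. moebius u w) = 0"
proof -
  have "{w. u \<preceq> w \<and> w \<preceq> v} = insert v {w. u \<preceq> w \<and> w \<preceq> v \<and> w \<noteq> v}"
    using assms by auto
  moreover have "finite {w. u \<preceq> w \<and> w \<preceq> v \<and> w \<noteq> v}"
    by (rule finite_subset[OF _ finite_interval[of u v]]) auto
  ultimately show ?thesis
    using assms by (simp add: moebius.simps[of u v])
qed

lemma word_le_length: "u \<preceq> v \<Longrightarrow> arity v = arity u"
  by (simp add: list_all2_lengthD arity_def)

text \<open>The values of \<open>moebius w\<close> on the interval from \<open>w\<close> to
  \<open>h\<close> add up to 0. By the closure property this interval is the union of the fibres of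
  \<open>hill_hull\<close> over hills below \<open>h\<close>. The fibres over smaller hills
  contribute 0 by induction, so the fibre over \<open>h\<close> does as well.\<close>

lemma sum_moebius_hull:
  assumes w: "w \<in> cliffs c" "w \<notin> hills c" and h: "h \<in> hills c"
  shows "(\<Sum>w'\<in>{w' \<in> cliffs c. w \<preceq> w' \<and> hill_hull w' = h}. moebius w w') = 0"
  using h
proof (induction "sum_list h" arbitrary: h rule: less_induct)
  case less
  have hs: "sorted h" "h \<in> cliffs c" using less.prems by (auto simp: hills_def)
  let ?U = "{w' \<in> cliffs c. w \<preceq> w' \<and> w' \<preceq> h}"
  have fin: "finite ?U" by (rule finite_subset[OF _ finite_word_ge[of c w]]) auto
  have le_iff: "hill_hull w' \<preceq> h \<longleftrightarrow> w' \<preceq> h" for w'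
    using hs by (intro rmax_word_le_iff) auto
  have "0 = (\<Sum>w'\<in>?U. moebius w w')"
  proof (cases "w \<preceq> h")
    case True
    have "?U = {w'. w \<preceq> w' \<and> w' \<preceq> h}" using cliffs_down hs by auto
    \<comment> \<open>The only place where \<open>w\<close> must not be a hill: the interval has to
      have two distinct ends.\<close>
    moreover have "w \<noteq> h" using less.prems w by auto
    ultimately show ?thesis using sum_moebius[OF True] by simp
  next
    case False
    then have "?U = {}" using word_le_trans by blast
    then show ?thesis by (simp only: sum.empty)
  qed
  also have "\<dots> = (\<Sum>h'\<in>hill_hull ` ?U. \<Sum>w'\<in>{w'\<in>?U. hill_hull w' = h'}. moebius w w')"
    by (rule sum.image_gen[OF fin])
  \<comment> \<open>The fibre over \<open>h\<close> may be empty; its empty sum is added so that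
    \<open>h\<close> can be singled out.\<close>
  also have "\<dots> = (\<Sum>h'\<in>insert h (hill_hull ` ?U). \<Sum>w'\<in>{w'\<in>?U. hill_hull w' = h'}. moebius w w')"
    using fin by (intro sum.mono_neutral_left) (auto intro!: sum.neutral)
  also have "\<dots> = (\<Sum>h'\<in>{h}. \<Sum>w'\<in>{w'\<in>?U. hill_hull w' = h'}. moebius w w')"
  proof (intro sum.mono_neutral_right ballI)
    fix h' assume h': "h' \<in> insert h (hill_hull ` ?U) - {h}"
    then obtain w' where w': "w' \<in> ?U" "h' = hill_hull w'" by auto
    then have "h' \<preceq> h" "h' \<noteq> h" "h' \<in> hills c"
      using h' le_iff[of w'] hull_in_hills by auto
    then have "(\<Sum>w'\<in>{w' \<in> cliffs c. w \<preceq> w' \<and> hill_hull w' = h'}. moebius w w') = 0"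
      using less.hyps sum_list_less_if_word_less by blast
    moreover have "{w'\<in>?U. hill_hull w' = h'} = {w' \<in> cliffs c. w \<preceq> w' \<and> hill_hull w' = h'}"
      using \<open>h' \<preceq> h\<close> le_iff by auto
    ultimately show "(\<Sum>w'\<in>{w'\<in>?U. hill_hull w' = h'}. moebius w w') = 0" by simp
  qed (use fin in simp_all)
  also have "\<dots> = (\<Sum>w'\<in>{w' \<in> cliffs c. w \<preceq> w' \<and> hill_hull w' = h}. moebius w w')"
  proof -
    have "{w'\<in>?U. hill_hull w' = h} = {w' \<in> cliffs c. w \<preceq> w' \<and> hill_hull w' = h}"
    proof (intro Collect_cong iffI)
      fix w' assume "w' \<in> cliffs c \<and> w \<preceq> w' \<and> hill_hull w' = h"
      then show "w' \<in> ?U \<and> hill_hull w' = h" using le_iff[of w'] by simp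
    qed auto
    then show ?thesis by simp
  qed
  finally show ?case by simp
qed

lemma push_sum: "push e (\<Sum>x\<in>A. f x) = (\<Sum>x\<in>A. push e (f x))"
  by (simp add: push_def lext_sum)

lemma push_hull_F_cl:
  assumes "w \<in> cliffs c" "w \<notin> hills c"
  shows "push hill_hull (F_cl c w :: _ \<Rightarrow>\<^sub>0 'k::field) = 0"
proof (rule poly_mapping_eqI)
  fix h
  let ?U = "{w' \<in> cliffs c. w \<preceq> w'}"
  have "lookup (push hill_hull (F_cl c w :: _ \<Rightarrow>\<^sub>0 'k)) h =
      (\<Sum>w'\<in>?U. if hill_hull w' = h then of_int (moebius w w') else 0)"
    by (simp add: F_cl_def push_sum lookup_sum lookup_single when_def)
  also have "\<dots> = (\<Sum>w'\<in>{w' \<in> ?U. hill_hull w' = h}. of_int (moebius w w'))"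
    by (rule sum.inter_filter[symmetric, OF finite_word_ge])
  also have "\<dots> = of_int (\<Sum>w'\<in>{w' \<in> cliffs c. w \<preceq> w' \<and> hill_hull w' = h}. moebius w w')"
    by (simp add: conj_assoc)
  also have "\<dots> = 0"
  proof (cases "h \<in> hills c")
    case True
    then show ?thesis using sum_moebius_hull[OF assms] by simp
  next
    case False
    then have "{w' \<in> cliffs c. w \<preceq> w' \<and> hill_hull w' = h} = {}" using hull_in_hills by auto
    then show ?thesis by (simp only: sum.empty of_int_0)
  qed
  finally show "lookup (push hill_hull (F_cl c w :: _ \<Rightarrow>\<^sub>0 'k)) h = lookup 0 h"
    by simp
qed

lemma keys_F_cl: "keys (F_cl c w) \<subseteq> {w' \<in> cliffs c. w \<preceq> w'}"
  unfolding F_cl_def by (rule order_trans[OF keys_sum]) auto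

lemma keys_F_cl_subset: "arity w = n \<Longrightarrow> keys (F_cl c w) \<subseteq> cliff_basis c n"
  by (rule order_trans[OF keys_F_cl]) (auto simp: cliff_basis_def word_le_length)

lemma submodule_hill_ideal:
  "submodule (hill_ideal c n :: (_ \<Rightarrow>\<^sub>0 'k::field) set) scalars (free_module (cliff_basis c n))"
  unfolding hill_ideal_def Cl_eq component_based_operad
proof (rule submodule_span_in[OF module_free_module])
  show "{F_cl c w | w. w \<in> cliffs c - hills c \<and> arity w = n} \<subseteq>
      carrier (free_module (cliff_basis c n) :: ('k, _) module)"
    using keys_F_cl_subset unfolding free_module_simps by blast
qed

lemma F_cl_in_hill_ideal: "w \<in> cliffs c - hills c \<Longrightarrow> F_cl c w \<in> hill_ideal c (arity w)"
  unfolding hill_ideal_def by (rule subsetD[OF span_in_superset]) auto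

text \<open>\<open>F_cl c w\<close> is \<open>E_w\<close> plus terms at strictly larger words, so
  modulo the ideal a word that is not a hill can be traded for larger ones. This stops because
  letters are at most \<open>c\<close>.\<close>

lemma cliff_mod_hill_ideal:
  assumes "w \<in> cliff_basis c n"
  shows "\<exists>g. keys g \<subseteq> hill_basis c n \<and>
    single w (1::'k::field) - g \<in> hill_ideal c n"
  using assms
proof (induction "sum_list (map (\<lambda>x. c - x) w)" arbitrary: w rule: less_induct)
  case less
  let ?I = "hill_ideal c n :: (_ \<Rightarrow>\<^sub>0 'k) set"
  note I = submodule_free_module_closed[OF submodule_hill_ideal[of c n, where ?'k = 'k]]
  have w: "w \<in> cliffs c" "arity w = n" using less.prems by (auto simp: cliff_basis_def)
  show ?case
  proof (cases "w \<in> hills c")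
    case True
    then show ?thesis
      using w I(1) by (intro exI[of _ "single w 1"]) (simp add: hill_basis_def)
  next
    case False
    let ?U = "{w' \<in> cliffs c. w \<preceq> w' \<and> w' \<noteq> w}"
    \<comment> \<open>Replacing each letter x by c - x reverses the order and is injective on words
      over \<open>{0..c}\<close>, so strictness survives.\<close>
    have smaller: "sum_list (map (\<lambda>x. c - x) w') < sum_list (map (\<lambda>x. c - x) w)" if "w' \<in> ?U" for w'
    proof -
      have le: "w \<preceq> w'" "w \<noteq> w'" "w' \<in> cliffs c" using that by auto
      have "map (\<lambda>x. c - x) w' \<preceq> map (\<lambda>x. c - x) w"
        using le(1) by (induction rule: list_all2_induct) auto
      moreover have "map (\<lambda>x. c - x) (map (\<lambda>x. c - x) u) = u" if "u \<in> cliffs c" for u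
        using that by (auto simp: cliffs_def intro!: map_idI)
      then have "map (\<lambda>x. c - x) w' \<noteq> map (\<lambda>x. c - x) w"
        using le w(1) by metis
      ultimately show ?thesis by (rule sum_list_less_if_word_less)
    qed
    let ?f = "single w 1 - F_cl c w :: _ \<Rightarrow>\<^sub>0 'k"
    have "keys ?f \<subseteq> {w' \<in> cliffs c. w \<preceq> w'}"
      using w keys_F_cl by (intro keys_subset(2)) auto
    moreover have "lookup ?f w = 0"
    proof -
      have "lookup (F_cl c w :: _ \<Rightarrow>\<^sub>0 'k) w = (\<Sum>w'\<in>{w' \<in> cliffs c. w \<preceq> w'}. if w' = w then 1 else 0)"
        unfolding F_cl_def lookup_sum by (intro sum.cong) (auto simp: lookup_single when_def moebius.simps[of w w])
      then show ?thesis using w by (simp add: lookup_minus finite_word_ge)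
    qed
    ultimately have f: "keys ?f \<subseteq> ?U"
      by (auto simp: in_keys_iff)
    have "\<exists>g. keys g \<subseteq> hill_basis c n \<and> single w' 1 - lext (\<lambda>w. single w 1) g \<in> ?I" if "w' \<in> keys ?f" for w'
    proof -
      have w': "w' \<in> ?U" using f that by blast
      then have "w' \<in> cliff_basis c n"
        using w word_le_length[of w w'] by (simp add: cliff_basis_def)
      from less.hyps[OF smaller[OF w'] this] show ?thesis
        by (simp add: single_expansion[symmetric])
    qed
    from lext_approximation[OF submodule_hill_ideal this] obtain g
      where g: "keys g \<subseteq> hill_basis c n" "?f - g \<in> ?I"
      by (auto simp: single_expansion[symmetric])
    have "F_cl c w \<in> ?I"
      using F_cl_in_hill_ideal[of w c] w False by simp
    from I(2)[OF g(2) this] g(1) show ?thesis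
      by (intro exI[of _ g]) simp
  qed
qed

text \<open>No dimension count is needed: an element of the kernel is congruent to a combination of
  hills, which lies in the kernel too but is fixed by the projection, hence is 0.\<close>

theorem hill_ideal_eq_kernel:
  "hill_ideal c n = {f :: _ \<Rightarrow>\<^sub>0 'k::field. keys f \<subseteq> cliff_basis c n \<and> push hill_hull f = 0}"
    (is "?I = ?K")
proof
  have K: "submodule ?K scalars (free_module (cliff_basis c n))"
    unfolding submodule_free_module_iff by (simp add: push_add push_scale keys_subset)
  have "{F_cl c w | w. w \<in> cliffs c - hills c \<and> arity w = n} \<subseteq> ?K"
    using keys_F_cl_subset push_hull_F_cl by blast
  then show "?I \<subseteq> ?K"
    unfolding hill_ideal_def Cl_eq component_based_operad by (intro span_in_minimal K)
  note I = submodule_free_module_closed[OF submodule_hill_ideal[of c n, where ?'k = 'k]]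
  show "?K \<subseteq> ?I"
  proof
    fix f assume f: "f \<in> ?K"
    have "\<exists>g. keys g \<subseteq> hill_basis c n \<and> single w 1 - lext (\<lambda>w. single w 1) g \<in> ?I" if "w \<in> keys f" for w
      using cliff_mod_hill_ideal[of w c n, where ?'k = 'k] f that by (auto simp: single_expansion[symmetric])
    from lext_approximation[OF submodule_hill_ideal this] obtain g
      where g: "keys g \<subseteq> hill_basis c n" and *: "f - g \<in> ?I"
      by (auto simp: single_expansion[symmetric])
    have "push hill_hull (f - g) = 0"
      using * \<open>?I \<subseteq> ?K\<close> by blast
    then have "push hill_hull g = 0"
      using f by (simp add: push_diff)
    moreover have "push hill_hull g = g"
      using g by (intro push_ident) (auto simp: hill_basis_def dest: hillsD)
    ultimately show "f \<in> ?I" using * by simp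
  qed
qed


section \<open>Isomorphisms of operads\<close>

lemma linear_onD:
  assumes "linear_on M N f"
  shows "x \<in> carrier M \<Longrightarrow> f x \<in> carrier N"
    and "x \<in> carrier M \<Longrightarrow> y \<in> carrier M \<Longrightarrow> f (x \<oplus>\<^bsub>M\<^esub> y) = f x \<oplus>\<^bsub>N\<^esub> f y"
    and "x \<in> carrier M \<Longrightarrow> f (a \<odot>\<^bsub>M\<^esub> x) = a \<odot>\<^bsub>N\<^esub> f x"
  using assms by (auto simp: linear_on_def)

lemma module_zero_closed: "Module.module scalars M \<Longrightarrow> \<zero>\<^bsub>M\<^esub> \<in> carrier M"
  by (rule abelian_monoid.zero_closed[OF abelian_group.axioms(1)[OF module.axioms(2)]])

lemma linear_on_zero:
  assumes "Module.module scalars M" "Module.module scalars N" "linear_on M N f"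
  shows "f \<zero>\<^bsub>M\<^esub> = \<zero>\<^bsub>N\<^esub>"
  using linear_onD(3)[OF assms(3) module_zero_closed[OF assms(1)], of 0]
    smult_scalars(6)[OF assms(1) module_zero_closed[OF assms(1)]] smult_scalars(6)[OF assms(2)]
  using linear_onD(1)[OF assms(3) module_zero_closed[OF assms(1)]] by simp

lemma module_transport:
  fixes M :: "('k::field, 'v) module" and N :: "('k, 'w) module"
  assumes M: "Module.module scalars M" and f: "linear_on M N f"
    and carrier: "carrier N = f ` carrier M" and zero: "\<zero>\<^bsub>N\<^esub> = f \<zero>\<^bsub>M\<^esub>"
  shows "Module.module scalars N"
proof (rule moduleI_scalars)
  interpret M: Module.module scalars M by fact
  note f_simps = linear_onD(2,3)[OF f, symmetric] zero
  show "abelian_group N"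
  proof (rule abelian_groupI)
    fix x assume "x \<in> carrier N"
    then obtain y where y: "x = f y" "y \<in> carrier M" by (auto simp: carrier)
    then have "f (\<ominus>\<^bsub>M\<^esub> y) \<oplus>\<^bsub>N\<^esub> x = \<zero>\<^bsub>N\<^esub>"
      using M.l_neg[of y] by (simp add: f_simps del: M.l_neg)
    then show "\<exists>z\<in>carrier N. z \<oplus>\<^bsub>N\<^esub> x = \<zero>\<^bsub>N\<^esub>"
      using y by (auto simp: carrier)
  qed (auto simp: carrier f_simps M.a_ac)
qed (auto simp: carrier linear_onD(2,3)[OF f, symmetric] smult_scalars[OF M]
    abelian_monoid.a_closed[OF abelian_group.axioms(1)[OF module.axioms(2)[OF M]]])

context nonsymmetric_operad
begin

lemma pcomp_closed:
  assumes "x \<in> elems P m" "y \<in> elems P n" "1 \<le> i" "i \<le> m"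
  shows "pcomp P m n i x y \<in> elems P (m + n - 1)"
  using linear_onD(1)[OF pcomp_linear_left] assms by blast

text \<open>That \<open>Q\<close> is an operad is a conclusion, because the quotient is given by
  unions of cosets about which nothing is known in advance; all of its structure is read off through
  the bijections \<open>\<phi> n\<close>.\<close>

lemma pcomp_transport:
  fixes Q :: "('k, 'w) ns_operad"
  assumes carrier: "\<And>n. elems Q n = \<phi> n ` elems P n"
    and inj: "\<And>n. inj_on (\<phi> n) (elems P n)"
    and linear: "\<And>n. linear_on (component P n) (component Q n) (\<phi> n)"
    and zero: "\<And>n. \<zero>\<^bsub>component Q n\<^esub> = \<phi> n \<zero>\<^bsub>component P n\<^esub>"
    and unit: "ounit Q = \<phi> 1 (ounit P)"
    and pcomp: "\<And>m n i x y. x \<in> elems P m \<Longrightarrow> y \<in> elems P n \<Longrightarrow> 1 \<le> i \<Longrightarrow> i \<le> m \<Longrightarrow>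
      pcomp Q m n i (\<phi> m x) (\<phi> n y) = \<phi> (m + n - 1) (pcomp P m n i x y)"
  shows "nonsymmetric_operad Q" "operad_hom P Q \<phi>"
    "operad_hom Q P (\<lambda>n. inv_into (elems P n) (\<phi> n))"
proof -
  note phi = linear_onD(2,3)[OF linear, symmetric]
  have module_Q: "Module.module scalars (component Q n)" for n
    by (rule module_transport[OF component_module linear carrier zero])
  note closed = pcomp_closed smult_scalars(1)[OF component_module]
    abelian_monoid.a_closed[OF abelian_group.axioms(1)[OF module.axioms(2)[OF component_module]]]
  note linear_P = linear_onD(2,3)[OF pcomp_linear_left] linear_onD(2,3)[OF pcomp_linear_right]
  show "nonsymmetric_operad Q"
  proof (rule nonsymmetric_operad.intro)
    show "Module.module scalars (component Q n)" for n by (rule module_Q)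
    show "linear_on (component Q m) (component Q (m + n - 1)) (\<lambda>x. pcomp Q m n i x y)"
      if "1 \<le> i" "i \<le> m" "y \<in> elems Q n" for i m n y
      using that unfolding linear_on_def carrier
      by (auto simp: phi pcomp closed linear_P simp del: One_nat_def)
    show "linear_on (component Q n) (component Q (m + n - 1)) (pcomp Q m n i x)"
      if "1 \<le> i" "i \<le> m" "x \<in> elems Q m" for i m n x
      using that unfolding linear_on_def carrier
      by (auto simp: phi pcomp closed linear_P simp del: One_nat_def)
    show "ounit Q \<in> elems Q 1" using ounit_closed by (simp add: unit carrier)
    show "pcomp Q 1 n 1 (ounit Q) x = x" if "x \<in> elems Q n" for n x
      using that pcomp[OF ounit_closed, of _ n 1] ounit_left by (auto simp: unit carrier)
    show "pcomp Q n 1 i x (ounit Q) = x" if "1 \<le> i" "i \<le> n" "x \<in> elems Q n" for n i x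
      using that pcomp[OF _ ounit_closed, of _ n i] ounit_right by (auto simp: unit carrier)
    show "pcomp Q (l + m - 1) n (i + j - 1) (pcomp Q l m i x y) z =
        pcomp Q l (m + n - 1) i x (pcomp Q m n j y z)"
      if xyz: "x \<in> elems Q l" "y \<in> elems Q m" "z \<in> elems Q n" and ij: "1 \<le> i" "i \<le> l" "1 \<le> j" "j \<le> m"
      for x y z l m n i j
    proof -
      obtain x' y' z' where *: "x = \<phi> l x'" "y = \<phi> m y'" "z = \<phi> n z'"
        "x' \<in> elems P l" "y' \<in> elems P m" "z' \<in> elems P n"
        using xyz by (auto simp: carrier)
      have ar: "l + m - 1 + n - 1 = l + (m + n - 1) - 1" "1 \<le> i + j - 1" "i + j - 1 \<le> l + m - 1"
        using ij by auto
      show ?thesis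
        using pcomp_sequential[OF *(4-6) ij] *(4-6) ij ar
        by (simp add: *(1-3) pcomp pcomp_closed del: One_nat_def)
    qed
    show "pcomp Q (l + m - 1) n (j + m - 1) (pcomp Q l m i x y) z =
        pcomp Q (l + n - 1) m i (pcomp Q l n j x z) y"
      if xyz: "x \<in> elems Q l" "y \<in> elems Q m" "z \<in> elems Q n" and ij: "1 \<le> i" "i < j" "j \<le> l"
      for x y z l m n i j
    proof -
      obtain x' y' z' where *: "x = \<phi> l x'" "y = \<phi> m y'" "z = \<phi> n z'"
        "x' \<in> elems P l" "y' \<in> elems P m" "z' \<in> elems P n"
        using xyz by (auto simp: carrier)
      have ar: "l + m - 1 + n - 1 = l + n - 1 + m - 1" "1 \<le> j + m - 1" "j + m - 1 \<le> l + m - 1"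
        "i \<le> l + n - 1" "i \<le> l" "1 \<le> j"
        using ij by auto
      show ?thesis
        using pcomp_parallel[OF *(4-6) ij] *(4-6) ij ar
        by (simp add: *(1-3) pcomp pcomp_closed del: One_nat_def)
    qed
  qed
  show "operad_hom P Q \<phi>"
    using linear unit pcomp by (simp add: operad_hom_def)
  have inv: "inv_into (elems P n) (\<phi> n) (\<phi> n x) = x" if "x \<in> elems P n" for n x
    using inj that by simp
  show "operad_hom Q P (\<lambda>n. inv_into (elems P n) (\<phi> n))"
    unfolding operad_hom_def linear_on_def
    by (auto simp: carrier unit phi pcomp inv closed ounit_closed simp del: One_nat_def)
qed

end

lemma operad_hom_comp:
  "operad_hom P Q \<phi> \<Longrightarrow> operad_hom Q R \<psi> \<Longrightarrow> operad_hom P R (\<lambda>n x. \<psi> n (\<phi> n x))"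
  by (auto simp: operad_hom_def linear_on_def Pi_iff)

section \<open>Transport of generating sets\<close>

lemma suboperad_preimage:
  assumes P: "nonsymmetric_operad P" and Q: "nonsymmetric_operad Q"
    and hom: "operad_hom P Q \<phi>" and S: "suboperad Q S"
  shows "suboperad P (\<lambda>n. {x \<in> elems P n. \<phi> n x \<in> S n})"
proof -
  interpret P: nonsymmetric_operad P by fact
  interpret Q: nonsymmetric_operad Q by fact
  have lin: "linear_on (component P n) (component Q n) (\<phi> n)" for n
    using hom by (simp add: operad_hom_def)
  have sub: "submodule (S n) scalars (component Q n)" for n
    using S by (simp add: suboperad_def)
  have "submodule {x \<in> elems P n. \<phi> n x \<in> S n} scalars (component P n)" for n
    using sub[of n] Module.module.carrier_is_submodule[OF P.component_module, of n]
    unfolding submodule_iff[OF P.component_module] submodule_iff[OF Q.component_module]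
    by (auto simp: linear_onD[OF lin] linear_on_zero[OF P.component_module Q.component_module lin])
  then show ?thesis
    using S hom P.ounit_closed P.pcomp_closed unfolding suboperad_def operad_hom_def by auto
qed

text \<open>A suboperad of \<open>Q\<close> containing the images of \<open>G\<close> has a preimage
  containing \<open>G\<close>, hence the whole of \<open>P\<close>; the one-sided inverse provides
  surjectivity.\<close>

lemma generates_transport:
  assumes P: "nonsymmetric_operad P" and Q: "nonsymmetric_operad Q"
    and \<phi>: "operad_hom P Q \<phi>" and \<psi>: "operad_hom Q P \<psi>"
    and inv: "\<And>n y. y \<in> elems Q n \<Longrightarrow> \<phi> n (\<psi> n y) = y"
    and G: "generates P G"
  shows "generates Q ((\<lambda>(n, x). (n, \<phi> n x)) ` G)"
  unfolding generates_def
proof (intro conjI allI impI)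
  have lin: "linear_on (component P n) (component Q n) (\<phi> n)"
    "linear_on (component Q n) (component P n) (\<psi> n)" for n
    using \<phi> \<psi> by (auto simp: operad_hom_def)
  have G_elems: "x \<in> elems P n" if "(n, x) \<in> G" for n x
    using G that by (auto simp: generates_def)
  then show "\<forall>(n, x)\<in>(\<lambda>(n, x). (n, \<phi> n x)) ` G. x \<in> elems Q n"
    using linear_onD(1)[OF lin(1)] by auto
  fix S n assume S: "suboperad Q S \<and> (\<forall>(n, x)\<in>(\<lambda>(n, x). (n, \<phi> n x)) ` G. x \<in> S n)"
  have "\<forall>(n, x)\<in>G. x \<in> {x \<in> elems P n. \<phi> n x \<in> S n}"
    using S G_elems by fastforce
  then have full: "{x \<in> elems P n. \<phi> n x \<in> S n} = elems P n" for n
    using G suboperad_preimage[OF P Q \<phi>, of S] S unfolding generates_def by blast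
  have "S n \<subseteq> elems Q n"
    using S submodule_iff[OF nonsymmetric_operad.component_module[OF Q]] by (auto simp: suboperad_def)
  moreover have "y \<in> S n" if "y \<in> elems Q n" for y
    using full[of n] linear_onD(1)[OF lin(2) that] inv[OF that] by (metis (mono_tags, lifting) mem_Collect_eq)
  ultimately show "S n = elems Q n" by blast
qed

lemma minimal_generating_set_transport:
  assumes P: "nonsymmetric_operad P" and Q: "nonsymmetric_operad Q"
    and \<phi>: "operad_hom P Q \<phi>" and \<psi>: "operad_hom Q P \<psi>"
    and inv: "\<And>n y. y \<in> elems Q n \<Longrightarrow> \<phi> n (\<psi> n y) = y" "\<And>n x. x \<in> elems P n \<Longrightarrow> \<psi> n (\<phi> n x) = x"
    and G: "minimal_generating_set P G"
  shows "minimal_generating_set Q ((\<lambda>(n, x). (n, \<phi> n x)) ` G)"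
proof -
  let ?\<Phi> = "\<lambda>(n, x). (n, \<phi> n x)" and ?\<Psi> = "\<lambda>(n, x). (n, \<psi> n x)"
  have gen: "generates P G" and min: "\<And>H. H \<subset> G \<Longrightarrow> \<not> generates P H"
    using G by (auto simp: minimal_generating_set_def)
  have \<Psi>\<Phi>: "?\<Psi> (?\<Phi> p) = p" if "p \<in> G" for p
    using that gen inv(2) by (auto simp: generates_def)
  have "\<not> generates Q H" if H: "H \<subset> ?\<Phi> ` G" for H
  proof
    assume "generates Q H"
    from generates_transport[OF Q P \<psi> \<phi> inv(2) this] have "generates P (?\<Psi> ` H)"
      by simp
    moreover have "?\<Psi> ` H \<subset> G"
    proof -
      \<comment> \<open>A generator whose image is missing from \<open>H\<close> is missing from the
        pullback too, since \<open>\<psi>\<close> undoes \<open>\<phi>\<close> on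
        \<open>G\<close>.\<close>
      obtain p where p: "p \<in> G" "?\<Phi> p \<notin> H" using H by blast
      have "?\<Psi> q \<in> G - {p}" if q: "q \<in> H" for q
      proof -
        obtain p' where p': "p' \<in> G" "q = ?\<Phi> p'" using H q by blast
        then show ?thesis using p q \<Psi>\<Phi>[OF p'(1)] by auto
      qed
      then show ?thesis using p(1) by blast
    qed
    ultimately show False using min by blast
  qed
  then show ?thesis
    using generates_transport[OF P Q \<phi> \<psi> inv(1) gen] by (auto simp: minimal_generating_set_def)
qed


section \<open>The operad of hills\<close>

text \<open>The elements of \<^term>\<open>Hi c\<close> are the fibres of the projection \<open>E_w \<mapsto> E_(hill_hull w)\<close>.\<close>

definition fibre :: "nat \<Rightarrow> nat \<Rightarrow> (nat list \<Rightarrow>\<^sub>0 'k::field) \<Rightarrow> (nat list \<Rightarrow>\<^sub>0 'k) set" where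
  "fibre c n g = {f. keys f \<subseteq> cliff_basis c n \<and> push hill_hull f = g}"

lemma component_Cl [simp]: "component (Cl c) n = free_module (cliff_basis c n)"
  and component_Hill [simp]: "component (Hill c) n = free_module (hill_basis c n)"
  by (simp_all add: Cl_eq Hill_def)

lemma hill_basis_subset: "hill_basis c n \<subseteq> cliff_basis c n"
  by (auto simp: hill_basis_def cliff_basis_def hills_def)

lemma push_hull_hill: "keys g \<subseteq> hill_basis c n \<Longrightarrow> push hill_hull g = g"
  by (rule push_ident) (auto simp: hill_basis_def dest: hillsD)

lemma push_hull_closed:
  "keys f \<subseteq> cliff_basis c n \<Longrightarrow> keys (push hill_hull f) \<subseteq> hill_basis c n"
  using keys_push[of hill_hull f] hull_in_hills by (fastforce simp: cliff_basis_def hill_basis_def)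

lemma in_fibre: "keys g \<subseteq> hill_basis c n \<Longrightarrow> g \<in> fibre c n g"
  using hill_basis_subset push_hull_hill by (fastforce simp: fibre_def)

lemma coset_hill_ideal:
  assumes "keys f \<subseteq> cliff_basis c n"
  shows "hill_ideal c n +>\<^bsub>free_module (cliff_basis c n)\<^esub> f = fibre c n (push hill_hull f)"
proof -
  have "(\<exists>h\<in>hill_ideal c n. f' = h + f) \<longleftrightarrow> f' \<in> fibre c n (push hill_hull f)" for f'
  proof
    assume "f' \<in> fibre c n (push hill_hull f)"
    then show "\<exists>h\<in>hill_ideal c n. f' = h + f"
      using assms
      by (intro bexI[of _ "f' - f"]) (simp_all add: hill_ideal_eq_kernel fibre_def push_diff keys_subset(2))
  next
    assume "\<exists>h\<in>hill_ideal c n. f' = h + f"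
    then show "f' \<in> fibre c n (push hill_hull f)"
      using assms by (elim bexE) (simp add: hill_ideal_eq_kernel fibre_def push_add keys_subset(1))
  qed
  then show ?thesis
    by (auto simp: a_r_coset_def')
qed

lemma fibre_add:
  assumes "keys g \<subseteq> hill_basis c n" "keys g' \<subseteq> hill_basis c n"
  shows "fibre c n g <+>\<^bsub>free_module (cliff_basis c n)\<^esub> fibre c n g' = fibre c n (g + g')"
proof -
  have "(\<exists>f\<in>fibre c n g. \<exists>f'\<in>fibre c n g'. h = f + f') \<longleftrightarrow> h \<in> fibre c n (g + g')" for h
  proof
    assume h: "h \<in> fibre c n (g + g')"
    have g': "g' \<in> fibre c n g'" using in_fibre assms(2) .
    then have "h - g' \<in> fibre c n g"
      using h by (simp add: fibre_def push_diff keys_subset(2))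
    from bexI[OF bexI[OF _ g'] this] show "\<exists>f\<in>fibre c n g. \<exists>f'\<in>fibre c n g'. h = f + f'"
      by simp
  next
    assume "\<exists>f\<in>fibre c n g. \<exists>f'\<in>fibre c n g'. h = f + f'"
    then show "h \<in> fibre c n (g + g')"
      by (elim bexE) (simp add: fibre_def push_add keys_subset(1))
  qed
  then show ?thesis
    unfolding set_add_def' free_module_simps by blast
qed

lemma elems_Hi: "elems (Hi c) n = fibre c n ` elems (Hill c) n"
proof -
  have "elems (Hi c) n = {fibre c n (push hill_hull f) | f. keys f \<subseteq> cliff_basis c n}"
    unfolding Hi_def quotient_operad_def quotient_module_def A_RCOSETS_def'
    using coset_hill_ideal[of _ c n] by auto
  also have "\<dots> = fibre c n ` elems (Hill c) n"
  proof (rule equalityI; rule subsetI)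
    fix A assume "A \<in> fibre c n ` elems (Hill c) n"
    then obtain g where g: "A = fibre c n g" "keys g \<subseteq> hill_basis c n"
      by auto
    then have "A = fibre c n (push hill_hull g)" "keys g \<subseteq> cliff_basis c n"
      using push_hull_hill[OF g(2)] hill_basis_subset[of c n] by auto
    then show "A \<in> {fibre c n (push hill_hull f) | f. keys f \<subseteq> cliff_basis c n}"
      by blast
  next
    fix A assume "A \<in> {fibre c n (push hill_hull f) | f. keys f \<subseteq> cliff_basis c n}"
    then obtain f where "A = fibre c n (push hill_hull f)" "keys f \<subseteq> cliff_basis c n"
      by blast
    then show "A \<in> fibre c n ` elems (Hill c) n"
      using push_hull_closed[of f c n] by simp
  qed
  finally show ?thesis .
qed

lemma inj_on_fibre: "inj_on (fibre c n) (elems (Hill c) n)"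
proof (rule inj_onI)
  fix g g' assume *: "g \<in> elems (Hill c) n" "g' \<in> elems (Hill c) n" "fibre c n g = fibre c n g'"
  then have "g \<in> fibre c n g'" using in_fibre[of g c n] by simp
  then show "g = g'" using * push_hull_hill[of g c n] by (simp add: fibre_def)
qed

lemma linear_on_fibre: "linear_on (component (Hill c) n) (component (Hi c) n) (fibre c n)"
  unfolding linear_on_def
proof (intro conjI ballI allI)
  show "fibre c n \<in> elems (Hill c) n \<rightarrow> elems (Hi c) n"
    by (simp add: elems_Hi)
  fix g assume g: "g \<in> elems (Hill c) n"
  show "fibre c n (g \<oplus>\<^bsub>component (Hill c) n\<^esub> g') = fibre c n g \<oplus>\<^bsub>component (Hi c) n\<^esub> fibre c n g'"
    if "g' \<in> elems (Hill c) n" for g'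
    using g that by (simp add: Hi_def quotient_operad_def quotient_module_def fibre_add)
  show "fibre c n (a \<odot>\<^bsub>component (Hill c) n\<^esub> g) = a \<odot>\<^bsub>component (Hi c) n\<^esub> fibre c n g" for a
  proof -
    have "hill_ideal c n +>\<^bsub>free_module (cliff_basis c n)\<^esub> scale a f = fibre c n (scale a g)"
      if "f \<in> fibre c n g" for f
      using that by (subst coset_hill_ideal) (auto simp: fibre_def push_scale intro!: keys_subset(3))
    moreover have "fibre c n g \<noteq> {}" using in_fibre[of g c n] g by auto
    ultimately show ?thesis
      by (simp add: Hi_def quotient_operad_def quotient_module_def)
  qed
qed

text \<open>The union defining the composition of cosets is taken over equal sets, because the
  projection of words to hulls is an operad morphism.\<close>

lemma pcomp_Hi:
  assumes "x \<in> elems (Hill c) m" "y \<in> elems (Hill c) n" "1 \<le> i" "i \<le> m"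
  shows "pcomp (Hi c) m n i (fibre c m x) (fibre c n y) = fibre c (m + n - 1) (pcomp (Hill c) m n i x y)"
proof -
  let ?I = "hill_ideal c (m + n - 1)" and ?M = "component (Cl c) (m + n - 1)"
  have *: "?I +>\<^bsub>?M\<^esub> pcomp (Cl c) m n i f g = fibre c (m + n - 1) (pcomp (Hill c) m n i x y)"
    if "f \<in> fibre c m x" "g \<in> fibre c n y" for f g
  proof -
    have fg: "f \<in> elems (Cl c) m" "g \<in> elems (Cl c) n" "push hill_hull f = x" "push hill_hull g = y"
      using that by (auto simp: fibre_def)
    have "keys (pcomp (Cl c) m n i f g) \<subseteq> cliff_basis c (m + n - 1)"
      using pcomp_based_operad_closed[of "cliff_basis c" m n insert_word i f "[]" g] fg(1,2)
      by (auto simp: Cl_eq cliff_basis_def cliffs_def)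
    moreover have "push hill_hull (pcomp (Cl c) m n i f g) = pcomp (Hill c) m n i x y"
      using operad_hom_hull[of c] fg assms(3,4) unfolding operad_hom_def by blast
    ultimately show ?thesis
      using coset_hill_ideal[of "pcomp (Cl c) m n i f g" c "m + n - 1"] by (simp del: One_nat_def)
  qed
  moreover have "fibre c m x \<noteq> {}" "fibre c n y \<noteq> {}"
    using in_fibre[of x c m] in_fibre[of y c n] assms by auto
  ultimately show ?thesis
    by (simp add: Hi_def quotient_operad_def)
qed

lemma E_hi_eq: "w \<in> cliffs c \<Longrightarrow> E_hi c w = fibre c (arity w) (single (hill_hull w) 1)"
  using coset_hill_ideal[of "single w 1" c "arity w"]
  by (simp add: E_hi_def E_cl_def) (simp add: cliff_basis_def)

lemma ounit_Hi: "ounit (Hi c) = fibre c 1 (ounit (Hill c))"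
proof -
  have "[] \<in> cliff_basis c 1" by (simp add: cliff_basis_def cliffs_def arity_def)
  then show ?thesis
    using coset_hill_ideal[of "single [] 1" c 1]
    by (simp add: Hi_def quotient_operad_def Hill_def Cl_eq)
qed

lemma zero_Hi: "\<zero>\<^bsub>component (Hi c) n\<^esub> = fibre c n \<zero>\<^bsub>component (Hill c) n\<^esub>"
  by (simp add: Hi_def quotient_operad_def quotient_module_def hill_ideal_eq_kernel fibre_def)

definition Hi_coords :: "nat \<Rightarrow> nat \<Rightarrow> (nat list \<Rightarrow>\<^sub>0 'k::field) set \<Rightarrow> nat list \<Rightarrow>\<^sub>0 'k" where
  "Hi_coords c n = inv_into (elems (Hill c) n) (fibre c n)"

lemma Hi_iso:
  shows nonsymmetric_operad_Hi: "nonsymmetric_operad (Hi c :: ('k::field, _) ns_operad)"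
    and operad_hom_fibre: "operad_hom (Hill c) (Hi c :: ('k::field, _) ns_operad) (fibre c)"
    and operad_hom_Hi_coords: "operad_hom (Hi c :: ('k::field, _) ns_operad) (Hill c) (Hi_coords c)"
proof -
  interpret Hill: nonsymmetric_operad "Hill c :: ('k::field, _) ns_operad"
    by (rule nonsymmetric_operad_Hill)
  show "nonsymmetric_operad (Hi c :: ('k::field, _) ns_operad)"
    "operad_hom (Hill c) (Hi c :: ('k::field, _) ns_operad) (fibre c)"
    "operad_hom (Hi c :: ('k::field, _) ns_operad) (Hill c) (Hi_coords c)"
    using Hill.pcomp_transport[of "Hi c" "fibre c", OF elems_Hi inj_on_fibre linear_on_fibre zero_Hi ounit_Hi pcomp_Hi]
    unfolding Hi_coords_def[abs_def] by blast+
qed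

lemma Hi_coords_fibre: "g \<in> elems (Hill c) n \<Longrightarrow> Hi_coords c n (fibre c n g) = g"
  and fibre_Hi_coords: "A \<in> elems (Hi c) n \<Longrightarrow> fibre c n (Hi_coords c n A) = A"
  unfolding Hi_coords_def elems_Hi by (rule inv_into_f_f[OF inj_on_fibre], assumption) (rule f_inv_into_f)


section \<open>Generation in arity 2\<close>

lemma letter_in_hill_basis: "a \<le> c \<Longrightarrow> [a] \<in> hill_basis c 2"
  by (simp add: hill_basis_def hills_def cliffs_def arity_def)

text \<open>A hill is the right comb of its letters: \<open>hill_comp 2 [a] h\<close> prepends
  \<open>a\<close>, and no letter is raised when \<open>a # h\<close> is weakly increasing.\<close>

lemma generates_Hill:
  "generates (Hill c :: ('k::field, _) ns_operad) {(2, single [a] 1) | a. a \<in> {0..c}}"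
  unfolding generates_def
proof (intro conjI allI impI)
  show "\<forall>(n, x)\<in>{(2, single [a] 1) | a. a \<in> {0..c}}. x \<in> elems (Hill c :: ('k, _) ns_operad) n"
    using letter_in_hill_basis by auto
  fix S n
  assume S: "suboperad (Hill c :: ('k, _) ns_operad) S \<and>
    (\<forall>(n, x)\<in>{(2, single [a] 1) | a. a \<in> {0..c}}. x \<in> S n)"
  then have unit: "ounit (Hill c) \<in> S 1" and gen: "\<And>a. a \<le> c \<Longrightarrow> single [a] (1::'k) \<in> S 2"
    and comp: "\<And>m n i x y. x \<in> S m \<Longrightarrow> y \<in> S n \<Longrightarrow> 1 \<le> i \<Longrightarrow> i \<le> m \<Longrightarrow>
      pcomp (Hill c) m n i x y \<in> S (m + n - 1)"
    and sub: "submodule (S n) scalars (free_module (hill_basis c n))" for n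
    by (auto simp: suboperad_def)
  have "single h 1 \<in> S (arity h)" if "h \<in> hills c" for h
    using that
  proof (induction h)
    case Nil
    then show ?case using unit by (simp add: Hill_def arity_def)
  next
    case (Cons a h)
    then have h: "h \<in> hills c" "a \<le> c" by (auto simp: hills_def cliffs_def)
    have "pcomp (Hill c) 2 (arity h) 2 (single [a] 1) (single h (1::'k)) \<in> S (2 + arity h - 1)"
      using gen[OF h(2)] Cons.IH[OF h(1)] by (intro comp) auto
    moreover have "hill_comp 2 [a] h = a # h"
      using hillsD(1)[OF Cons.prems] by (simp add: hill_comp_def insert_word_def)
    ultimately show ?case by (simp add: Hill_def arity_def)
  qed
  then have "f \<in> S n" if "f \<in> elems (Hill c) n" for f
    using that submodule_free_module_closed(7)[OF sub, of f "\<lambda>w. single w 1" n]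
    by (auto simp: single_expansion[symmetric] hill_basis_def)
  then show "S n = elems (Hill c) n"
    using sub[of n] by (auto simp: submodule_free_module_iff)
qed

lemma pcomp_Hill_scale:
  "pcomp (Hill c) m n i (scale a f) g = scale a (pcomp (Hill c) m n i f g)"
  "pcomp (Hill c) m n i f (scale a g) = scale a (pcomp (Hill c) m n i f g)"
  unfolding Hill_def by (rule pcomp_based_operad_scale)+

lemma not_generates_Hill:
  assumes a: "a \<le> c"
  shows "\<not> generates (Hill c :: ('k::field, _) ns_operad) {(2, single [b] 1) | b. b \<in> {0..c} - {a}}"
proof
  interpret Hill: nonsymmetric_operad "Hill c :: ('k::field, _) ns_operad"
    by (rule nonsymmetric_operad_Hill)
  \<comment> \<open>The candidate for a proper suboperad drops the direction \<open>[a]\<close> in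
    arity 2 and nothing else.\<close>
  define S where "S = (\<lambda>n. {f \<in> elems (Hill c :: ('k, _) ns_operad) n. n = 2 \<longrightarrow> lookup f [a] = 0})"
  assume gen: "generates (Hill c :: ('k, _) ns_operad) {(2, single [b] 1) | b. b \<in> {0..c} - {a}}"
  have ar1: "\<exists>b. f = scale b (ounit (Hill c))" if "f \<in> elems (Hill c) 1" for f :: "nat list \<Rightarrow>\<^sub>0 'k"
  proof -
    have "keys f \<subseteq> {[]}"
      using that by (auto simp: hill_basis_def arity_def)
    then have "f = single [] (lookup f [])"
      by (intro poly_mapping_eqI) (auto simp: lookup_single when_def in_keys_iff)
    then show ?thesis by (intro exI[of _ "lookup f []"]) (simp add: Hill_def)
  qed
  have "suboperad (Hill c) S"
    unfolding suboperad_def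
  proof (intro conjI allI ballI impI)
    show "submodule (S n) scalars (component (Hill c) n)" for n
      by (simp add: S_def submodule_free_module_iff lookup_add keys_subset)
    show "ounit (Hill c) \<in> S 1"
      using Hill.ounit_closed by (simp add: S_def)
    fix m n i x y assume xy: "x \<in> S m" "y \<in> S n" and i: "1 \<le> i" "i \<le> m"
    then have el: "x \<in> elems (Hill c) m" "y \<in> elems (Hill c) n" by (auto simp: S_def)
    have "lookup (pcomp (Hill c) m n i x y) [a] = 0" if mn: "m + n - 1 = 2"
    proof -
      \<comment> \<open>A composite of arity 2 has a factor of arity 1, which is a multiple of the
        unit, or a second factor of arity 0, which is 0. So nothing decomposable reaches
        \<open>[a]\<close>.\<close>
      consider "m = 1" "n = 2" "i = 1" | "m = 2" "n = 1" | "n = 0"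
        using mn i by linarith
      then show ?thesis
      proof cases
        case 1
        then obtain b where "x = scale b (ounit (Hill c))" using ar1 el by blast
        then have "pcomp (Hill c) m n i x y = scale b y"
          using 1 Hill.ounit_left[OF el(2)] by (simp only: pcomp_Hill_scale)
        then show ?thesis using xy 1 by (simp add: S_def)
      next
        case 2
        then obtain b where "y = scale b (ounit (Hill c))" using ar1 el by blast
        then have "pcomp (Hill c) m n i x y = scale b x"
          using 2 i Hill.ounit_right[OF i el(1)] by (simp only: pcomp_Hill_scale)
        then show ?thesis using xy 2 by (simp add: S_def)
      next
        case 3
        then have "y = 0" using el by (auto simp: hill_basis_def arity_def)
        then show ?thesis by (simp add: Hill_def pcomp_based_operad)
      qed
    qed
    then show "pcomp (Hill c) m n i x y \<in> S (m + n - 1)"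
      using Hill.pcomp_closed[OF el i] by (simp add: S_def)
  qed
  moreover have "\<forall>(n, x)\<in>{(2, single [b] 1) | b. b \<in> {0..c} - {a}}. x \<in> S n"
    using letter_in_hill_basis by (auto simp: S_def lookup_single)
  ultimately have "S 2 = elems (Hill c) 2"
    using gen unfolding generates_def by blast
  moreover have "single [a] 1 \<in> elems (Hill c :: ('k, _) ns_operad) 2"
    using letter_in_hill_basis[OF a] by simp
  ultimately have "single [a] (1::'k) \<in> S 2"
    by simp
  then show False by (simp add: S_def)
qed

lemma generates_mono:
  "generates P G \<Longrightarrow> G \<subseteq> G' \<Longrightarrow> \<forall>(n, x)\<in>G'. x \<in> elems P n \<Longrightarrow> generates P G'"
  unfolding generates_def by blast

lemma minimal_generating_set_Hill:
  "minimal_generating_set (Hill c :: ('k::field, _) ns_operad) {(2, single [a] 1) | a. a \<in> {0..c}}"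
  unfolding minimal_generating_set_def
proof (intro conjI allI impI notI generates_Hill)
  fix H assume H: "H \<subset> {(2, single [a] (1::'k)) | a. a \<in> {0..c}}" "generates (Hill c) H"
  then obtain a where a: "a \<le> c" "(2, single [a] 1) \<notin> H" by auto
  have "generates (Hill c) {(2, single [b] (1::'k)) | b. b \<in> {0..c} - {a}}"
    by (rule generates_mono[OF H(2)]) (use H(1) a letter_in_hill_basis in auto)
  then show False using not_generates_Hill[OF a(1)] by blast
qed

lemma minimal_generating_set_Hi:
  "minimal_generating_set (Hi c :: ('k::field, _) ns_operad) {(2, E_hi c [a]) | a. a \<in> {0..c}}"
proof -
  have *: "(\<lambda>(n, x). (n, fibre c n x)) ` {(2, single [a] (1::'k)) | a. a \<in> {0..c}} =
      {(2, E_hi c [a]) | a. a \<in> {0..c}}"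
  proof -
    have "E_hi c [a] = fibre c 2 (single [a] (1::'k))" if "a \<in> {0..c}" for a
      using that E_hi_eq[of "[a]" c] by (simp add: cliffs_def arity_def numeral_2_eq_2)
    then show ?thesis by (auto simp: image_iff) blast
  qed
  show ?thesis
    unfolding *[symmetric]
    by (rule minimal_generating_set_transport[OF nonsymmetric_operad_Hill nonsymmetric_operad_Hi
      operad_hom_fibre operad_hom_Hi_coords fibre_Hi_coords Hi_coords_fibre minimal_generating_set_Hill])
qed


section \<open>The quadratic presentation\<close>

text \<open>The catch-all value is the right one at a leaf; other nonbinary trees are excluded by
  \<open>tree_over (letters c)\<close>.\<close>

fun inorder :: "nat ptree \<Rightarrow> nat list" where
  "inorder (Node a [l, r]) = inorder l @ a # inorder r"
| "inorder t = []"

fun comb :: "nat list \<Rightarrow> nat ptree" where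
  "comb [] = Leaf"
| "comb (a # w) = Node a [Leaf, comb w]"

lemma tree_over_letters_Node:
  "tree_over (letters c) (Node a ts) \<longleftrightarrow>
     (\<exists>l r. ts = [l, r] \<and> a \<le> c \<and> tree_over (letters c) l \<and> tree_over (letters c) r)"
  by (auto simp: letters_def length_Suc_conv numeral_2_eq_2)

lemma tree_over_letters_induct [consumes 1, case_names Leaf Node]:
  assumes "tree_over (letters c) t" "P Leaf"
    and "\<And>a l r. a \<le> c \<Longrightarrow> tree_over (letters c) l \<Longrightarrow> tree_over (letters c) r \<Longrightarrow> P l \<Longrightarrow> P r \<Longrightarrow>
      P (Node a [l, r])"
  shows "P t"
  using assms(1)
proof (induction t)
  case (Node a ts)
  then obtain l r where "ts = [l, r]" "a \<le> c" "tree_over (letters c) l" "tree_over (letters c) r"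
    unfolding tree_over_letters_Node by blast
  then show ?case using Node.IH[of l] Node.IH[of r] assms(3) by simp
qed (rule assms(2))

lemma leaves_eq_length_inorder: "tree_over (letters c) t \<Longrightarrow> leaves t = Suc (length (inorder t))"
  by (induction rule: tree_over_letters_induct) auto

lemma inorder_subset: "tree_over (letters c) t \<Longrightarrow> inorder t \<in> cliffs c"
  by (induction rule: tree_over_letters_induct) (auto simp: cliffs_def)

lemma tree_over_graft:
  assumes "tree_over (letters c) s" "tree_over (letters c) t"
  shows "tree_over (letters c) (graft i s t)"
  using assms
  by (induction arbitrary: i rule: tree_over_letters_induct)
    (auto simp: tree_over_letters_Node simp del: tree_over.simps(2))

text \<open>Leaf \<open>i\<close> of a binary tree is the gap before letter \<open>i\<close> of its
  in-order word, the last leaf being the gap at the end. This makes \<open>tree_hill\<close>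
  compatible with composition.\<close>

lemma inorder_graft:
  assumes "tree_over (letters c) s" "1 \<le> i" "i \<le> leaves s"
  shows "inorder (graft i s t) = insert_word i (inorder s) (inorder t)"
  using assms
proof (induction arbitrary: i rule: tree_over_letters_induct)
  case Leaf
  then show ?case by (simp add: insert_word_def)
next
  case (Node a l r)
  have len: "leaves l = Suc (length (inorder l))"
    using Node leaves_eq_length_inorder by blast
  show ?case
  proof (cases "i \<le> leaves l")
    case True
    then show ?thesis
      using Node.IH(1)[of i] Node.prems len by (simp add: insert_word_def)
  next
    case False
    then obtain j where j: "i = leaves l + Suc j" by (metis less_imp_Suc_add not_le add_Suc_right)
    have "inorder (graft (Suc j) r t) = insert_word (Suc j) (inorder r) (inorder t)"
      using Node.IH(2)[of "Suc j"] Node.prems by (simp add: j)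
    then show ?thesis
      using Node.prems by (simp add: j insert_word_def len)
  qed
qed

lemma leaves_graft:
  assumes "tree_over (letters c) s" "tree_over (letters c) t" "1 \<le> i" "i \<le> leaves s"
  shows "leaves (graft i s t) = leaves s + leaves t - 1"
  using assms inorder_graft[OF assms(1,3,4)]
  by (simp add: leaves_eq_length_inorder[OF tree_over_graft] leaves_eq_length_inorder)

definition tree_basis :: "nat \<Rightarrow> nat \<Rightarrow> nat ptree set" where
  "tree_basis c n = {t. tree_over (letters c) t \<and> leaves t = n}"

lemma free_operad_letters: "free_operad (letters c) = based_operad (tree_basis c) graft Leaf"
  by (simp add: free_operad_def tree_basis_def[abs_def])

definition tree_hill :: "nat ptree \<Rightarrow> nat list" where
  "tree_hill t = hill_hull (inorder t)"

lemma operad_hom_tree_hill: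
  "operad_hom (free_operad (letters c)) (Hill c :: ('k::field, _) ns_operad) (\<lambda>n. push tree_hill)"
  unfolding free_operad_letters Hill_def
proof (rule operad_hom_push)
  show "tree_hill t \<in> hill_basis c n" if "t \<in> tree_basis c n" for t n
    using that hull_in_hills[OF inorder_subset[of c t]] leaves_eq_length_inorder[of c t]
    by (auto simp: tree_basis_def hill_basis_def tree_hill_def arity_def)
  show "tree_hill (graft i s t) = hill_comp i (tree_hill s) (tree_hill t)"
    if "s \<in> tree_basis c m" "1 \<le> i" "i \<le> m" for m i s t
    using that by (simp add: tree_basis_def tree_hill_def inorder_graft[of c] hill_comp_hull)
qed (simp add: tree_hill_def)

lemma free_pair_eq:
  "free_pair c 1 a b = single (Node a [Node b [Leaf, Leaf], Leaf]) 1"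
  "free_pair c 2 a b = single (Node a [Leaf, Node b [Leaf, Leaf]]) 1"
  by (simp_all add: free_pair_def free_operad_letters free_gen_def numeral_2_eq_2)

lemma operad_ideal_kernel:
  "operad_ideal (free_operad (letters c))
     (\<lambda>n. {f :: _ \<Rightarrow>\<^sub>0 'k::field. keys f \<subseteq> tree_basis c n \<and> push tree_hill f = 0})"
  (is "operad_ideal ?F ?K")
  unfolding operad_ideal_def
proof (intro conjI allI ballI impI)
  show "submodule (?K n) scalars (component ?F n)" for n
    unfolding free_operad_letters component_based_operad submodule_free_module_iff
    by (simp add: push_add push_scale keys_subset)
  fix m n i and x y :: "nat ptree \<Rightarrow>\<^sub>0 'k"
  assume xy: "x \<in> elems ?F m" "y \<in> elems ?F n" and i: "1 \<le> i" "i \<le> m" and K: "x \<in> ?K m \<or> y \<in> ?K n"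
  have "graft i s t \<in> tree_basis c (m + n - 1)" if "s \<in> tree_basis c m" "t \<in> tree_basis c n" for s t
    using that i by (simp add: tree_basis_def tree_over_graft leaves_graft[of c])
  then have "keys (pcomp ?F m n i x y) \<subseteq> tree_basis c (m + n - 1)"
    using pcomp_based_operad_closed[of "tree_basis c" m n graft i x Leaf y] xy
    by (simp add: free_operad_letters)
  moreover have "push tree_hill (pcomp ?F m n i x y) = pcomp (Hill c) m n i (push tree_hill x) (push tree_hill y)"
    using operad_hom_tree_hill[of c] xy i unfolding operad_hom_def by blast
  moreover have "pcomp (Hill c) m n i (push tree_hill x) (push tree_hill y) = 0"
    using K by (auto simp: Hill_def pcomp_based_operad)
  ultimately show "pcomp ?F m n i x y \<in> ?K (m + n - 1)" by simp
qed

text \<open>In the first family the in-order words are \<open>[b, a]\<close> and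
  \<open>[b, a']\<close>, both with running maxima \<open>[b, b]\<close>; in the second family both
  words are \<open>[a, b]\<close>.\<close>

lemma hill_relators_in_kernel:
  assumes "(m, f) \<in> hill_relators c"
  shows "keys f \<subseteq> tree_basis c m \<and> push tree_hill f = (0 :: _ \<Rightarrow>\<^sub>0 'k::field)"
proof -
  have "Node a [Node b [Leaf, Leaf], Leaf] \<in> tree_basis c 3" "Node a [Leaf, Node b [Leaf, Leaf]] \<in> tree_basis c 3"
    if "a \<le> c" "b \<le> c" for a b
    using that by (auto simp: tree_basis_def tree_over_letters_Node simp del: tree_over.simps(2))
  note mem = this
  consider a a' b where "m = 3" "f = free_pair c 1 a b - free_pair c 2 b a'" "b \<le> c" "a \<le> b" "a' \<le> b"
    | a b where "m = 3" "f = free_pair c 1 b a - free_pair c 2 a b" "b \<le> c" "a < b"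
    using assms by (auto simp: hill_relators_def)
  then show ?thesis
  proof cases
    case 1
    then show ?thesis
      unfolding free_pair_eq by (simp add: push_diff tree_hill_def mem keys_subset(2) max_def)
  next
    case 2
    then show ?thesis
      unfolding free_pair_eq by (simp add: push_diff tree_hill_def mem keys_subset(2) max_def)
  qed
qed

section \<open>Congruence of trees modulo an arbitrary ideal containing the relators\<close>

context
  fixes c :: nat and I :: "nat \<Rightarrow> (nat ptree \<Rightarrow>\<^sub>0 'k::field) set"
  assumes I: "operad_ideal (free_operad (letters c)) I"
    and relators: "\<forall>(m, x)\<in>hill_relators c. x \<in> I m"
begin

text \<open>Comparing single trees is enough: an element killed by \<open>push tree_hill\<close> is
  a combination of differences of trees with equal hills. Well-formedness and equal arity are built
  in so that the relation composes without side conditions.\<close>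

definition ideal_eq :: "nat ptree \<Rightarrow> nat ptree \<Rightarrow> bool" where
  "ideal_eq s t \<longleftrightarrow> tree_over (letters c) s \<and> tree_over (letters c) t \<and> leaves s = leaves t \<and>
     single s 1 - single t 1 \<in> I (leaves s)"

lemma submodule_I: "submodule (I n) scalars (free_module (tree_basis c n))"
  using I by (simp add: operad_ideal_def free_operad_letters)

lemmas I_closed = submodule_free_module_closed[OF submodule_I]

lemma ideal_eq_refl: "tree_over (letters c) t \<Longrightarrow> ideal_eq t t"
  by (simp add: ideal_eq_def I_closed(1))

lemma ideal_eq_sym: "ideal_eq s t \<Longrightarrow> ideal_eq t s"
  using I_closed(4) by (fastforce simp: ideal_eq_def)

lemma ideal_eq_trans [trans]: "ideal_eq s t \<Longrightarrow> ideal_eq t u \<Longrightarrow> ideal_eq s u"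
  using I_closed(2)[of "single s 1 - single t 1" "leaves s"
      "single t 1 - single u 1"]
  by (auto simp: ideal_eq_def)

text \<open>The arguments are exchanged one at a time: the difference is \<open>?ds\<close> composed
  with \<open>t\<close>, plus \<open>s'\<close> composed with \<open>?dt\<close>.\<close>

lemma ideal_eq_graft:
  assumes "ideal_eq s s'" "ideal_eq t t'" and i: "1 \<le> i" "i \<le> leaves s"
  shows "ideal_eq (graft i s t) (graft i s' t')"
proof -
  let ?F = "free_operad (letters c) :: ('k, _) ns_operad" and ?m = "leaves s" and ?n = "leaves t"
  let ?ds = "single s 1 - single s' (1::'k)" and ?dt = "single t 1 - single t' (1::'k)"
  have s: "tree_over (letters c) s" "tree_over (letters c) s'" "leaves s' = ?m" "?ds \<in> I ?m"
    and t: "tree_over (letters c) t" "tree_over (letters c) t'" "leaves t' = ?n" "?dt \<in> I ?n"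
    using assms(1,2) by (auto simp: ideal_eq_def)
  have "?ds \<in> elems ?F ?m" "?dt \<in> elems ?F ?n" "single t (1::'k) \<in> elems ?F ?n" "single s' (1::'k) \<in> elems ?F ?m"
    using s t by (simp_all add: free_operad_letters tree_basis_def keys_subset(2))
  then have "pcomp ?F ?m ?n i ?ds (single t 1) \<in> I (?m + ?n - 1)" "pcomp ?F ?m ?n i (single s' 1) ?dt \<in> I (?m + ?n - 1)"
    using I s(4) t(4) i unfolding operad_ideal_def by blast+
  from I_closed(2)[OF this] show ?thesis
    using s t i by (simp add: ideal_eq_def tree_over_graft leaves_graft[of c] free_operad_letters pcomp_based_operad_diff)
qed

lemma ideal_eq_Node_left:
  assumes "ideal_eq l l'" "tree_over (letters c) r" "a \<le> c"
  shows "ideal_eq (Node a [l, r]) (Node a [l', r])"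
  using ideal_eq_graft[OF ideal_eq_refl[of "Node a [Leaf, r]"] assms(1), of 1] assms(2,3)
  by (simp add: tree_over_letters_Node del: tree_over.simps(2))

lemma ideal_eq_Node_right:
  assumes "ideal_eq r r'" "tree_over (letters c) l" "a \<le> c"
  shows "ideal_eq (Node a [l, r]) (Node a [l, r'])"
  using ideal_eq_graft[OF ideal_eq_refl[of "Node a [l, Leaf]"] assms(1), of "Suc (leaves l)"] assms(2,3)
  by (simp add: tree_over_letters_Node del: tree_over.simps(2))

text \<open>Puts a relator inside a larger tree. The rightmost leaf is filled before the others, so
  that the leaves still to be filled keep their numbers.\<close>

lemma ideal_eq_relator:
  assumes "(3, single s 1 - single t (1::'k)) \<in> hill_relators c"
    "tree_over (letters c) s" "tree_over (letters c) t" "leaves s = 3" "leaves t = 3"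
    "tree_over (letters c) t1" "tree_over (letters c) t2" "tree_over (letters c) t3"
  shows "ideal_eq (graft 1 (graft 2 (graft 3 s t3) t2) t1) (graft 1 (graft 2 (graft 3 t t3) t2) t1)"
proof -
  have "ideal_eq s t"
    using assms bspec[OF relators assms(1)] by (simp add: ideal_eq_def)
  then have 3: "ideal_eq (graft 3 s t3) (graft 3 t t3)"
    using assms by (intro ideal_eq_graft ideal_eq_refl) auto
  have 2: "ideal_eq (graft 2 (graft 3 s t3) t2) (graft 2 (graft 3 t t3) t2)"
    using assms by (intro ideal_eq_graft[OF 3] ideal_eq_refl) (simp_all add: leaves_graft[of c])
  show ?thesis
    using assms by (intro ideal_eq_graft[OF 2] ideal_eq_refl) (simp_all add: leaves_graft[of c] tree_over_graft)
qed

lemma ideal_eq_rotate_le: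
  assumes "b \<le> c" "a \<le> b" "a' \<le> b"
    and t: "tree_over (letters c) t1" "tree_over (letters c) t2" "tree_over (letters c) t3"
  shows "ideal_eq (Node a [Node b [t1, t2], t3]) (Node b [t1, Node a' [t2, t3]])"
proof -
  have "(3, free_pair c 1 a b - free_pair c 2 b a' :: _ \<Rightarrow>\<^sub>0 'k) \<in> hill_relators c"
    using assms by (auto simp: hill_relators_def)
  from ideal_eq_relator[OF this[unfolded free_pair_eq] _ _ _ _ t] show ?thesis
    using assms by (simp add: tree_over_letters_Node del: tree_over.simps(2))
qed

lemma ideal_eq_rotate_less:
  assumes "b \<le> c" "a < b"
    and t: "tree_over (letters c) t1" "tree_over (letters c) t2" "tree_over (letters c) t3"
  shows "ideal_eq (Node b [Node a [t1, t2], t3]) (Node a [t1, Node b [t2, t3]])"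
proof -
  have "(3, free_pair c 1 b a - free_pair c 2 a b :: _ \<Rightarrow>\<^sub>0 'k) \<in> hill_relators c"
    using assms by (auto simp: hill_relators_def)
  from ideal_eq_relator[OF this[unfolded free_pair_eq] _ _ _ _ t] show ?thesis
    using assms by (simp add: tree_over_letters_Node del: tree_over.simps(2))
qed

text \<open>The first family with \<open>a' = a\<close> gives the rotations with
  \<open>a \<le> b\<close>, the second family all others. So rotation is unconditional, and only the
  in-order word matters.\<close>

lemma ideal_eq_rotate:
  assumes "a \<le> c" "b \<le> c"
    and t: "tree_over (letters c) t1" "tree_over (letters c) t2" "tree_over (letters c) t3"
  shows "ideal_eq (Node a [Node b [t1, t2], t3]) (Node b [t1, Node a [t2, t3]])"
proof (cases "a \<le> b")
  case True
  show ?thesis by (rule ideal_eq_rotate_le[OF assms(2) True True t])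
next
  case False
  then show ?thesis using ideal_eq_rotate_less[OF assms(1) _ t] by simp
qed

text \<open>In the first family \<open>a'\<close> is free while the left-hand side does not mention
  it, so two choices of \<open>a'\<close> are congruent to each other.\<close>

lemma ideal_eq_raise:
  assumes "b \<le> c" "a \<le> b"
    and t: "tree_over (letters c) t1" "tree_over (letters c) t2" "tree_over (letters c) t3"
  shows "ideal_eq (Node b [t1, Node a [t2, t3]]) (Node b [t1, Node b [t2, t3]])"
  using ideal_eq_trans[OF ideal_eq_sym[OF ideal_eq_rotate_le[OF assms(1) order_refl assms(2) t]]
      ideal_eq_rotate_le[OF assms(1) order_refl order_refl t]] .

lemma tree_over_comb: "w \<in> cliffs c \<Longrightarrow> tree_over (letters c) (comb w)"
  by (induction w) (auto simp: cliffs_def tree_over_letters_Node simp del: tree_over.simps(2))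

text \<open>The leading letter is its own running maximum. Raising the second letter to the maximum
  of both passes the task on to the shorter comb.\<close>

lemma ideal_eq_comb_rmax: "a # w \<in> cliffs c \<Longrightarrow> ideal_eq (comb (a # w)) (comb (a # rmax a w))"
proof (induction w arbitrary: a)
  case Nil
  then show ?case using tree_over_comb[of "[a]"] ideal_eq_refl by simp
next
  case (Cons b w)
  let ?m = "max a b"
  have c: "a \<le> c" "b \<le> c" "w \<in> cliffs c" using Cons.prems by (auto simp: cliffs_def)
  have "ideal_eq (comb (a # b # w)) (comb (a # ?m # w))"
  proof (cases "a \<le> b")
    case True
    then show ?thesis using ideal_eq_refl tree_over_comb[OF Cons.prems] by (simp add: max_def)
  next
    case False
    then show ?thesis
      using ideal_eq_raise[of a b Leaf Leaf "comb w"] c tree_over_comb[of w] by (simp add: max_def)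
  qed
  also have "ideal_eq (comb (a # ?m # w)) (comb (a # ?m # rmax ?m w))"
    using Cons.IH[of ?m] c by (auto intro!: ideal_eq_Node_right simp: cliffs_def)
  finally show ?case by simp
qed

text \<open>Each rotation moves the node \<open>a\<close> down past one letter of
  \<open>u\<close>.\<close>

lemma ideal_eq_comb_append:
  assumes "u @ a # v \<in> cliffs c"
  shows "ideal_eq (Node a [comb u, comb v]) (comb (u @ a # v))"
  using assms
proof (induction u)
  case Nil
  then show ?case using tree_over_comb[of "a # v"] ideal_eq_refl by simp
next
  case (Cons b u)
  then have c: "a \<le> c" "b \<le> c" "u \<in> cliffs c" "v \<in> cliffs c" "u @ a # v \<in> cliffs c"
    by (auto simp: cliffs_def)
  have "ideal_eq (Node a [comb (b # u), comb v]) (Node b [Leaf, Node a [comb u, comb v]])"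
    using ideal_eq_rotate[of a b Leaf "comb u" "comb v"] c tree_over_comb by simp
  also have "ideal_eq \<dots> (Node b [Leaf, comb (u @ a # v)])"
    using c Cons.IH by (intro ideal_eq_Node_right) auto
  finally show ?case by simp
qed

lemma ideal_eq_comb_inorder: "tree_over (letters c) t \<Longrightarrow> ideal_eq t (comb (inorder t))"
proof (induction rule: tree_over_letters_induct)
  case Leaf
  then show ?case using ideal_eq_refl[of Leaf] by simp
next
  case (Node a l r)
  have w: "inorder l \<in> cliffs c" "inorder r \<in> cliffs c"
    using Node inorder_subset by auto
  have "ideal_eq (Node a [l, r]) (Node a [comb (inorder l), r])"
    using Node by (intro ideal_eq_Node_left) auto
  also have "ideal_eq \<dots> (Node a [comb (inorder l), comb (inorder r)])"
    using Node w tree_over_comb by (intro ideal_eq_Node_right) auto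
  also have "ideal_eq \<dots> (comb (inorder l @ a # inorder r))"
    using Node w by (intro ideal_eq_comb_append) (auto simp: cliffs_def)
  finally show ?case by simp
qed

lemma ideal_eq_comb_tree_hill:
  assumes "tree_over (letters c) t"
  shows "ideal_eq t (comb (tree_hill t))"
proof -
  have "ideal_eq (comb (inorder t)) (comb (tree_hill t))"
  proof (cases "inorder t")
    case Nil
    then show ?thesis using ideal_eq_refl[of Leaf] by (simp add: tree_hill_def)
  next
    case (Cons a w)
    then show ?thesis
      using ideal_eq_comb_rmax[of a w] inorder_subset[OF assms] by (simp add: tree_hill_def)
  qed
  then show ?thesis using ideal_eq_comb_inorder[OF assms] ideal_eq_trans by blast
qed

text \<open>Replacing every tree of \<open>f\<close> by its normal form gives
  \<open>push comb (push tree_hill f)\<close>, which is 0. So \<open>f\<close> is the sum of the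
  corrections, and these lie in the ideal.\<close>

lemma kernel_subset_ideal:
  assumes "keys f \<subseteq> tree_basis c n" "push tree_hill f = 0"
  shows "f \<in> I n"
proof -
  have "lext (\<lambda>t. single (comb (tree_hill t)) 1) f = push comb (push tree_hill f)"
    by (simp add: push_push) (simp add: push_def)
  then have "f = lext (\<lambda>t. single t 1 - single (comb (tree_hill t)) 1) f"
    using assms(2) by (simp add: lext_fun_diff single_expansion[symmetric])
  also have "\<dots> \<in> I n"
  proof (rule I_closed(7))
    fix t assume "t \<in> keys f"
    then show "single t 1 - single (comb (tree_hill t)) 1 \<in> I n"
      using assms(1) ideal_eq_comb_tree_hill[of t] by (auto simp: ideal_eq_def tree_basis_def)
  qed
  finally show ?thesis .
qed

end

lemma generated_ideal_hill_relators:
  "generated_ideal (free_operad (letters c)) (hill_relators c) n =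
     {f :: _ \<Rightarrow>\<^sub>0 'k::field. keys f \<subseteq> tree_basis c n \<and> push tree_hill f = 0}"
proof (rule equalityI; rule subsetI)
  fix f :: "nat ptree \<Rightarrow>\<^sub>0 'k" assume "f \<in> generated_ideal (free_operad (letters c)) (hill_relators c) n"
  then show "f \<in> {f. keys f \<subseteq> tree_basis c n \<and> push tree_hill f = 0}"
    using operad_ideal_kernel[of c, where ?'k = 'k] hill_relators_in_kernel
    unfolding generated_ideal_def by blast
next
  fix f :: "nat ptree \<Rightarrow>\<^sub>0 'k" assume "f \<in> {f. keys f \<subseteq> tree_basis c n \<and> push tree_hill f = 0}"
  then show "f \<in> generated_ideal (free_operad (letters c)) (hill_relators c) n"
    using kernel_subset_ideal unfolding generated_ideal_def by blast
qed

text \<open>\<open>fibre\<close> is injective, so passing from \<open>Hill c\<close> to the quotient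
  does not enlarge the kernel.\<close>

lemma presentation_Hi:
  "\<exists>\<phi>. canonical_hom (letters c) (\<lambda>_ a. E_hi c [a]) (Hi c :: ('k::field, _) ns_operad) \<phi> \<and>
    (\<forall>n. a_kernel (component (free_operad (letters c)) n) (component (Hi c :: ('k, _) ns_operad) n) (\<phi> n) =
      generated_ideal (free_operad (letters c)) (hill_relators c) n)"
proof (intro exI conjI allI)
  let ?\<phi> = "\<lambda>n f. fibre c n (push tree_hill f :: _ \<Rightarrow>\<^sub>0 'k)"
  have hom: "operad_hom (free_operad (letters c)) (Hi c) ?\<phi>"
    by (rule operad_hom_comp[OF operad_hom_tree_hill operad_hom_fibre])
  have "?\<phi> 2 (free_gen 2 a) = E_hi c [a]" if "a \<le> c" for a
  proof -
    have "free_gen 2 a = single (Node a [Leaf, Leaf]) (1::'k)"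
      by (simp add: free_gen_def numeral_2_eq_2)
    moreover have "E_hi c [a] = fibre c 2 (single [a] (1::'k))"
      using that E_hi_eq[of "[a]" c] by (simp add: cliffs_def arity_def numeral_2_eq_2)
    ultimately show ?thesis by (simp add: tree_hill_def)
  qed
  with hom show "canonical_hom (letters c) (\<lambda>_ a. E_hi c [a]) (Hi c) ?\<phi>"
    by (auto simp: canonical_hom_def letters_def)
  fix n
  have inj: "?\<phi> n f = \<zero>\<^bsub>component (Hi c) n\<^esub> \<longleftrightarrow> push tree_hill f = 0" if "keys f \<subseteq> tree_basis c n" for f
  proof -
    have "push tree_hill f \<in> elems (Hill c) n"
      using operad_hom_tree_hill[of c] that linear_onD(1)
      unfolding operad_hom_def free_operad_letters by fastforce
    then show ?thesis
      using inj_onD[OF inj_on_fibre, of c n "push tree_hill f" 0] by (auto simp: zero_Hi)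
  qed
  show "a_kernel (component (free_operad (letters c)) n) (component (Hi c) n) (?\<phi> n) =
      generated_ideal (free_operad (letters c)) (hill_relators c) n"
    unfolding generated_ideal_hill_relators a_kernel_def kernel_def
    using inj by (auto simp: free_operad_letters)
qed


section \<open>Binary trees with joined right edges\<close>

text \<open>
  A planar tree with nodes labelled by hills is encoded by its binary refinement: a node labelled by
  the hill \<open>w\<close> becomes a chain of right edges through the letters of \<open>w\<close>, which are marked as
  joined, while the edges between nodes are the unmarked ones.
\<close>

datatype btree = Tip | Br nat bool btree btree

fun top_label :: "btree \<Rightarrow> nat" where
  "top_label Tip = 0"
| "top_label (Br x j l r) = x"

text \<open>Raising follows joined edges only: it changes the hill of the root node and no other
  node. On valid trees it is \<open>rmax m\<close> applied to that hill.\<close>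

fun raise :: "nat \<Rightarrow> btree \<Rightarrow> btree" where
  "raise m Tip = Tip"
| "raise m (Br x j l r) = Br (max m x) j l (if j then raise m r else r)"

text \<open>The contraction of the left edge of \<open>Br x j l r\<close>: the chain of \<open>l\<close> is inserted before \<open>x\<close>.\<close>

fun chain_app :: "btree \<Rightarrow> nat \<Rightarrow> bool \<Rightarrow> btree \<Rightarrow> btree" where
  "chain_app Tip x j r = Br x j Tip r"
| "chain_app (Br y k a b) x j r =
     Br y True a (raise y (if k then chain_app b x j r else Br x j b r))"

text \<open>The order is that of \<open>contractions\<close>, so signs will agree automatically.
  Below a joined edge, contracting the left edge at the root of \<open>r\<close> may bring a letter
  smaller than \<open>x\<close> to the top of the chain; \<open>raise x\<close> restores the running
  maxima.\<close>

fun contr :: "btree \<Rightarrow> btree list" where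
  "contr Tip = []"
| "contr (Br x j l r) =
     (if l = Tip then [] else [chain_app l x j r]) @
     map (\<lambda>l'. Br x j l' r) (contr l) @
     (if j then map (\<lambda>r'. Br x True l (raise x r')) (contr r)
      else (if r = Tip then [] else [Br x True l (raise x r)]) @
        map (Br x False l) (contr r))"

text \<open>The condition at joined edges says that chains are weakly increasing words; edges
  between nodes may join any labels.\<close>

fun valid :: "nat \<Rightarrow> btree \<Rightarrow> bool" where
  "valid c Tip \<longleftrightarrow> True"
| "valid c (Br x j l r) \<longleftrightarrow>
     x \<le> c \<and> valid c l \<and> valid c r \<and> (j \<longrightarrow> r \<noteq> Tip \<and> x \<le> top_label r)"

text \<open>A chain is counted at its last letter, the one whose right edge is not joined.\<close>

fun blocks :: "btree \<Rightarrow> nat" where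
  "blocks Tip = 0"
| "blocks (Br x j l r) = blocks l + blocks r + (if j then 0 else 1)"

fun bsize :: "btree \<Rightarrow> nat" where
  "bsize Tip = 0"
| "bsize (Br x j l r) = Suc (bsize l + bsize r)"

lemma raise_eq_Tip_iff [simp]: "raise m t = Tip \<longleftrightarrow> t = Tip" "Tip = raise m t \<longleftrightarrow> t = Tip"
  by (cases t; simp)+

lemma chain_app_neq_Tip [simp]: "chain_app l x j r \<noteq> Tip"
  by (cases l) auto

lemma raise_raise [simp]: "raise m (raise m' t) = raise (max m m') t"
  by (induction t) (auto simp: max.assoc)

lemma top_label_raise: "t \<noteq> Tip \<Longrightarrow> top_label (raise m t) = max m (top_label t)"
  by (cases t) auto

lemma raise_id: "valid c t \<Longrightarrow> m \<le> top_label t \<Longrightarrow> raise m t = t"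
  by (induction t) auto

lemma valid_raise: "valid c t \<Longrightarrow> m \<le> c \<Longrightarrow> valid c (raise m t)"
  by (induction t) (auto simp: top_label_raise)

lemma blocks_raise [simp]: "blocks (raise m t) = blocks t"
  and bsize_raise [simp]: "bsize (raise m t) = bsize t"
  by (induction t) auto

lemma blocks_eq_0_iff: "valid c t \<Longrightarrow> blocks t = 0 \<longleftrightarrow> t = Tip"
  by (induction t) auto

lemma bsize_eq_0_iff [simp]: "bsize t = 0 \<longleftrightarrow> t = Tip"
  by (cases t) auto

lemma bsize_chain_app [simp]: "bsize (chain_app l x j r) = Suc (bsize l + bsize r)"
  by (induction l x j r rule: chain_app.induct) auto

lemma blocks_chain_app:
  "valid c l \<Longrightarrow> l \<noteq> Tip \<Longrightarrow> Suc (blocks (chain_app l x j r)) = blocks l + blocks r + (if j then 0 else 1)"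
  by (induction l x j r rule: chain_app.induct) auto

lemma valid_chain_app:
  "valid c l \<Longrightarrow> valid c (Br x j l' r) \<Longrightarrow> valid c (chain_app l x j r)"
  by (induction l x j r rule: chain_app.induct) (auto intro!: valid_raise simp: top_label_raise)

lemma contr_cases:
  assumes "s \<in> set (contr (Br x j l r))"
  obtains "l \<noteq> Tip" "s = chain_app l x j r"
    | l' where "l' \<in> set (contr l)" "s = Br x j l' r"
    | r' where "j" "r' \<in> set (contr r)" "s = Br x True l (raise x r')"
    | "\<not> j" "r \<noteq> Tip" "s = Br x True l (raise x r)"
    | r' where "\<not> j" "r' \<in> set (contr r)" "s = Br x False l r'"
  using assms by (auto split: if_splits)

lemma contr_props:
  assumes "valid c t" "s \<in> set (contr t)"
  shows "valid c s \<and> s \<noteq> Tip \<and> Suc (blocks s) = blocks t \<and> bsize s = bsize t"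
  using assms
proof (induction t arbitrary: s)
  case (Br x j l r)
  from Br.prems(2) show ?case
  proof (cases rule: contr_cases)
    case 1
    then show ?thesis
      using Br.prems(1) valid_chain_app[of c l x j l r] blocks_chain_app[of c l x j r] by simp
  next
    case (2 l')
    then show ?thesis using Br.IH(1)[of l'] Br.prems(1) by simp
  next
    case (3 r')
    then show ?thesis using Br.IH(2)[of r'] Br.prems(1) by (simp add: top_label_raise valid_raise)
  next
    case 4
    then show ?thesis using Br.prems(1) by (simp add: top_label_raise valid_raise)
  next
    case (5 r')
    then show ?thesis using Br.IH(2)[of r'] Br.prems(1) by simp
  qed
qed simp

lemma length_contr: "valid c t \<Longrightarrow> length (contr t) = blocks t - 1"
proof (induction t)
  case (Br x j l r)
  then show ?case
    using blocks_eq_0_iff[of c l] blocks_eq_0_iff[of c r] by auto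
qed simp

lemma raise_chain_app_raise:
  "m' \<le> m \<Longrightarrow> raise m (chain_app (raise m' l) x j r) = raise m (chain_app l x j r)"
  by (induction l arbitrary: m) (auto simp: max_def)

lemma raise_chain_app_root:
  "m' \<le> m \<Longrightarrow> raise m (chain_app l (max m' x) j (if j then raise m' r else r)) = raise m (chain_app l x j r)"
proof (induction l arbitrary: m)
  case Tip
  then have "max m (max m' x) = max m x" "max m m' = m"
    by linarith+
  then show ?case by simp
next
  case (Br y k a b)
  then have "max (max m y) (max m' x) = max (max m y) x" "max (max m y) m' = max m y" "m' \<le> max m y"
    by linarith+
  then show ?case
    using Br.IH(2)[of "max m y"] by (cases j) simp_all
qed

text \<open>Contraction does not commute with \<open>raise m'\<close>, since a letter coming up from
  a left subtree has not been raised. An outer \<open>raise m\<close> with \<open>m' \<le> m\<close>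
  removes the difference.\<close>

lemma map_raise_contr_raise:
  "m' \<le> m \<Longrightarrow> map (raise m) (contr (raise m' t)) = map (raise m) (contr t)"
proof (induction t arbitrary: m)
  case (Br x j l r)
  have "map (raise (max m x)) (contr (raise m' r)) = map (raise (max m x)) (contr r)"
    using Br.IH(2)[of "max m x"] Br.prems by simp
  then have *: "map (\<lambda>r'. g (raise (max m x) r')) (contr (raise m' r)) =
      map (\<lambda>r'. g (raise (max m x) r')) (contr r)" for g :: "btree \<Rightarrow> btree"
    by (drule_tac arg_cong[of _ _ "map g"]) (simp add: comp_def)
  have "max m (max m' x) = max m x" "max m m' = m"
    using Br.prems by linarith+
  then show ?case
    using Br.prems raise_chain_app_root[of m' m l x j r] *[of "Br (max m x) True l"]
    by (cases j) (simp_all add: comp_def)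
qed simp

lemma chain_app_assoc:
  "chain_app (chain_app a y k b) x j r =
     chain_app a y True (raise y (if k then chain_app b x j r else Br x j b r))"
  by (induction a y k b rule: chain_app.induct) (simp_all add: raise_chain_app_raise)

text \<open>The contractions of the edges to the right of the root, as the new right edge and subtree.\<close>

definition contr_right :: "nat \<Rightarrow> bool \<Rightarrow> btree \<Rightarrow> (bool \<times> btree) list" where
  "contr_right x j r =
     (if j then map (\<lambda>r'. (True, raise x r')) (contr r)
      else (if r = Tip then [] else [(True, raise x r)]) @ map (Pair False) (contr r))"

lemma contr_Br:
  "contr (Br x j l r) =
     (if l = Tip then [] else [chain_app l x j r]) @ map (\<lambda>l'. Br x j l' r) (contr l) @
     map (\<lambda>(j', r'). Br x j' l r') (contr_right x j r)"
  by (simp add: contr_right_def)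

declare contr.simps(2) [simp del]

text \<open>Contracting the left edge leaves the remaining edges in their order. This is the case of
  the presimplicial identity in which one of the two edges is the left edge at the root.\<close>

lemma contr_chain_app:
  "contr (chain_app l x j r) =
     map (\<lambda>l'. chain_app l' x j r) (contr l) @
     map (\<lambda>(j', r'). chain_app l x j' r') (contr_right x j r)"
proof (induction l x j r rule: chain_app.induct)
  case (1 x j r)
  then show ?case by (simp add: contr_Br)
next
  case (2 y k a b x j r)
  define Z where "Z = (if k then chain_app b x j r else Br x j b r)"
  have "map (\<lambda>r'. Br y True a (raise y r')) (contr (raise y Z)) =
      map (Br y True a) (map (raise y) (contr (raise y Z)))"
    by simp
  also have "\<dots> = map (Br y True a) (map (raise y) (contr Z))"
    by (subst map_raise_contr_raise) simp_all
  finally have *: "map (\<lambda>r'. Br y True a (raise y r')) (contr (raise y Z)) =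
      map (\<lambda>r'. Br y True a (raise y r')) (contr Z)"
    by simp
  have L: "contr (chain_app (Br y k a b) x j r) =
      (if a = Tip then [] else [chain_app a y True (raise y Z)]) @
      map (\<lambda>a'. Br y True a' (raise y Z)) (contr a) @ map (\<lambda>r'. Br y True a (raise y r')) (contr Z)"
    by (simp add: Z_def[symmetric] contr.simps(2)[of y True] *)
  show ?case
  proof (cases k)
    case True
    then show ?thesis
      using 2 unfolding L by (simp add: Z_def contr_Br[of y True] contr_right_def[of y] chain_app_assoc
          raise_chain_app_raise comp_def case_prod_unfold)
  next
    case False
    then show ?thesis
      unfolding L by (simp add: Z_def contr_Br[of y False] contr_Br[of x] contr_right_def[of y] chain_app_assoc
          raise_chain_app_raise comp_def case_prod_unfold)
  qed
qed

text \<open>The presimplicial identity restricted to edges right of the root. Two contractions there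
  raise by \<open>x\<close> twice, and the inner raise is absorbed by the outer one.\<close>

lemma contr_right_contr:
  assumes IH: "\<And>i j. i < j \<Longrightarrow> j < length (contr r) \<Longrightarrow>
      contr (contr r ! i) ! (j - 1) = contr (contr r ! j) ! i"
    and r: "valid c r" and ij: "i < j" "j < length (contr_right x k r)"
  shows "case_prod (contr_right x) (contr_right x k r ! i) ! (j - 1) =
    case_prod (contr_right x) (contr_right x k r ! j) ! i"
proof -
  have *: "map (\<lambda>r'. (True, raise x r')) (contr (raise x s)) =
      map (\<lambda>r'. (True, raise x r')) (contr s)" for s
    using arg_cong[OF map_raise_contr_raise[of x x s], of "map (Pair True)"] by (simp add: comp_def)
  have len: "length (contr (contr r ! i)) = length (contr r) - 1" "contr r ! i \<noteq> Tip"
    if "i < length (contr r)" for i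
    using contr_props[OF r nth_mem[OF that]] length_contr r by auto
  show ?thesis
  proof (cases k)
    case True
    then show ?thesis
      using ij IH[of i j] len(1)[of i] len(1)[of j] by (auto simp: contr_right_def *)
  next
    case False
    with ij have "r \<noteq> Tip" by (auto simp: contr_right_def)
    then obtain j' where j': "j = Suc j'" "j' < length (contr r)"
      using ij False by (cases j) (auto simp: contr_right_def)
    show ?thesis
    proof (cases i)
      \<comment> \<open>Index 0 is the unjoined right edge itself: whether it is joined before or
        after a contraction inside \<open>r\<close>, the result is joined and raised by
        \<open>x\<close>.\<close>
      case 0
      then show ?thesis
        using j' False \<open>r \<noteq> Tip\<close> len[of j'] by (auto simp: contr_right_def *)
    next
      case (Suc i')
      then show ?thesis
        using j' False \<open>r \<noteq> Tip\<close> len[of j'] len[of i'] ij IH[of i' j']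
        by (cases j') (auto simp: contr_right_def)
    qed
  qed
qed

text \<open>This presimplicial identity gives \<open>d \<circ> d = 0\<close>.\<close>

lemma contr_contr:
  "valid c t \<Longrightarrow> i < j \<Longrightarrow> j < length (contr t) \<Longrightarrow>
   contr (contr t ! i) ! (j - 1) = contr (contr t ! j) ! i"
proof (induction t arbitrary: i j)
  case (Br x k l r)
  let ?R = "contr_right x k r"
  have l: "valid c l" and r: "valid c r"
    using Br.prems by auto
  have IHr: "\<And>i j. i < j \<Longrightarrow> j < length (contr r) \<Longrightarrow>
      contr (contr r ! i) ! (j - 1) = contr (contr r ! j) ! i"
    using Br.IH(2) r by blast
  have len: "length (contr (contr l ! i)) = length (contr l) - 1" "contr l ! i \<noteq> Tip"
    if "i < length (contr l)" for i
    using contr_props[OF l nth_mem[OF that]] length_contr l by auto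
  \<comment> \<open>Lengths are read off from block counts: a contraction removes exactly one
    block.\<close>
  have lenR: "length (case_prod (contr_right x) (?R ! n)) = length ?R - 1" if n: "n < length ?R" for n
  proof -
    obtain k' r' where kr: "?R ! n = (k', r')"
      by fastforce
    have "(\<lambda>(k', r'). Br x k' l r') (?R ! n) \<in> set (contr (Br x k l r))"
      using nth_mem[OF n] by (simp only: contr_Br set_append set_map) blast
    then have "Br x k' l r' \<in> set (contr (Br x k l r))"
      by (simp add: kr)
    then have "valid c (Br x k' l r')" "Suc (blocks (Br x k' l r')) = blocks (Br x k l r)"
      using contr_props[OF Br.prems(1)] by blast+
    then show ?thesis
      using length_contr[of c "Br x k' l r'"] length_contr[OF Br.prems(1)]
      by (simp add: contr_Br kr split: if_splits)
  qed
  have RR: "case_prod (contr_right x) (?R ! i) ! (j - 1) = case_prod (contr_right x) (?R ! j) ! i"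
    if "i < j" "j < length ?R" for i j
    using contr_right_contr[OF IHr r that] by simp
  show ?case
  proof (cases "l = Tip")
    case True
    then show ?thesis
      using Br.prems RR[of i j] lenR[of i] lenR[of j]
      by (cases "?R ! i"; cases "?R ! j") (simp add: contr_Br)
  next
    case l: False
    \<comment> \<open>For a nonempty \<open>l\<close> the list has the left edge at position 0,
      followed by the contractions inside \<open>l\<close> and those right of the root. The cases
      below locate \<open>i\<close> and \<open>j\<close> in these segments.\<close>
    have nth0: "contr (Br x k' l' r') ! 0 = chain_app l' x k' r'" if "l' \<noteq> Tip" for l' k' r'
      using that by (simp add: contr_Br)
    have nthl: "contr (Br x k' l' r') ! Suc n = Br x k' (contr l' ! n) r'"
      if "l' \<noteq> Tip" "n < length (contr l')" for l' k' r' n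
      using that by (simp add: contr_Br nth_append)
    have nthr: "contr (Br x k' l' r') ! Suc (length (contr l') + n) =
        (case contr_right x k' r' ! n of (k'', r'') \<Rightarrow> Br x k'' l' r'')"
      if "l' \<noteq> Tip" "n < length (contr_right x k' r')" for l' k' r' n
      using that by (simp add: contr_Br nth_append)
    obtain j' where j': "j = Suc j'" "j' < length (contr l) + length ?R"
      using Br.prems by (cases j) (auto simp: contr_Br split: if_splits)
    consider (ll) "j' < length (contr l)" | (r) n where "j' = length (contr l) + n" "n < length ?R"
      using j' le_Suc_ex[of "length (contr l)" j'] by fastforce
    then show ?thesis
    proof cases
      case ll
      have tj: "contr (Br x k l r) ! j = Br x k (contr l ! j') r"
        unfolding j'(1) by (rule nthl[OF l ll])
      show ?thesis
      proof (cases i)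
        case 0
        have "contr (contr (Br x k l r) ! i) ! (j - 1) = chain_app (contr l ! j') x k r"
          unfolding 0 nth0[OF l] contr_chain_app using ll j' by (simp add: nth_append)
        then show ?thesis
          unfolding tj 0 nth0[OF len(2)[OF ll]] .
      next
        case (Suc i')
        then have i': "i' < j'" "i' < length (contr l)" using Br.prems j' ll by auto
        have ti: "contr (Br x k l r) ! i = Br x k (contr l ! i') r"
          unfolding Suc by (rule nthl[OF l i'(2)])
        obtain m where m: "j' = Suc m" using i' by (cases j') auto
        have "contr (Br x k (contr l ! i') r) ! Suc m = Br x k (contr (contr l ! i') ! m) r"
          using len[OF i'(2)] ll m by (intro nthl) auto
        moreover have "contr (Br x k (contr l ! j') r) ! Suc i' = Br x k (contr (contr l ! j') ! i') r"
          using len[OF ll] ll i' by (intro nthl) auto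
        moreover have "contr (contr l ! i') ! m = contr (contr l ! j') ! i'"
          using Br.IH(1)[OF \<open>valid c l\<close> i'(1) ll] m by simp
        ultimately show ?thesis
          unfolding ti tj by (simp add: j' Suc m)
      qed
    next
      case r
      obtain k' r' where kr: "?R ! n = (k', r')"
        by fastforce
      have tj: "contr (Br x k l r) ! j = Br x k' l r'"
        unfolding j'(1) r(1) nthr[OF l r(2)] kr by simp
      show ?thesis
      proof (cases i)
        case 0
        have "contr (contr (Br x k l r) ! i) ! (j - 1) = chain_app l x k' r'"
          unfolding 0 nth0[OF l] contr_chain_app using r j' by (simp add: nth_append kr)
        then show ?thesis
          unfolding tj 0 nth0[OF l] .
      next
        case (Suc i')
        then have "i' < j'" using Br.prems j' by simp
        show ?thesis
        proof (cases "i' < length (contr l)")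
          case True
          have ti: "contr (Br x k l r) ! i = Br x k (contr l ! i') r"
            unfolding Suc by (rule nthl[OF l True])
          have "j' = Suc (length (contr (contr l ! i')) + n)"
            using len[OF True] r True by simp
          then have "contr (Br x k (contr l ! i') r) ! j' = Br x k' (contr l ! i') r'"
            using nthr[OF len(2)[OF True] r(2)] kr by simp
          moreover have "contr (Br x k' l r') ! Suc i' = Br x k' (contr l ! i') r'"
            by (rule nthl[OF l True])
          ultimately show ?thesis
            unfolding ti tj by (simp add: j' Suc)
        next
          case False
          then obtain n' where n': "i' = length (contr l) + n'" "n' < n"
            using \<open>i' < j'\<close> r le_Suc_ex[of "length (contr l)" i'] by auto
          then have n'R: "n' < length ?R" using r by simp
          obtain k'' r'' where kr': "?R ! n' = (k'', r'')"
            by fastforce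
          have ti: "contr (Br x k l r) ! i = Br x k'' l r''"
            unfolding Suc n'(1) nthr[OF l n'R] kr' by simp
          obtain m where m: "n = Suc m" using n' by (cases n) auto
          have "contr (Br x k'' l r'') ! Suc (length (contr l) + m) =
              (case contr_right x k'' r'' ! m of (k, r) \<Rightarrow> Br x k l r)"
            using lenR[OF n'R] kr' r(2) m by (intro nthr[OF l]) simp
          moreover have "contr (Br x k' l r') ! Suc (length (contr l) + n') =
              (case contr_right x k' r' ! n' of (k, r) \<Rightarrow> Br x k l r)"
            using lenR[OF r(2)] kr n' r(2) by (intro nthr[OF l]) simp
          moreover have "contr_right x k'' r'' ! m = contr_right x k' r' ! n'"
            using RR[OF n'(2) r(2)] unfolding kr kr' prod.case by (simp add: m)
          ultimately show ?thesis
            unfolding ti tj by (simp add: j' Suc n' r(1) m)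
        qed
      qed
    qed
  qed
qed simp


section \<open>Matching trees along their first admissible edge\<close>

text \<open>
  The first right edge in preorder that may be joined decides the status of a tree, and toggling it
  is the matching.
\<close>

datatype status = Critical | Joined | Cut

fun edge_status :: "btree \<Rightarrow> status" where
  "edge_status Tip = Critical"
| "edge_status (Br x j l r) =
     (if r \<noteq> Tip \<and> x \<le> top_label r then if j then Joined else Cut
      else if edge_status l \<noteq> Critical then edge_status l else edge_status r)"

fun toggle :: "btree \<Rightarrow> btree" where
  "toggle Tip = Tip"
| "toggle (Br x j l r) =
     (if r \<noteq> Tip \<and> x \<le> top_label r then Br x (\<not> j) l r
      else if edge_status l \<noteq> Critical then Br x j (toggle l) r else Br x j l (toggle r))"

fun skeleton :: "btree \<Rightarrow> btree" where
  "skeleton Tip = Tip"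
| "skeleton (Br x j l r) = Br x False (skeleton l) (skeleton r)"

text \<open>Contracting an edge that is not admissible rotates a left edge or raises a label; both lower the rank.\<close>

fun rank :: "nat \<Rightarrow> btree \<Rightarrow> nat" where
  "rank c Tip = 0"
| "rank c (Br x j l r) = rank c l + rank c r + bsize l + (c - x)"

lemma toggle_eq_Tip_iff [simp]: "toggle t = Tip \<longleftrightarrow> t = Tip"
  and top_label_toggle [simp]: "top_label (toggle t) = top_label t"
  and bsize_toggle [simp]: "bsize (toggle t) = bsize t"
  by (induction t) auto

lemma rank_toggle [simp]: "rank c (toggle t) = rank c t"
  by (induction t) auto

lemma edge_status_toggle:
  "edge_status (toggle t) =
     (case edge_status t of Critical \<Rightarrow> Critical | Joined \<Rightarrow> Cut | Cut \<Rightarrow> Joined)"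
  by (induction t) (auto split: status.splits)

lemma toggle_toggle [simp]: "toggle (toggle t) = t"
proof (induction t)
  case (Br x j l r)
  have "edge_status (toggle l) = Critical \<longleftrightarrow> edge_status l = Critical"
    by (simp add: edge_status_toggle split: status.splits)
  with Br show ?case by auto
qed simp

lemma valid_toggle: "valid c t \<Longrightarrow> valid c (toggle t)"
  by (induction t) auto

lemma blocks_toggle: "valid c t \<Longrightarrow> edge_status t = Joined \<Longrightarrow> blocks (toggle t) = Suc (blocks t)"
  by (induction t) (auto split: if_splits)

text \<open>By validity a joined edge is joinable, so a critical tree has no joined edge and each
  letter is a block by itself.\<close>

lemma blocks_eq_bsize_if_Critical: "valid c t \<Longrightarrow> edge_status t = Critical \<Longrightarrow> blocks t = bsize t"
  by (induction t) (auto split: if_splits)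

lemma skeleton_eq_Tip_iff [simp]: "skeleton t = Tip \<longleftrightarrow> t = Tip" "Tip = skeleton t \<longleftrightarrow> t = Tip"
  by (cases t; simp)+

lemma skeleton_eqD:
  assumes "skeleton s = skeleton t"
  shows "top_label s = top_label t" "s = Tip \<longleftrightarrow> t = Tip" "edge_status s = Critical \<longleftrightarrow> edge_status t = Critical"
    "rank c s = rank c t" "bsize s = bsize t"
proof -
  have "s = Tip \<longleftrightarrow> t = Tip"
    using assms by (metis skeleton_eq_Tip_iff(1))
  moreover have "top_label (skeleton u) = top_label u" "(edge_status (skeleton u) = Critical) = (edge_status u = Critical)"
    "bsize (skeleton u) = bsize u" for u
    by (induction u) auto
  moreover from this(3) have "rank c (skeleton u) = rank c u" for u
    by (induction u) auto
  ultimately show "top_label s = top_label t" "s = Tip \<longleftrightarrow> t = Tip" "edge_status s = Critical \<longleftrightarrow> edge_status t = Critical"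
    "rank c s = rank c t" "bsize s = bsize t"
    using assms by metis+
qed

lemma rank_raise_le: "rank c (raise m t) \<le> rank c t"
  by (induction t) (auto intro!: add_mono)

lemma rank_raise_less:
  assumes "t \<noteq> Tip" "top_label t < m" "m \<le> c"
  shows "rank c (raise m t) < rank c t"
proof -
  obtain x j l r where t: "t = Br x j l r" using assms(1) by (cases t) auto
  have "rank c (if j then raise m r else r) \<le> rank c r"
    using rank_raise_le by simp
  then show ?thesis using assms t by (auto simp: max_def)
qed

text \<open>The node \<open>x\<close> moves down into the right part of \<open>l\<close>, so its
  left subtree loses at least the root of \<open>l\<close>. No other left subtree changes size, and
  raising letters can only lower the rank.\<close>

lemma rank_chain_app_le: "rank c (chain_app l x j r) \<le> rank c (Br x j l r)"
  and rank_chain_app_less: "l \<noteq> Tip \<Longrightarrow> rank c (chain_app l x j r) < rank c (Br x j l r)"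
proof -
  have "rank c (chain_app l x j r) + (if l = Tip then 0 else 1) \<le> rank c (Br x j l r)"
  proof (induction l x j r rule: chain_app.induct)
    case (2 y k a b x j r)
    have "rank c (raise y (if k then chain_app b x j r else Br x j b r)) \<le>
        rank c (if k then chain_app b x j r else Br x j b r)"
      by (rule rank_raise_le)
    also have "\<dots> \<le> rank c (Br x j b r)"
      using 2 by (auto split: if_splits)
    finally show ?case by simp
  qed simp
  then show "rank c (chain_app l x j r) \<le> rank c (Br x j l r)"
    "l \<noteq> Tip \<Longrightarrow> rank c (chain_app l x j r) < rank c (Br x j l r)"
    by (auto split: if_splits)
qed

text \<open>Only joining an admissible edge leaves labels and shape alone; a rotation, or a right
  edge descending in label, costs rank.\<close>

lemma contr_rank:
  assumes "valid c t" "s \<in> set (contr t)"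
  shows "rank c s < rank c t \<or> skeleton s = skeleton t"
  using assms
proof (induction t arbitrary: s)
  case (Br x j l r)
  from Br.prems(2) show ?case
  proof (cases rule: contr_cases)
    case 1
    then show ?thesis
      using rank_chain_app_less by blast
  next
    case (2 l')
    then show ?thesis using Br.IH(1)[of l'] Br.prems(1) contr_props[of c l l'] by auto
  next
    case (3 r')
    then have r': "valid c r'" "rank c r' < rank c r \<or> skeleton r' = skeleton r"
      using Br.prems(1) contr_props[of c r r'] Br.IH(2)[of r'] by auto
    show ?thesis
    proof (cases "rank c r' < rank c r")
      case True
      then show ?thesis using 3 rank_raise_le[of c x r'] by simp
    next
      case False
      \<comment> \<open>If \<open>r'\<close> has the skeleton of \<open>r\<close>, its top label is
        still at least \<open>x\<close>, and raising by \<open>x\<close> changes nothing.\<close>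
      then have "raise x r' = r'"
        using r' Br.prems(1) 3(1) skeleton_eqD(1)[of r' r] by (intro raise_id[of c]) auto
      then show ?thesis using False r' 3 by simp
    qed
  next
    case 4
    then show ?thesis
      using Br.prems(1) raise_id[of c r x] rank_raise_less[of r x c] by fastforce
  next
    case (5 r')
    then show ?thesis using Br.IH(2)[of r'] Br.prems(1) by auto
  qed
qed simp

text \<open>Joining an admissible edge other than the first keeps the labels, so the first one stays
  admissible and cut; every contraction not of this kind lowers the rank. Thus
  \<open>toggle t\<close> is the only joined tree of full rank in the boundary of
  \<open>t\<close>.\<close>

lemma contr_toggle:
  assumes "valid c t" "edge_status t = Cut"
  shows "\<exists>xs ys. contr t = xs @ toggle t # ys \<and>
    (\<forall>s\<in>set (xs @ ys). rank c s < rank c t \<or> edge_status s = Cut)"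
  using assms
proof (induction t)
  case (Br x j l r)
  define A where "A = (if l = Tip then [] else [chain_app l x j r])"
  have l: "valid c l" and r: "valid c r" and x: "x \<le> c" using Br.prems by auto
  have I: "\<exists>xs ys. contr u = xs @ toggle u # ys \<and> (\<forall>s\<in>set (xs @ ys). rank c s < rank c u \<or> edge_status s = Cut)"
    if "contr u = xs @ toggle u # ys" "\<And>s. s \<in> set xs \<or> s \<in> set ys \<Longrightarrow> rank c s < rank c u \<or> edge_status s = Cut"
    for u xs ys using that by (metis UnE set_append)
  have rank_A: "rank c s < rank c (Br x j l r)" if "s \<in> set A" for s
    using that rank_chain_app_less[of l c x j r] by (auto simp: A_def split: if_splits)
  have face_l: "rank c l' < rank c l \<and> rank c (Br x False l' r) < rank c (Br x False l r) \<or> skeleton l' = skeleton l"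
    if "l' \<in> set (contr l)" for l'
    using contr_rank[OF l that] contr_props[OF l that] by auto
  have face_r: "rank c (Br x False l r') < rank c (Br x False l r) \<or> skeleton r' = skeleton r"
    if "r' \<in> set (contr r)" for r'
    using contr_rank[OF r that] by auto
  show ?case
  proof (cases "r \<noteq> Tip \<and> x \<le> top_label r")
    case True
    with Br.prems have j: "\<not> j" by auto
    have "raise x r = r" using True r by (intro raise_id[of c]) auto
    then have "contr (Br x j l r) = (A @ map (\<lambda>l'. Br x j l' r) (contr l)) @ toggle (Br x j l r) #
        map (Br x False l) (contr r)"
      using True j by (simp add: contr.simps(2) A_def)
    moreover have "edge_status (Br x j l' r) = Cut" for l'
      using True j by simp
    moreover have "rank c (Br x False l r') < rank c (Br x j l r) \<or> edge_status (Br x False l r') = Cut"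
      if "r' \<in> set (contr r)" for r'
      using face_r[OF that] True skeleton_eqD(1,2)[of r' r] j by auto
    ultimately show ?thesis
      using rank_A by - (rule I, assumption, auto simp del: edge_status.simps rank.simps toggle.simps)
  next
    case not_adm: False
    \<comment> \<open>A joined edge would be admissible by validity.\<close>
    with Br.prems have j: "\<not> j" by auto
    define C where "C = (if r = Tip then [] else [Br x True l (raise x r)])"
    have rank_C: "rank c s < rank c (Br x j l r)" if "s \<in> set C" for s
      using that not_adm x rank_raise_less[of r x c] by (auto simp: C_def split: if_splits)
    have contr: "contr (Br x j l r) = A @ map (\<lambda>l'. Br x j l' r) (contr l) @ C @ map (Br x False l) (contr r)"
      using j by (simp add: contr.simps(2) A_def C_def)
    have not_adm': "\<not> (r' \<noteq> Tip \<and> x \<le> top_label r')" if "skeleton r' = skeleton r" for r'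
      using skeleton_eqD(1,2)[OF that] not_adm by auto
    show ?thesis
    proof (cases "edge_status l = Critical")
      case False
      then have "edge_status l = Cut" using Br.prems not_adm by auto
      with Br.IH(1) l obtain xs ys where xy: "contr l = xs @ toggle l # ys"
        "\<And>s. s \<in> set (xs @ ys) \<Longrightarrow> rank c s < rank c l \<or> edge_status s = Cut"
        by blast
      have "contr (Br x j l r) = (A @ map (\<lambda>l'. Br x j l' r) xs) @ toggle (Br x j l r) #
          (map (\<lambda>l'. Br x j l' r) ys @ C @ map (Br x False l) (contr r))"
        using False not_adm by (auto simp: contr xy(1))
      moreover have "rank c (Br x j l' r) < rank c (Br x j l r) \<or> edge_status (Br x j l' r) = Cut"
        if "l' \<in> set (xs @ ys)" for l'
        using xy(2)[OF that] face_l[of l'] that not_adm j contr_props[OF l, of l'] by (auto simp: xy(1))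
      moreover have "rank c (Br x False l r') < rank c (Br x j l r) \<or> edge_status (Br x False l r') = Cut"
        if "r' \<in> set (contr r)" for r'
        using face_r[OF that] not_adm'[of r'] \<open>edge_status l = Cut\<close> j by auto
      ultimately show ?thesis
        using rank_A rank_C by - (rule I, assumption, auto simp del: edge_status.simps rank.simps toggle.simps)
    next
      case True
      then have "edge_status r = Cut" using Br.prems not_adm by auto
      with Br.IH(2) r obtain xs ys where xy: "contr r = xs @ toggle r # ys"
        "\<And>s. s \<in> set (xs @ ys) \<Longrightarrow> rank c s < rank c r \<or> edge_status s = Cut"
        by blast
      have "contr (Br x j l r) = (A @ map (\<lambda>l'. Br x j l' r) (contr l) @ C @ map (Br x False l) xs) @
          toggle (Br x j l r) # map (Br x False l) ys"
        unfolding contr xy(1) using True not_adm j by auto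
      moreover have "rank c (Br x j l' r) < rank c (Br x j l r) \<or> edge_status (Br x j l' r) = Cut"
        if "l' \<in> set (contr l)" for l'
        using face_l[OF that] not_adm j True skeleton_eqD(3)[of l' l] \<open>edge_status r = Cut\<close> by auto
      moreover have "rank c (Br x False l r') < rank c (Br x j l r) \<or> edge_status (Br x False l r') = Cut"
        if "r' \<in> set (xs @ ys)" for r'
        using face_r[of r'] xy(2)[OF that] that not_adm'[of r'] True j by (auto simp: xy(1))
      ultimately show ?thesis
        using rank_A rank_C by - (rule I, assumption, auto simp del: edge_status.simps rank.simps toggle.simps)
    qed
  qed
qed simp


section \<open>Acyclicity of the complex of binary trees\<close>

fun alternating :: "'a list \<Rightarrow> 'a \<Rightarrow>\<^sub>0 'k::field" where
  "alternating [] = 0"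
| "alternating (x # xs) = single x 1 - alternating xs"

definition boundary :: "(btree \<Rightarrow>\<^sub>0 'k::field) \<Rightarrow> btree \<Rightarrow>\<^sub>0 'k" where
  "boundary = lext (\<lambda>t. alternating (contr t))"

definition trees :: "nat \<Rightarrow> nat \<Rightarrow> nat \<Rightarrow> btree set" where
  "trees c n k = {t. valid c t \<and> bsize t = n \<and> blocks t = k}"

lemma alternating_eq_sum:
  "alternating xs = (\<Sum>i<length xs. single (xs ! i) ((-1) ^ i))"
proof (induction xs)
  case (Cons x xs)
  show ?case
    unfolding alternating.simps Cons length_Cons sum.lessThan_Suc_shift
    by (simp add: single_uminus sum_negf)
qed simp

lemma alternating_append:
  "alternating (xs @ ys) = alternating xs + scale ((-1) ^ length xs) (alternating ys)"
  by (induction xs) (simp_all add: scale_uminus)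

lemma keys_alternating: "keys (alternating xs :: 'a \<Rightarrow>\<^sub>0 'k::field) \<subseteq> set xs"
proof (induction xs)
  case (Cons x xs)
  then show ?case
    using keys_diff[of "single x (1::'k)" "alternating xs"] by fastforce
qed simp

lemma lookup_alternating: "x \<notin> set xs \<Longrightarrow> lookup (alternating xs) x = 0"
  using keys_alternating[of xs] by (auto simp: in_keys_iff subset_iff)

lemma boundary_closed:
  assumes "keys z \<subseteq> trees c n (Suc k)"
  shows "keys (boundary z) \<subseteq> trees c n k"
  unfolding boundary_def
proof (rule lext_closed)
  fix t assume "t \<in> keys z"
  then have "set (contr t) \<subseteq> trees c n k"
    using assms contr_props[of c t] by (auto simp: trees_def)
  then show "keys (alternating (contr t)) \<subseteq> trees c n k"
    by (rule order_trans[OF keys_alternating])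
qed

text \<open>The pair (i, j) with i at most j is cancelled by the pair (j + 1, i), which carries the
  same term with the opposite sign.\<close>

lemma alternating_sum_cancel:
  fixes f :: "nat \<Rightarrow> nat \<Rightarrow> 'a"
  assumes "\<And>i j. i < j \<Longrightarrow> j < m \<Longrightarrow> f i (j - 1) = f j i"
  shows "(\<Sum>i<m. \<Sum>j<m - 1. single (f i j) ((-1) ^ (i + j) :: 'k::field)) = 0"
proof -
  let ?s = "\<lambda>(i, j). single (f i j) ((-1) ^ (i + j) :: 'k)"
  let ?U = "{(i, j). i \<le> j \<and> j < m - 1}" and ?L = "{(i, j). j < i \<and> i < m}"
  have fin: "finite ?U" "finite ?L"
    by (rule finite_subset[of _ "{..m} \<times> {..m}"]; auto)+
  have "(\<Sum>i<m. \<Sum>j<m - 1. ?s (i, j)) = sum ?s ({..<m} \<times> {..<m - 1})"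
    by (simp add: sum.cartesian_product)
  also have "{..<m} \<times> {..<m - 1} = ?U \<union> ?L"
    by auto
  also have "sum ?s (?U \<union> ?L) = sum ?s ?U + sum ?s ?L"
    using fin by (intro sum.union_disjoint) auto
  also have "sum ?s ?U = sum (\<lambda>p. - ?s p) ?L"
  proof (rule sum.reindex_bij_witness[of _ "\<lambda>(j, i). (i, j - 1)" "\<lambda>(i, j). (Suc j, i)"])
    fix p assume "p \<in> ?U"
    then show "- ?s (case p of (i, j) \<Rightarrow> (Suc j, i)) = ?s p"
      using assms[of "fst p" "Suc (snd p)"] by (auto simp: single_uminus add.commute)
  qed auto
  finally show ?thesis
    by (simp add: sum_negf)
qed

lemma boundary_boundary:
  assumes "keys (z :: btree \<Rightarrow>\<^sub>0 'k::field) \<subseteq> {t. valid c t}"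
  shows "boundary (boundary z) = 0"
proof -
  have "lext (\<lambda>t. alternating (contr t)) (alternating (contr t)) = (0 :: btree \<Rightarrow>\<^sub>0 'k)"
    if "t \<in> keys z" for t
  proof -
    have t: "valid c t" using assms that by auto
    let ?m = "length (contr t)"
    have len: "length (contr (contr t ! i)) = ?m - 1" if "i < ?m" for i
      using contr_props[OF t nth_mem[OF that]] length_contr t by auto
    have "lext (\<lambda>t. alternating (contr t)) (alternating (contr t)) =
        (\<Sum>i<?m. scale ((-1) ^ i) (alternating (contr (contr t ! i)) :: btree \<Rightarrow>\<^sub>0 'k))"
      by (subst alternating_eq_sum) (simp add: lext_sum)
    also have "\<dots> = (\<Sum>i<?m. \<Sum>j<?m - 1. single (contr (contr t ! i) ! j) ((-1) ^ (i + j)))"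
    proof (rule sum.cong)
      fix i assume "i \<in> {..<?m}"
      then show "scale ((-1) ^ i) (alternating (contr (contr t ! i)) :: btree \<Rightarrow>\<^sub>0 'k) =
          (\<Sum>j<?m - 1. single (contr (contr t ! i) ! j) ((-1) ^ (i + j)))"
        by (subst alternating_eq_sum) (simp add: len scale_sum power_add)
    qed simp
    also have "\<dots> = 0"
      by (rule alternating_sum_cancel) (rule contr_contr[OF t])
    finally show ?thesis .
  qed
  then have "lext (\<lambda>t. lext (\<lambda>t. alternating (contr t)) (alternating (contr t))) z = lext (\<lambda>_. 0) z"
    by (rule lext_cong)
  then show ?thesis
    by (simp add: boundary_def lext_lext)
qed

text \<open>Induction on the rank: up to sign a joined tree \<open>t\<close> is one term in the
  boundary of \<open>toggle t\<close>, and the other terms are cut or of lower rank.\<close>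

lemma reduce_to_cut:
  assumes "k < n" "keys (z :: btree \<Rightarrow>\<^sub>0 'k::field) \<subseteq> trees c n k"
  shows "\<exists>y. keys y \<subseteq> trees c n (Suc k) \<and> keys (z - boundary y) \<subseteq> {t. edge_status t = Cut}"
proof -
  let ?H = "{f :: btree \<Rightarrow>\<^sub>0 'k. keys f \<subseteq> {t. edge_status t = Cut}}"
  have H: "submodule ?H scalars (free_module {t. edge_status t = Cut})"
    using Module.module.carrier_is_submodule[OF module_free_module] by simp
  have reduce: "\<exists>y. keys y \<subseteq> trees c n (Suc k) \<and> single t 1 - boundary y \<in> ?H" if "t \<in> trees c n k" for t
    using that
  proof (induction "rank c t" arbitrary: t rule: less_induct)
    case less
    then have t: "valid c t" "bsize t = n" "blocks t = k" by (auto simp: trees_def)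
    show ?case
    proof (cases "edge_status t")
      case Critical
      \<comment> \<open>Critical trees have as many blocks as letters, so \<open>k < n\<close>
        excludes them.\<close>
      then show ?thesis using blocks_eq_bsize_if_Critical[of c t] t assms(1) by simp
    next
      case Cut
      then show ?thesis by (intro exI[of _ 0]) (simp add: boundary_def)
    next
      case Joined
      let ?u = "toggle t"
      have u: "valid c ?u" "edge_status ?u = Cut" "?u \<in> trees c n (Suc k)"
        using t Joined blocks_toggle[of c t] by (auto simp: valid_toggle edge_status_toggle trees_def)
      obtain xs ys where xy: "contr ?u = xs @ t # ys"
        "\<And>s. s \<in> set (xs @ ys) \<Longrightarrow> rank c s < rank c t \<or> edge_status s = Cut"
        using contr_toggle[OF u(1,2)] by auto
      \<comment> \<open>The sign with which \<open>t\<close> occurs in the boundary of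
        \<open>?u\<close>; it is its own inverse.\<close>
      define e where "e = (-1 :: 'k) ^ length xs"
      have e: "e * e = 1" by (simp add: e_def flip: power_add mult_2)
      let ?f = "single t 1 - scale e (boundary (single ?u 1))"
      have "?f = alternating ys - scale e (alternating xs)"
        by (simp add: boundary_def xy(1) alternating_append scale_add scale_diff e e_def[symmetric])
      also have "keys \<dots> \<subseteq> set (xs @ ys)"
        using keys_alternating[of xs] keys_alternating[of ys]
        by (intro keys_subset(2) keys_subset(3)) (auto intro: order_trans)
      finally have f: "keys ?f \<subseteq> set (xs @ ys)" .
      have "\<exists>y. keys y \<subseteq> trees c n (Suc k) \<and> single s 1 - boundary y \<in> ?H" if "s \<in> keys ?f" for s
      proof -
        have s: "s \<in> set (xs @ ys)" using subsetD[OF f that] .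
        then have "s \<in> trees c n k"
          using contr_props[OF u(1), of s] u(3) by (auto simp: trees_def xy(1))
        from xy(2)[OF s] show ?thesis
        proof
          assume "edge_status s = Cut"
          then show ?thesis by (intro exI[of _ 0]) (simp add: boundary_def)
        qed (rule less.hyps[OF _ \<open>s \<in> trees c n k\<close>])
      qed
      from lext_approximation[OF H this[unfolded boundary_def]] obtain y
        where y: "keys y \<subseteq> trees c n (Suc k)" "?f - boundary y \<in> ?H"
        unfolding boundary_def by blast
      have "single t 1 - boundary (y + scale e (single ?u 1)) = ?f - boundary y"
        by (simp add: boundary_def lext_add lext_scale)
      moreover have "keys (y + scale e (single ?u 1)) \<subseteq> trees c n (Suc k)"
        using y(1) u(3) by (intro keys_subset(1) keys_subset(3)) auto
      ultimately show ?thesis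
        using y(2) by (intro exI[of _ "y + scale e (single ?u 1)"]) (simp only: simp_thms)
    qed
  qed
  have "\<exists>y. keys y \<subseteq> trees c n (Suc k) \<and> z - boundary y \<in> ?H"
    unfolding boundary_def
  proof (rule lext_approximation[OF H])
    fix t assume "t \<in> keys z"
    from reduce[OF subsetD[OF assms(2) this]]
    show "\<exists>y. keys y \<subseteq> trees c n (Suc k) \<and> single t 1 - lext (\<lambda>t. alternating (contr t)) y \<in> ?H"
      unfolding boundary_def .
  qed
  then show ?thesis by simp
qed

text \<open>For a tree \<open>t\<close> of maximal rank in \<open>z\<close>, the joined tree
  \<open>toggle t\<close> occurs in the boundary of \<open>t\<close> with coefficient 1 or -1 and in
  the boundary of no other tree of \<open>z\<close>. So its coefficient in \<open>boundary z\<close>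
  is not 0.\<close>

lemma cut_cycle_eq_0:
  assumes z: "\<And>t. t \<in> keys z \<Longrightarrow> valid c t \<and> edge_status t = Cut"
    and "boundary z = (0 :: btree \<Rightarrow>\<^sub>0 'k::field)"
  shows "z = 0"
proof (rule ccontr)
  assume "z \<noteq> 0"
  then have "keys z \<noteq> {}" by simp
  then have "Max (rank c ` keys z) \<in> rank c ` keys z"
    by (intro Max_in) auto
  then obtain t where "t \<in> keys z" "rank c t = Max (rank c ` keys z)"
    by (metis imageE)
  then have t: "t \<in> keys z"
    "\<And>t'. t' \<in> keys z \<Longrightarrow> rank c t' \<le> rank c t"
    by auto
  have Joined: "edge_status (toggle t) = Joined" using z[OF t(1)] by (simp add: edge_status_toggle)
  \<comment> \<open>Otherwise \<open>toggle t\<close> would be \<open>toggle t'\<close>, or be cut,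
    or have rank below that of \<open>t'\<close>. But \<open>toggle\<close> is injective and keeps
    the rank, and \<open>t\<close> has maximal rank.\<close>
  have other: "lookup (alternating (contr t')) (toggle t) = (0 :: 'k)"
    if t': "t' \<in> keys z" "t' \<noteq> t" for t'
  proof -
    obtain xs ys where xy: "contr t' = xs @ toggle t' # ys"
      "\<And>s. s \<in> set (xs @ ys) \<Longrightarrow> rank c s < rank c t' \<or> edge_status s = Cut"
      using contr_toggle[of c t'] z[OF t'(1)] by blast
    moreover have "toggle t' \<noteq> toggle t" using t'(2) by (metis toggle_toggle)
    ultimately have "toggle t \<notin> set (contr t')"
      using Joined t(2)[OF t'(1)] by fastforce
    then show ?thesis by (rule lookup_alternating)
  qed
  obtain xs ys where xy: "contr t = xs @ toggle t # ys"
    "\<And>s. s \<in> set (xs @ ys) \<Longrightarrow> rank c s < rank c t \<or> edge_status s = Cut"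
    using contr_toggle[of c t] z[OF t(1)] by blast
  have "toggle t \<notin> set xs" "toggle t \<notin> set ys"
    using Joined xy(2)[of "toggle t"] by auto
  then have self: "lookup (alternating (contr t)) (toggle t) = (-1 :: 'k) ^ length xs"
    by (simp add: xy(1) alternating_append lookup_add lookup_minus lookup_alternating)
  have "0 = lookup (boundary z) (toggle t)"
    by (simp add: assms(2))
  also have "\<dots> = (\<Sum>t'\<in>{t}. lookup z t' * lookup (alternating (contr t')) (toggle t))"
    unfolding boundary_def lookup_lext using t(1) other by (intro sum.mono_neutral_right) auto
  also have "\<dots> = lookup z t * (-1) ^ length xs"
    by (simp add: self)
  finally show False
    using t(1) by (simp add: in_keys_iff)
qed

text \<open>A cycle differs by a boundary from a cycle supported on cut trees, and the latter is
  0.\<close>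

theorem boundary_acyclic:
  assumes "k < n" "keys (z :: btree \<Rightarrow>\<^sub>0 'k::field) \<subseteq> trees c n k" "boundary z = 0"
  shows "\<exists>y. keys y \<subseteq> trees c n (Suc k) \<and> z = boundary y"
proof -
  obtain y where y: "keys y \<subseteq> trees c n (Suc k)"
    "keys (z - boundary y) \<subseteq> {t. edge_status t = Cut}"
    using reduce_to_cut[OF assms(1,2)] by blast
  have "boundary (boundary y) = 0"
    using y(1) by (intro boundary_boundary[of _ c]) (auto simp: trees_def)
  then have cycle: "boundary (z - boundary y) = 0"
    using assms(3) by (simp add: boundary_def lext_diff)
  have keys: "keys (z - boundary y) \<subseteq> trees c n k"
    by (rule keys_subset(2)[OF assms(2) boundary_closed[OF y(1)]])
  have "z - boundary y = 0"
  proof (rule cut_cycle_eq_0[OF _ cycle])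
    fix t assume "t \<in> keys (z - boundary y)"
    then show "valid c t \<and> edge_status t = Cut"
      using subsetD[OF y(2)] subsetD[OF keys] by (simp add: trees_def)
  qed
  then have "z = boundary y" by simp
  with y(1) show ?thesis by (intro exI[of _ y] conjI)
qed


section \<open>Contractions and multilinearity\<close>

text \<open>The contractions of \<open>Node x (pre @ ts)\<close> at the edges lying over \<open>ts\<close>.\<close>

fun edge_contractions ::
  "('k::field, 'v) ns_operad \<Rightarrow> 'v \<Rightarrow> 'v ptree list \<Rightarrow> 'v ptree list \<Rightarrow> 'v ptree list" where
  "edge_contractions P x pre [] = []"
| "edge_contractions P x pre (s # ss) =
     (case s of Leaf \<Rightarrow> []
      | Node y us \<Rightarrow>
          [Node (pcomp P (length pre + Suc (length ss)) (length us) (Suc (length pre)) x y) (pre @ us @ ss)]) @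
     map (\<lambda>t. Node x (pre @ t # ss)) (contractions P s) @
     edge_contractions P x (pre @ [s]) ss"

text \<open>Recursion over positions becomes structural recursion over the children, with the
  children already passed as accumulator.\<close>

lemma contractions_Node: "contractions P (Node x ts) = edge_contractions P x [] ts"
proof -
  have "concat (map (\<lambda>i.
       (case (pre @ ss) ! i of
          Leaf \<Rightarrow> []
        | Node y us \<Rightarrow>
            [Node (pcomp P (length (pre @ ss)) (length us) (Suc i) x y)
               (take i (pre @ ss) @ us @ drop (Suc i) (pre @ ss))]) @
       map (\<lambda>t. Node x ((pre @ ss)[i := t])) (contractions P ((pre @ ss) ! i)))
     [length pre..<length (pre @ ss)]) = edge_contractions P x pre ss" for pre ss
  proof (induction ss arbitrary: pre)
    case (Cons s ss)
    have upt: "[length pre..<length (pre @ s # ss)] = length pre # [length (pre @ [s])..<length (pre @ s # ss)]"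
      by (subst upt_conv_Cons) simp_all
    note IH = Cons[of "pre @ [s]", unfolded append.assoc append_Cons append_Nil]
    show ?case
      unfolding upt list.map concat.simps IH by (cases s) simp_all
  qed simp
  from this[of "[]" ts, unfolded append_Nil] show ?thesis by simp
qed

declare contractions.simps(2) [simp del]

abbreviation typed :: "('k::field, 'v) ns_operad \<Rightarrow> 'v ptree \<Rightarrow> bool" where
  "typed P \<equiv> tree_over {(j, x). 2 \<le> j \<and> x \<in> elems P j}"

lemma bar_diff_eq: "bar_diff P = lext (\<lambda>t. alternating (contractions P t))"
  by (rule ext) (simp add: bar_diff_def lext_def alternating_eq_sum scale_sum mult.commute)

context nonsymmetric_operad
begin

abbreviation lincomb :: "nat \<Rightarrow> 'k \<Rightarrow> 'k \<Rightarrow> 'v \<Rightarrow> 'v \<Rightarrow> 'v" where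
  "lincomb n a b x y \<equiv> (a \<odot>\<^bsub>component P n\<^esub> x) \<oplus>\<^bsub>component P n\<^esub> (b \<odot>\<^bsub>component P n\<^esub> y)"

lemma edge_contractions_typed:
  assumes "t \<in> set (edge_contractions P x pre ss)" "typed P (Node x (pre @ ss))"
    and "\<And>s u. s \<in> set ss \<Longrightarrow> u \<in> set (contractions P s) \<Longrightarrow> typed P s \<Longrightarrow>
      typed P u \<and> leaves u = leaves s \<and> Suc (nodes u) = nodes s"
  shows "typed P t \<and> leaves t = leaves (Node x (pre @ ss)) \<and> Suc (nodes t) = nodes (Node x (pre @ ss))"
  using assms
proof (induction ss arbitrary: pre)
  case (Cons s ss)
  consider y us where "s = Node y us"
      "t = Node (pcomp P (length pre + Suc (length ss)) (length us) (Suc (length pre)) x y) (pre @ us @ ss)"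
    | u where "u \<in> set (contractions P s)" "t = Node x (pre @ u # ss)"
    | "t \<in> set (edge_contractions P x (pre @ [s]) ss)"
    using Cons.prems(1) by (auto split: ptree.splits)
  then show ?case
  proof cases
    case 1
    have "pcomp P (length pre + Suc (length ss)) (length us) (Suc (length pre)) x y
        \<in> elems P (length pre + Suc (length ss) + length us - 1)"
      using Cons.prems(2) 1 by (intro pcomp_closed) auto
    then show ?thesis using Cons.prems(2) 1 by (auto simp: ac_simps)
  next
    case 2
    then show ?thesis using Cons.prems(2) Cons.prems(3)[of s u] by auto
  next
    case 3
    have "typed P (Node x ((pre @ [s]) @ ss))"
      using Cons.prems(2) by simp
    moreover have "typed P u \<and> leaves u = leaves s' \<and> Suc (nodes u) = nodes s'"
      if "s' \<in> set ss" "u \<in> set (contractions P s')" "typed P s'" for s' u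
      using Cons.prems(3)[of s' u] that by simp
    ultimately show ?thesis
      using Cons.IH[OF 3] by simp
  qed
qed simp

lemma contractions_typed:
  "typed P t \<Longrightarrow> u \<in> set (contractions P t) \<Longrightarrow> typed P u \<and> leaves u = leaves t \<and> Suc (nodes u) = nodes t"
proof (induction t arbitrary: u)
  case (Node x ts)
  then show ?case
    using edge_contractions_typed[of u x "[]" ts] by (simp add: contractions_Node)
qed simp

lemma contractions_bar_trees:
  "t \<in> bar_trees P n k \<Longrightarrow> set (contractions P t) \<subseteq> bar_trees P n (k - 1)"
  using contractions_typed by (fastforce simp: bar_trees_def)

text \<open>Three trees related by \<open>linear_node\<close> have the same edges, and contracting
  corresponding ones gives related trees at equal list positions. So the signs match and
  \<open>bar_diff\<close> respects \<open>bar_null\<close>.\<close>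

inductive linear_list :: "'k \<Rightarrow> 'k \<Rightarrow> 'v ptree list \<Rightarrow> 'v ptree list \<Rightarrow> 'v ptree list \<Rightarrow> bool" for a b where
  Nil: "linear_list a b [] [] []"
| Cons: "linear_node P a b t t1 t2 \<Longrightarrow> linear_list a b ts ts1 ts2 \<Longrightarrow>
    linear_list a b (t # ts) (t1 # ts1) (t2 # ts2)"

lemma linear_list_append:
  "linear_list a b ts ts1 ts2 \<Longrightarrow> linear_list a b us us1 us2 \<Longrightarrow>
   linear_list a b (ts @ us) (ts1 @ us1) (ts2 @ us2)"
  by (induction rule: linear_list.induct) (auto intro: linear_list.intros)

lemma linear_list_map:
  "linear_list a b ts ts1 ts2 \<Longrightarrow>
   (\<And>t t1 t2. linear_node P a b t t1 t2 \<Longrightarrow> linear_node P a b (f t) (f t1) (f t2)) \<Longrightarrow>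
   linear_list a b (map f ts) (map f ts1) (map f ts2)"
  by (induction rule: linear_list.induct) (auto intro: linear_list.intros)

lemma linear_list_map_same:
  "(\<And>u. linear_node P a b (f u) (f1 u) (f2 u)) \<Longrightarrow> linear_list a b (map f us) (map f1 us) (map f2 us)"
  by (induction us) (auto intro: linear_list.intros)

lemma linear_list_single: "linear_node P a b t t1 t2 \<Longrightarrow> linear_list a b [t] [t1] [t2]"
  by (intro linear_list.intros)

lemma pcomp_lincomb:
  assumes "1 \<le> i" "i \<le> m"
  shows "x \<in> elems P m \<Longrightarrow> x' \<in> elems P m \<Longrightarrow> y \<in> elems P n \<Longrightarrow>
      pcomp P m n i (lincomb m a b x x') y =
      lincomb (m + n - 1) a b (pcomp P m n i x y) (pcomp P m n i x' y)"
    and "x \<in> elems P m \<Longrightarrow> y \<in> elems P n \<Longrightarrow> y' \<in> elems P n \<Longrightarrow>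
      pcomp P m n i x (lincomb n a b y y') =
      lincomb (m + n - 1) a b (pcomp P m n i x y) (pcomp P m n i x y')"
  using linear_onD(2,3)[OF pcomp_linear_left[OF assms]] linear_onD(2,3)[OF pcomp_linear_right[OF assms]]
    smult_scalars(1)[OF component_module]
  by simp_all

lemma linear_list_edge_contractions_root:
  assumes "x \<in> elems P (length (pre @ ss))" "y \<in> elems P (length (pre @ ss))" "\<forall>s\<in>set ss. typed P s"
  shows "linear_list a b
    (edge_contractions P (lincomb (length (pre @ ss)) a b x y) pre ss)
    (edge_contractions P x pre ss) (edge_contractions P y pre ss)"
  using assms
proof (induction ss arbitrary: pre)
  case Nil
  then show ?case by (simp add: linear_list.intros)
next
  case (Cons s ss)
  let ?N = "length (pre @ s # ss)"
  let ?z = "lincomb ?N a b x y"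
  have root: "linear_node P a b (Node ?z ts) (Node x ts) (Node y ts)" if "length ts = ?N" for ts
    using linear_node.root[of "component P ?N" P ts x y a b] that Cons.prems by simp
  have inside: "linear_list a b (map (\<lambda>t. Node ?z (pre @ t # ss)) (contractions P s))
      (map (\<lambda>t. Node x (pre @ t # ss)) (contractions P s)) (map (\<lambda>t. Node y (pre @ t # ss)) (contractions P s))"
    by (intro linear_list_map_same root) simp
  have rest: "linear_list a b (edge_contractions P ?z (pre @ [s]) ss)
      (edge_contractions P x (pre @ [s]) ss) (edge_contractions P y (pre @ [s]) ss)"
    using Cons.IH[of "pre @ [s]"] Cons.prems by simp
  show ?case
  proof (cases s)
    case Leaf
    then show ?thesis using linear_list_append[OF inside rest] by simp
  next
    case (Node w us)
    let ?M = "length pre + Suc (length ss)" and ?i = "Suc (length pre)"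
    have "w \<in> elems P (length us)" using Cons.prems Node by auto
    then have "linear_node P a b
       (Node (pcomp P ?M (length us) ?i ?z w) (pre @ us @ ss))
       (Node (pcomp P ?M (length us) ?i x w) (pre @ us @ ss))
       (Node (pcomp P ?M (length us) ?i y w) (pre @ us @ ss))"
      using linear_node.root[of "component P (length (pre @ us @ ss))" P "pre @ us @ ss"
          "pcomp P ?M (length us) ?i x w" "pcomp P ?M (length us) ?i y w" a b]
        pcomp_lincomb(1)[of ?i ?M x y w "length us" a b] Cons.prems
        pcomp_closed[of x ?M w "length us" ?i] pcomp_closed[of y ?M w "length us" ?i]
      by (simp add: ac_simps)
    from linear_list_append[OF linear_list_single[OF this] linear_list_append[OF inside rest]]
    show ?thesis by (simp add: Node)
  qed
qed

lemma linear_node_childI: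
  "linear_node P a b s s1 s2 \<Longrightarrow> ts = p @ s # q \<Longrightarrow> ts1 = p @ s1 # q \<Longrightarrow> ts2 = p @ s2 # q \<Longrightarrow>
   linear_node P a b (Node x ts) (Node x ts1) (Node x ts2)"
  by (simp add: linear_node.child)

lemma linear_list_edge_contractions_prefix:
  assumes "linear_node P a b s s1 s2"
  shows "linear_list a b (edge_contractions P x (p @ s # q) ss)
    (edge_contractions P x (p @ s1 # q) ss) (edge_contractions P x (p @ s2 # q) ss)"
proof (induction ss arbitrary: q)
  case Nil
  then show ?case by (simp add: linear_list.intros)
next
  case (Cons r ss)
  have "linear_list a b (map (\<lambda>t. Node x ((p @ s # q) @ t # ss)) (contractions P r))
      (map (\<lambda>t. Node x ((p @ s1 # q) @ t # ss)) (contractions P r))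
      (map (\<lambda>t. Node x ((p @ s2 # q) @ t # ss)) (contractions P r))"
    using assms by (intro linear_list_map_same) (rule linear_node_childI, auto)
  note rest = linear_list_append[OF this Cons.IH[of "q @ [r]"]]
  show ?case
  proof (cases r)
    case Leaf
    then show ?thesis using rest by simp
  next
    case (Node y us)
    have "linear_node P a b (Node u ((p @ s # q) @ us @ ss)) (Node u ((p @ s1 # q) @ us @ ss))
        (Node u ((p @ s2 # q) @ us @ ss))" for u
      using assms by (rule linear_node_childI) auto
    from linear_list_append[OF linear_list_single[OF this] rest] show ?thesis
      by (simp add: Node)
  qed
qed

lemma linear_node_NodeE:
  assumes "linear_node P a b s s1 s2"
  obtains (root) y1 y2 vs where "s1 = Node y1 vs" "s2 = Node y2 vs"
      "y1 \<in> elems P (length vs)" "y2 \<in> elems P (length vs)"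
      "s = Node (lincomb (length vs) a b y1 y2) vs"
    | (child) y p q r r1 r2 where "linear_node P a b r r1 r2"
      "s = Node y (p @ r # q)" "s1 = Node y (p @ r1 # q)" "s2 = Node y (p @ r2 # q)"
  using assms by (cases rule: linear_node.cases) auto

text \<open>Edges left or right of the altered child leave it intact. At the edge to
  \<open>s\<close> itself, the altered node is either the root of \<open>s\<close>, where
  composition is linear in its second argument, or it lies deeper and stays a descendant.\<close>

lemma linear_list_edge_contractions_child:
  assumes s: "linear_node P a b s s1 s2" "typed P s1"
    and IH: "linear_list a b (contractions P s) (contractions P s1) (contractions P s2)"
    and x: "x \<in> elems P (length (pre @ ts @ s # us))"
  shows "linear_list a b (edge_contractions P x pre (ts @ s # us))
    (edge_contractions P x pre (ts @ s1 # us)) (edge_contractions P x pre (ts @ s2 # us))"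
  using x
proof (induction ts arbitrary: pre)
  case Nil
  have child: "linear_node P a b (Node x (pre @ t # us)) (Node x (pre @ t1 # us)) (Node x (pre @ t2 # us))"
    if "linear_node P a b t t1 t2" for t t1 t2
    using that by (rule linear_node_childI) auto
  have rest: "linear_list a b
      (map (\<lambda>t. Node x (pre @ t # us)) (contractions P s) @ edge_contractions P x (pre @ [s]) us)
      (map (\<lambda>t. Node x (pre @ t # us)) (contractions P s1) @ edge_contractions P x (pre @ [s1]) us)
      (map (\<lambda>t. Node x (pre @ t # us)) (contractions P s2) @ edge_contractions P x (pre @ [s2]) us)"
    using linear_list_edge_contractions_prefix[OF s(1), of x pre "[]" us]
    by (intro linear_list_append linear_list_map[OF IH] child) auto
  let ?M = "length pre + Suc (length us)" and ?i = "Suc (length pre)"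
  from s(1) show ?case
  proof (cases rule: linear_node_NodeE)
    case (root y1 y2 vs)
    let ?y = "lincomb (length vs) a b y1 y2"
    have "linear_node P a b
       (Node (pcomp P ?M (length vs) ?i x ?y) (pre @ vs @ us))
       (Node (pcomp P ?M (length vs) ?i x y1) (pre @ vs @ us))
       (Node (pcomp P ?M (length vs) ?i x y2) (pre @ vs @ us))"
      using linear_node.root[of "component P (length (pre @ vs @ us))" P "pre @ vs @ us"
          "pcomp P ?M (length vs) ?i x y1" "pcomp P ?M (length vs) ?i x y2" a b]
        pcomp_lincomb(2)[of ?i ?M x y1 "length vs" y2 a b] Nil root(3,4)
        pcomp_closed[of x ?M y1 "length vs" ?i] pcomp_closed[of x ?M y2 "length vs" ?i]
      by (simp add: ac_simps)
    from linear_list_append[OF linear_list_single[OF this] rest] show ?thesis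
      by (simp add: root(1,2,5))
  next
    case (child y p q r r1 r2)
    have "linear_node P a b (Node u (pre @ (p @ r # q) @ us)) (Node u (pre @ (p @ r1 # q) @ us))
        (Node u (pre @ (p @ r2 # q) @ us))" for u
      using child(1) by (rule linear_node_childI[where p = "pre @ p" and q = "q @ us"]) auto
    from linear_list_append[OF linear_list_single[OF this] rest] show ?thesis
      by (simp add: child(2-4))
  qed
next
  case (Cons r ts)
  have "linear_list a b (map (\<lambda>t. Node x (pre @ t # ts @ s # us)) (contractions P r))
      (map (\<lambda>t. Node x (pre @ t # ts @ s1 # us)) (contractions P r))
      (map (\<lambda>t. Node x (pre @ t # ts @ s2 # us)) (contractions P r))"
  proof (rule linear_list_map_same)
    show "linear_node P a b (Node x (pre @ t # ts @ s # us)) (Node x (pre @ t # ts @ s1 # us))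
        (Node x (pre @ t # ts @ s2 # us))" for t
      using s(1) by (rule linear_node_childI[where p = "pre @ t # ts"]) auto
  qed
  note rest = linear_list_append[OF this Cons.IH[of "pre @ [r]"]]
  show ?case
  proof (cases r)
    case Leaf
    then show ?thesis using rest Cons.prems by simp
  next
    case (Node y vs)
    have "linear_node P a b (Node u (pre @ vs @ ts @ s # us)) (Node u (pre @ vs @ ts @ s1 # us))
        (Node u (pre @ vs @ ts @ s2 # us))" for u
      using s(1) by (rule linear_node_childI[where p = "pre @ vs @ ts"]) auto
    from linear_list_append[OF linear_list_single[OF this] rest] show ?thesis
      using Cons.prems by (simp add: Node)
  qed
qed

lemma linear_list_contractions:
  assumes "linear_node P a b t t1 t2" "typed P t1"
  shows "linear_list a b (contractions P t) (contractions P t1) (contractions P t2)"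
  using assms
proof (induction rule: linear_node.induct)
  case (root M ts x y)
  then show ?case
    using linear_list_edge_contractions_root[of x "[]" ts y] by (simp add: contractions_Node)
next
  case (child s s1 s2 x ts us)
  then show ?case
    using linear_list_edge_contractions_child[of a b s s1 s2 x "[]" ts us] by (simp add: contractions_Node)
qed

lemma linear_node_typed:
  assumes "linear_node P a b t t1 t2" "typed P t"
  shows "typed P t1 \<and> typed P t2 \<and> leaves t1 = leaves t \<and> leaves t2 = leaves t \<and> nodes t1 = nodes t \<and> nodes t2 = nodes t"
  using assms by (induction rule: linear_node.induct) auto

lemma bar_null_gen:
  assumes "linear_node P a b t t1 t2" "t \<in> bar_trees P n k"
  shows "single t 1 - single t1 a - single t2 b \<in> bar_null P n k"
  unfolding bar_null_def using assms linear_node_typed[OF assms(1)]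
  by - (rule subsetD[OF span_in_superset], rule CollectI, rule exI[of _ t], rule exI[of _ t1],
      rule exI[of _ t2], rule exI[of _ a], rule exI[of _ b], auto simp: bar_trees_def)

lemma submodule_bar_null: "submodule (bar_null P n k) scalars (free_module (bar_trees P n k))"
  unfolding bar_null_def
proof (rule submodule_span_in[OF module_free_module], clarify)
  fix t t1 t2 and a b :: 'k
  assume "t \<in> bar_trees P n k" "t1 \<in> bar_trees P n k" "t2 \<in> bar_trees P n k"
  then show "single t 1 - single t1 a - single t2 b
      \<in> carrier (free_module (bar_trees P n k))"
    by (simp add: keys_subset(2))
qed

lemma bar_null_minimal:
  assumes "submodule H scalars (free_module (bar_trees P n k))"
    and "\<And>a b t t1 t2. linear_node P a b t t1 t2 \<Longrightarrow> t \<in> bar_trees P n k \<Longrightarrow> t1 \<in> bar_trees P n k \<Longrightarrow>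
      t2 \<in> bar_trees P n k \<Longrightarrow>
      single t 1 - single t1 a - single t2 b \<in> H"
  shows "bar_null P n k \<subseteq> H"
  unfolding bar_null_def using assms by (intro span_in_minimal) auto

lemma alternating_linear_list:
  assumes "linear_list a b ts ts1 ts2" "set ts \<subseteq> bar_trees P n k"
  shows "alternating ts - scale a (alternating ts1) - scale b (alternating ts2) \<in> bar_null P n k"
  using assms
proof (induction rule: linear_list.induct)
  case Nil
  then show ?case using submodule_free_module_closed(1)[OF submodule_bar_null] by simp
next
  case (Cons t t1 t2 ts ts1 ts2)
  let ?g = "single t 1 - single t1 a - single t2 b"
  have "alternating (t # ts) - scale a (alternating (t1 # ts1)) - scale b (alternating (t2 # ts2)) =
      ?g - (alternating ts - scale a (alternating ts1) - scale b (alternating ts2))"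
    by (simp add: scale_diff)
  also have "\<dots> \<in> bar_null P n k"
    using Cons by (intro submodule_free_module_closed(5)[OF submodule_bar_null, of ?g] bar_null_gen) auto
  finally show ?case .
qed

text \<open>\<open>bar_null\<close> is the least subspace containing its generators, so it suffices
  to differentiate these.\<close>

lemma bar_diff_bar_null:
  assumes "z \<in> bar_null P n k"
  shows "bar_diff P z \<in> bar_null P n (k - 1)"
proof -
  note null = submodule_free_module_closed[OF submodule_bar_null]
  define H where "H = {z. keys z \<subseteq> bar_trees P n k \<and> bar_diff P z \<in> bar_null P n (k - 1)}"
  have "submodule H scalars (free_module (bar_trees P n k))"
    unfolding submodule_free_module_iff H_def
    by (simp add: bar_diff_eq lext_add lext_scale keys_subset null)
  moreover have "single t 1 - single t1 a - single t2 b \<in> H"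
    if "linear_node P a b t t1 t2" "t \<in> bar_trees P n k" "t1 \<in> bar_trees P n k" "t2 \<in> bar_trees P n k"
    for a b t t1 t2
    using that alternating_linear_list[OF linear_list_contractions[OF that(1)] contractions_bar_trees[OF that(2)]]
    by (simp add: H_def bar_diff_eq lext_diff keys_subset) (simp add: bar_trees_def)
  ultimately have "bar_null P n k \<subseteq> H"
    by (rule bar_null_minimal)
  then show ?thesis using assms by (auto simp: H_def)
qed

end


section \<open>The bar construction of the operad of hills\<close>

type_synonym 'k hill_tree = "(nat list \<Rightarrow>\<^sub>0 'k) set ptree"

definition hill_elem :: "nat \<Rightarrow> nat list \<Rightarrow> (nat list \<Rightarrow>\<^sub>0 'k::field) set" where
  "hill_elem c w = fibre c (arity w) (single w 1)"

fun chain_word :: "btree \<Rightarrow> nat list" where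
  "chain_word Tip = []"
| "chain_word (Br x j l r) = x # (if j then chain_word r else [])"

text \<open>\<open>kids\<close> lists the children of the planar node represented by the chain that
  starts at the root. Its value at \<open>Tip\<close> is a dummy: in a valid tree no joined edge
  leads there.\<close>

fun realize :: "nat \<Rightarrow> btree \<Rightarrow> 'k::field hill_tree"
  and kids :: "nat \<Rightarrow> btree \<Rightarrow> 'k hill_tree list" where
  "realize c Tip = Leaf"
| "realize c (Br x j l r) =
     Node (hill_elem c (x # (if j then chain_word r else [])))
       (realize c l # (if j then kids c r else [realize c r]))"
| "kids c Tip = []"
| "kids c (Br x j l r) = realize c l # (if j then kids c r else [realize c r])"

lemma realize_eq: "t \<noteq> Tip \<Longrightarrow> realize c t = Node (hill_elem c (chain_word t)) (kids c t)"
  by (cases t) auto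

lemma chain_word_eq_Nil_iff [simp]:
  "chain_word t = [] \<longleftrightarrow> t = Tip" "[] = chain_word t \<longleftrightarrow> t = Tip"
  by (cases t; simp)+

lemma length_kids: "valid c t \<Longrightarrow> t \<noteq> Tip \<Longrightarrow> length (kids d t :: 'k::field hill_tree list) = Suc (length (chain_word t))"
  by (induction t) auto

lemma hd_chain_word: "t \<noteq> Tip \<Longrightarrow> \<exists>w. chain_word t = top_label t # w"
  by (cases t) auto

lemma chain_word_hill: "valid c t \<Longrightarrow> chain_word t \<in> hills c"
proof (induction t)
  case (Br x j l r)
  show ?case
  proof (cases j)
    case True
    then obtain w where "chain_word r = top_label r # w"
      using Br.prems hd_chain_word[of r] by auto
    then show ?thesis
      using Br True by (auto simp: hills_def cliffs_def)
  qed (use Br in \<open>auto simp: hills_def cliffs_def\<close>)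
qed (simp add: hills_def cliffs_def)

lemma sorted_chain_word: "valid c t \<Longrightarrow> sorted (chain_word t)"
  using chain_word_hill by (auto simp: hills_def)

lemma chain_word_raise: "valid c t \<Longrightarrow> chain_word (raise m t) = rmax m (chain_word t)"
proof (induction t)
  case (Br x j l r)
  then show ?case
    using rmax_Cons_sorted[of x "chain_word r" m] sorted_chain_word[OF Br.prems] by (cases j) auto
qed simp

lemma kids_raise: "kids c (raise m t) = kids c t"
  by (induction t) auto

lemma kids_chain_app:
  "valid c l \<Longrightarrow> l \<noteq> Tip \<Longrightarrow>
   (kids d (chain_app l x j r) :: 'k::field hill_tree list) = kids d l @ (if j then kids d r else [realize d r])"
  by (induction l x j r rule: chain_app.induct) (auto simp: kids_raise)

text \<open>A left edge enters its node at the first input, so the hill of \<open>l\<close> is put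
  in front; the nested calls of \<open>raise\<close> compute the running maxima.\<close>

lemma chain_word_chain_app:
  "valid c l \<Longrightarrow> valid c (Br x j l' r) \<Longrightarrow>
   chain_word (chain_app l x j r) = hill_hull (chain_word l @ chain_word (Br x j l' r))"
proof (induction l x j r rule: chain_app.induct)
  case (1 x j r)
  then show ?case
    using hillsD(1)[OF chain_word_hill[OF 1(2)]] by simp
next
  case (2 y k a b x j r)
  let ?Z = "if k then chain_app b x j r else Br x j b r"
  have b: "valid c b" using 2 by simp
  have "valid c ?Z"
    using 2 valid_chain_app[OF b 2(3)] by auto
  then have "chain_word (chain_app (Br y k a b) x j r) = y # rmax y (chain_word ?Z)"
    by (simp add: chain_word_raise[of c])
  also have "\<dots> = hill_hull (chain_word (Br y k a b) @ chain_word (Br x j l' r))"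
    using 2 b by (cases k) auto
  finally show ?case .
qed

lemma leaves_realize:
  shows "valid c t \<Longrightarrow> leaves (realize d t :: 'k::field hill_tree) = Suc (bsize t)"
    and "valid c t \<Longrightarrow> t \<noteq> Tip \<Longrightarrow> sum_list (map leaves (kids d t :: 'k hill_tree list)) = Suc (bsize t)"
  by (induction t) auto

lemma nodes_realize:
  shows "valid c t \<Longrightarrow> nodes (realize d t :: 'k::field hill_tree) = blocks t"
    and "valid c t \<Longrightarrow> t \<noteq> Tip \<Longrightarrow> Suc (sum_list (map nodes (kids d t :: 'k hill_tree list))) = blocks t"
  by (induction t) auto

lemma hill_elem_closed: "w \<in> hills c \<Longrightarrow> hill_elem c w \<in> elems (Hi c) (arity w)"
  by (auto simp: hill_elem_def elems_Hi hill_basis_def intro!: imageI)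

lemma typed_realize_kids:
  "valid c t \<Longrightarrow> typed (Hi c) (realize c t :: 'k::field hill_tree) \<and>
    (\<forall>s\<in>set (kids c t :: 'k hill_tree list). typed (Hi c) s)"
proof (induction t)
  case (Br x j l r)
  have k: "\<forall>s\<in>set (kids c (Br x j l r) :: 'k hill_tree list). typed (Hi c) s"
    using Br by auto
  have "(realize c (Br x j l r) :: 'k hill_tree) =
      Node (hill_elem c (chain_word (Br x j l r))) (kids c (Br x j l r))"
    by (rule realize_eq) simp
  moreover have "2 \<le> length (kids c (Br x j l r) :: 'k hill_tree list)"
    using length_kids[OF Br.prems, where d = c and ?'k = 'k] by (cases j) auto
  moreover have "hill_elem c (chain_word (Br x j l r)) \<in>
      elems (Hi c) (length (kids c (Br x j l r) :: 'k hill_tree list))"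
    using hill_elem_closed[OF chain_word_hill[OF Br.prems]] length_kids[OF Br.prems, where d = c and ?'k = 'k]
    by (simp add: arity_def del: kids.simps chain_word.simps)
  ultimately show ?case
    using k by (simp del: realize.simps kids.simps chain_word.simps)
qed simp

lemmas typed_realize = conjunct1[OF typed_realize_kids]

lemma realize_bar_trees_iff:
  "valid c t \<Longrightarrow> realize c t \<in> bar_trees (Hi c) n k \<longleftrightarrow> Suc (bsize t) = n \<and> blocks t = k"
  using typed_realize by (auto simp: bar_trees_def leaves_realize nodes_realize)

section \<open>Realization as a chain map\<close>

lemma pcomp_hill_elem:
  assumes "u \<in> hills c" "v \<in> hills c" "arity u = m" "arity v = n" "1 \<le> i" "i \<le> m"
  shows "pcomp (Hi c) m n i (hill_elem c u) (hill_elem c v :: (_ \<Rightarrow>\<^sub>0 'k::field) set) = hill_elem c (hill_comp i u v)"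
proof -
  have "pcomp (Hi c) m n i (hill_elem c u) (hill_elem c v :: (_ \<Rightarrow>\<^sub>0 'k) set) =
      fibre c (m + n - 1) (pcomp (Hill c) m n i (single u 1) (single v 1))"
    unfolding hill_elem_def assms(3,4) using assms by (intro pcomp_Hi) (auto simp: hill_basis_def)
  also have "\<dots> = hill_elem c (hill_comp i u v)"
    using assms by (simp add: Hill_def hill_elem_def hill_comp_def)
  finally show ?thesis .
qed

text \<open>Kept apart because the induction along a chain needs it for the subtrees hanging off
  that chain. The hull is harmless, as chain words of valid trees are hills.\<close>

lemma contractions_realize_if:
  assumes t: "valid c t"
    and kids: "t \<noteq> Tip \<Longrightarrow> edge_contractions (Hi c) (hill_elem c (chain_word t)) [] (kids c t :: 'k::field hill_tree list) =
      map (\<lambda>t'. Node (hill_elem c (hill_hull (chain_word t'))) (kids c t')) (contr t)"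
  shows "contractions (Hi c) (realize c t :: 'k hill_tree) = map (realize c) (contr t)"
proof (cases "t = Tip")
  case False
  have "contractions (Hi c) (realize c t :: 'k hill_tree) =
      map (\<lambda>t'. Node (hill_elem c (hill_hull (chain_word t'))) (kids c t')) (contr t)"
    using kids[OF False] by (simp add: realize_eq[OF False] contractions_Node)
  also have "\<dots> = map (realize c) (contr t)"
    using contr_props[OF t] hillsD(1)[OF chain_word_hill, of c] by (intro map_cong) (simp_all add: realize_eq)
  finally show ?thesis .
qed simp

text \<open>\<open>pw\<close> and \<open>pk\<close> are the letters and children of the node that
  precede the chain of \<open>t\<close>, which lets the induction run along a chain. A contraction
  may bring a letter smaller than those of \<open>pw\<close> to the front, hence the hull of the
  whole word on the right.\<close>

lemma edge_contractions_kids: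
  assumes "valid c t" "t \<noteq> Tip" "pw @ chain_word t \<in> hills c" "length pk = length pw"
  shows "edge_contractions (Hi c) (hill_elem c (pw @ chain_word t)) pk (kids c t :: 'k::field hill_tree list) =
    map (\<lambda>t'. Node (hill_elem c (hill_hull (pw @ chain_word t'))) (pk @ kids c t')) (contr t)"
  using assms
proof (induction t arbitrary: pw pk)
  case (Br x j l r)
  have l: "valid c l" and r: "valid c r" using Br.prems(1) by auto
  have con_l: "contractions (Hi c) (realize c l :: 'k hill_tree) = map (realize c) (contr l)"
    using Br.IH(1)[OF l, of "[]" "[]"] chain_word_hill[OF l] by (intro contractions_realize_if[OF l]) simp
  have con_r: "contractions (Hi c) (realize c r :: 'k hill_tree) = map (realize c) (contr r)"
    using Br.IH(2)[OF r, of "[]" "[]"] chain_word_hill[OF r] by (intro contractions_realize_if[OF r]) simp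
  let ?t = "Br x j l r"
  let ?w = "pw @ chain_word ?t"
  let ?rest = "if j then kids c r else [realize c r] :: 'k hill_tree list"
  have len: "Suc (length pk) + length ?rest = arity ?w"
    using length_kids[OF Br.prems(1,2), where d = c and ?'k = 'k] Br.prems(4) by (auto simp: arity_def)
  have l_edge: "(case realize c l :: 'k hill_tree of Leaf \<Rightarrow> []
      | Node y us \<Rightarrow> [Node (pcomp (Hi c) (length pk + Suc (length ?rest)) (length us) (Suc (length pk))
          (hill_elem c ?w) y) (pk @ us @ ?rest)]) =
    map (\<lambda>t'. Node (hill_elem c (hill_hull (pw @ chain_word t'))) (pk @ kids c t'))
      (if l = Tip then [] else [chain_app l x j r])"
  proof (cases "l = Tip")
    case False
    \<comment> \<open>Input \<open>Suc (length pk)\<close> is the gap right before the letter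
      \<open>x\<close>.\<close>
    have "hill_comp (Suc (length pk)) ?w (chain_word l) = hill_hull (pw @ chain_word l @ chain_word ?t)"
      using Br.prems(4) by (simp add: hill_comp_def insert_word_def)
    also have "\<dots> = hill_hull (pw @ chain_word (chain_app l x j r))"
      using hull_append_hull[of 0 pw "chain_word l @ chain_word ?t" "[]"] chain_word_chain_app[OF l Br.prems(1)]
      by simp
    finally have "pcomp (Hi c) (length pk + Suc (length ?rest)) (length (kids c l :: 'k hill_tree list)) (Suc (length pk))
          (hill_elem c ?w) (hill_elem c (chain_word l) :: (_ \<Rightarrow>\<^sub>0 'k) set) = hill_elem c (hill_hull (pw @ chain_word (chain_app l x j r)))"
      using pcomp_hill_elem[OF Br.prems(3) chain_word_hill[OF l], of "arity ?w" "length (kids c l :: 'k hill_tree list)" "Suc (length pk)"]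
        len length_kids[OF l False, where d = c and ?'k = 'k] by (simp add: arity_def)
    then show ?thesis
      using False kids_chain_app[OF l False, where d = c and x = x and j = j and r = r and ?'k = 'k] by (simp add: realize_eq)
  qed (simp del: chain_word.simps)
  have l_inside: "map (\<lambda>t. Node (hill_elem c ?w) (pk @ t # ?rest)) (contractions (Hi c) (realize c l :: 'k hill_tree)) =
    map (\<lambda>t'. Node (hill_elem c (hill_hull (pw @ chain_word t'))) (pk @ kids c t'))
      (map (\<lambda>l'. Br x j l' r) (contr l))"
    using hillsD(1)[OF Br.prems(3)] by (simp add: con_l)
  have right: "edge_contractions (Hi c) (hill_elem c ?w) (pk @ [realize c l]) ?rest =
    map (\<lambda>t'. Node (hill_elem c (hill_hull (pw @ chain_word t'))) (pk @ kids c t'))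
      (if j then map (\<lambda>r'. Br x True l (raise x r')) (contr r)
       else (if r = Tip then [] else [Br x True l (raise x r)]) @ map (Br x False l) (contr r))"
  proof (cases j)
    case True
    \<comment> \<open>The running maximum is at least \<open>x\<close> after passing
      \<open>x\<close>, so raising by \<open>x\<close> beforehand is invisible.\<close>
    have raise_word: "hill_hull (pw @ x # rmax x w) = hill_hull (pw @ x # w)" for w
      by (simp add: rmax_append)
    have "edge_contractions (Hi c) (hill_elem c ((pw @ [x]) @ chain_word r)) (pk @ [realize c l]) (kids c r :: 'k hill_tree list) =
        map (\<lambda>t'. Node (hill_elem c (hill_hull ((pw @ [x]) @ chain_word t'))) ((pk @ [realize c l]) @ kids c t')) (contr r)"
      using Br.prems True by (intro Br.IH(2)[OF r]) auto
    also have "\<dots> = map (\<lambda>r'. Node (hill_elem c (hill_hull (pw @ chain_word (Br x True l (raise x r')))))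
        (pk @ kids c (Br x True l (raise x r')))) (contr r)"
    proof (rule map_cong[OF refl])
      fix r' assume "r' \<in> set (contr r)"
      then have "valid c r'" using contr_props[OF r] by blast
      then show "Node (hill_elem c (hill_hull ((pw @ [x]) @ chain_word r'))) ((pk @ [realize c l]) @ kids c r') =
          Node (hill_elem c (hill_hull (pw @ chain_word (Br x True l (raise x r')))))
            (pk @ kids c (Br x True l (raise x r')) :: 'k hill_tree list)"
        by (simp add: kids_raise chain_word_raise[of c] raise_word)
    qed
    finally show ?thesis
      using True by (simp add: comp_def)
  next
    case False
    have r_edge: "pcomp (Hi c) (Suc (Suc (length pk))) (length (kids c r :: 'k hill_tree list)) (Suc (Suc (length pk))) (hill_elem c ?w)
        (hill_elem c (chain_word r) :: (_ \<Rightarrow>\<^sub>0 'k) set) = hill_elem c (hill_hull (pw @ x # chain_word (raise x r)))" if "r \<noteq> Tip"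
    proof -
      \<comment> \<open>The last input lies behind the last letter \<open>x\<close>, so the hill of
        \<open>r\<close> is appended.\<close>
      have "hill_comp (Suc (Suc (length pk))) ?w (chain_word r) = hill_hull (pw @ x # chain_word (raise x r))"
        using Br.prems(4) False r by (simp add: hill_comp_def insert_word_def chain_word_raise[of c] rmax_append)
      then show ?thesis
        using pcomp_hill_elem[OF Br.prems(3) chain_word_hill[OF r], of "arity ?w" "length (kids c r :: 'k hill_tree list)" "Suc (Suc (length pk))"]
          len length_kids[OF r that, where d = c and ?'k = 'k] False by (simp add: arity_def)
    qed
    have "hill_hull ?w = ?w" by (rule hillsD(1)[OF Br.prems(3)])
    then have hull_w: "hill_hull (pw @ [x]) = pw @ [x]" using False by simp
    have r_case: "(case realize c r :: 'k hill_tree of Leaf \<Rightarrow> [] | Node y us \<Rightarrow> f y us) =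
        (if r = Tip then [] else f (hill_elem c (chain_word r)) (kids c r))" for f :: "_ \<Rightarrow> _ \<Rightarrow> 'k hill_tree list"
      by (cases "r = Tip") (simp_all add: realize_eq)
    show ?thesis
      using False r_edge by (simp add: r_case con_r kids_raise hull_w)
  qed
  show ?case
    unfolding kids.simps edge_contractions.simps l_edge l_inside right contr.simps(2) map_append by simp
qed simp

lemma contractions_realize:
  assumes t: "valid c t"
  shows "contractions (Hi c) (realize c t :: 'k::field hill_tree) = map (realize c) (contr t)"
  using edge_contractions_kids[OF t, of "[]" "[]"] chain_word_hill[OF t]
  by (intro contractions_realize_if[OF t]) simp

text \<open>The two lists of contractions agree including their order, so no signs have to be
  compared.\<close>

lemma bar_diff_push_realize:
  assumes "keys y \<subseteq> {t. valid c t}"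
  shows "bar_diff (Hi c) (push (realize c) y) = push (realize c) (boundary y)"
proof -
  have alt: "alternating (map f xs) = push f (alternating xs :: _ \<Rightarrow>\<^sub>0 'a)" for f :: "btree \<Rightarrow> (nat list \<Rightarrow>\<^sub>0 'a) set ptree" and xs
    by (induction xs) (simp_all add: push_diff)
  show ?thesis
    unfolding bar_diff_eq boundary_def push_def lext_lext
    using assms by (auto intro!: lext_cong simp: contractions_realize alt push_def[symmetric])
qed


text \<open>
  The coefficient of a realized tree in the multilinear expansion of a tree with arbitrary labels.
\<close>

fun tree_coeff :: "nat \<Rightarrow> btree \<Rightarrow> 'k::field hill_tree \<Rightarrow> 'k"
  and kids_coeff :: "nat \<Rightarrow> btree \<Rightarrow> 'k hill_tree list \<Rightarrow> 'k" where
  "tree_coeff c Tip T = (if T = Leaf then 1 else 0)"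
| "tree_coeff c (Br x j l r) T =
     (case T of Leaf \<Rightarrow> 0
      | Node A Ts \<Rightarrow> lookup (Hi_coords c (length Ts) A) (chain_word (Br x j l r)) *
          (case Ts of [] \<Rightarrow> 0 | S # Ss \<Rightarrow> tree_coeff c l S *
             (if j then kids_coeff c r Ss else (case Ss of [S'] \<Rightarrow> tree_coeff c r S' | _ \<Rightarrow> 0))))"
| "kids_coeff c Tip Ts = 0"
| "kids_coeff c (Br x j l r) Ts =
     (case Ts of [] \<Rightarrow> 0 | S # Ss \<Rightarrow> tree_coeff c l S *
        (if j then kids_coeff c r Ss else (case Ss of [S'] \<Rightarrow> tree_coeff c r S' | _ \<Rightarrow> 0)))"

lemma tree_coeff_Node:
  "t \<noteq> Tip \<Longrightarrow> tree_coeff c t (Node A Ts) =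
    lookup (Hi_coords c (length Ts) A) (chain_word t) * kids_coeff c t Ts"
  by (cases t) auto

lemma kids_coeff_child:
  assumes "\<And>t. tree_coeff c t s = a * tree_coeff c t s1 + b * tree_coeff c t s2"
  shows "kids_coeff c t (ts @ s # us) =
    a * kids_coeff c t (ts @ s1 # us) + b * kids_coeff c t (ts @ s2 # us)"
proof (induction t arbitrary: ts)
  case (Br x j l r)
  show ?case
  proof (cases ts)
    case Nil
    then show ?thesis
      using assms by (auto simp: algebra_simps split: list.splits)
  next
    case (Cons q qs)
    show ?thesis
    proof (cases j)
      case True
      then show ?thesis using Cons Br.IH(2)[of qs] by (simp add: algebra_simps)
    next
      case False
      then show ?thesis
        using Cons assms by (cases qs; cases us) (auto simp: algebra_simps split: list.splits)
    qed
  qed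
qed simp

text \<open>Each label enters exactly one factor of the product, through its coordinates, which are
  linear.\<close>

lemma tree_coeff_linear:
  assumes "linear_node (Hi c) a b T T1 T2"
  shows "tree_coeff c t T = a * tree_coeff c t T1 + b * tree_coeff c t (T2 :: 'k::field hill_tree)"
  using assms
proof (induction arbitrary: t rule: linear_node.induct)
  case (root M ts x y)
  interpret Hi: nonsymmetric_operad "Hi c :: ('k, _) ns_operad" by (rule nonsymmetric_operad_Hi)
  have "operad_hom (Hi c :: ('k, _) ns_operad) (Hill c) (Hi_coords c)"
    by (rule operad_hom_Hi_coords)
  then have lin: "linear_on (component (Hi c) n) (component (Hill c :: ('k, _) ns_operad) n) (Hi_coords c n)" for n
    by (simp add: operad_hom_def)
  have "Hi_coords c (length ts) ((a \<odot>\<^bsub>M\<^esub> x) \<oplus>\<^bsub>M\<^esub> (b \<odot>\<^bsub>M\<^esub> y)) =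
      scale a (Hi_coords c (length ts) x) + scale b (Hi_coords c (length ts) y)"
    using root linear_onD(2,3)[OF lin] smult_scalars(1)[OF Hi.component_module] by simp
  then show ?case
    by (cases "t = Tip") (simp_all add: tree_coeff_Node lookup_add algebra_simps)
next
  case (child s s1 s2 x ts us)
  then show ?case
    using kids_coeff_child[of c s a s1 b s2 t ts us]
    by (cases "t = Tip") (simp_all add: tree_coeff_Node algebra_simps)
qed

lemma coords_hill_elem:
  "w \<in> hills c \<Longrightarrow> lookup (Hi_coords c (arity w) (hill_elem c w :: (_ \<Rightarrow>\<^sub>0 'k::field) set)) w' =
    (if w = w' then 1 else 0)"
  unfolding hill_elem_def by (subst Hi_coords_fibre) (auto simp: hill_basis_def lookup_single)

text \<open>Realized trees and these coefficients are dual to each other, which gives independence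
  modulo \<open>bar_null\<close>. The conjunct about children presupposes equal chain words because
  \<open>kids_coeff\<close> does not look at the letters of the chain.\<close>

lemma tree_coeff_realize:
  assumes "valid c t" "valid c t'"
  shows "tree_coeff c t (realize c t' :: 'k::field hill_tree) = (if t = t' then 1 else 0) \<and>
    (chain_word t = chain_word t' \<longrightarrow> t \<noteq> Tip \<longrightarrow>
      kids_coeff c t (kids c t' :: 'k hill_tree list) = (if t = t' then 1 else 0))"
  using assms
proof (induction t arbitrary: t')
  case Tip
  then show ?case by (cases t') auto
next
  case (Br x j l r)
  let ?t = "Br x j l r"
  have kids: "kids_coeff c ?t (kids c t' :: 'k hill_tree list) = (if ?t = t' then 1 else 0)"
    if cw: "chain_word ?t = chain_word t'"
  proof -
    obtain j' l' r' where t': "t' = Br x j' l' r'"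
      using cw by (cases t') auto
    have "chain_word r \<noteq> []" if j using Br.prems that by simp
    moreover have "chain_word r' \<noteq> []" if j' using Br.prems that t' by simp
    \<comment> \<open>The chains have equal length, and a joined edge always leads to a further
      letter, so both end at the same place.\<close>
    ultimately have "j' = j" "j \<Longrightarrow> chain_word r = chain_word r'"
      using cw t' by (auto split: if_splits)
    then show ?thesis
      using t' Br.IH(1)[of l'] Br.IH(2)[of r'] Br.prems by auto
  qed
  have "tree_coeff c ?t (realize c t' :: 'k hill_tree) = (if ?t = t' then 1 else 0)"
  proof (cases "t' = Tip")
    case False
    have len: "length (kids c t' :: 'k hill_tree list) = arity (chain_word t')"
      using length_kids[OF Br.prems(2) False] by (simp add: arity_def)
    have "?t \<noteq> Tip" by simp
    note Node = tree_coeff_Node[OF this]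
    have "tree_coeff c ?t (realize c t' :: 'k hill_tree) =
        (if chain_word t' = chain_word ?t then 1 else 0) * kids_coeff c ?t (kids c t' :: 'k hill_tree list)"
      unfolding realize_eq[OF False] Node len coords_hill_elem[OF chain_word_hill[OF Br.prems(2)]] ..
    then show ?thesis using kids by auto
  qed simp
  with kids show ?case by blast
qed

text \<open>The one-dimensional target \<open>unit \<Rightarrow>\<^sub>0 'k\<close> makes this
  linear functional an instance of \<open>lext\<close>.\<close>

definition coeff_map :: "nat \<Rightarrow> btree \<Rightarrow> ('k::field hill_tree \<Rightarrow>\<^sub>0 'k) \<Rightarrow> unit \<Rightarrow>\<^sub>0 'k" where
  "coeff_map c t = lext (\<lambda>T. single () (tree_coeff c t T))"

lemma coeff_map_bar_null:
  assumes "z \<in> bar_null (Hi c) n k"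
  shows "coeff_map c t z = (0 :: _ \<Rightarrow>\<^sub>0 'k::field)"
proof -
  interpret Hi: nonsymmetric_operad "Hi c :: ('k, _) ns_operad" by (rule nonsymmetric_operad_Hi)
  define H :: "('k hill_tree \<Rightarrow>\<^sub>0 'k) set" where
    "H = {z. keys z \<subseteq> bar_trees (Hi c) n k \<and> coeff_map c t z = 0}"
  have "submodule H scalars (free_module (bar_trees (Hi c) n k))"
    unfolding submodule_free_module_iff H_def
    by (simp add: coeff_map_def lext_add lext_scale keys_subset)
  moreover have "single T 1 - single T1 a - single T2 b \<in> H"
    if "linear_node (Hi c) a b T T1 T2" "T \<in> bar_trees (Hi c) n k" "T1 \<in> bar_trees (Hi c) n k" "T2 \<in> bar_trees (Hi c) n k"
    for a b T T1 T2
    using that tree_coeff_linear[OF that(1), of t]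
    by (simp add: H_def coeff_map_def lext_diff keys_subset single_diff[symmetric])
  ultimately have "bar_null (Hi c) n k \<subseteq> H"
    by (rule Hi.bar_null_minimal)
  then show ?thesis using assms by (auto simp: H_def)
qed

lemma coeff_map_push_realize:
  assumes "keys w \<subseteq> {t. valid c t}" "valid c t"
  shows "coeff_map c t (push (realize c) w) = single () (lookup w t :: 'k::field)"
proof -
  have "coeff_map c t (push (realize c) w) = lext (\<lambda>t'. single () (if t = t' then 1 else 0)) w"
    unfolding coeff_map_def push_def lext_lext
    using assms tree_coeff_realize[of c t, where ?'k = 'k] by (intro lext_cong) auto
  also have "\<dots> = single () (lookup w t)"
  proof (rule poly_mapping_eqI)
    fix u
    have "(\<Sum>t'\<in>keys w. lookup w t' *
          lookup (single () (if t = t' then 1 else 0 :: 'k)) u) =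
        (\<Sum>t'\<in>keys w. if t = t' then lookup w t' else 0)"
      by (rule sum.cong) auto
    then show "lookup (lext (\<lambda>t'. single () (if t = t' then 1 else 0)) w) u =
        lookup (single () (lookup w t)) u"
      by (simp add: lookup_lext in_keys_iff)
  qed
  finally show ?thesis .
qed

text \<open>Multilinear expansion one label at a time, which avoids writing down a sum over
  simultaneous choices at all nodes.\<close>

inductive expandable :: "nat \<Rightarrow> 'k::field hill_tree \<Rightarrow> bool" for c where
  realize: "valid c t \<Longrightarrow> expandable c (realize c t)"
| linear: "linear_node (Hi c) a b T T1 T2 \<Longrightarrow> expandable c T1 \<Longrightarrow> expandable c T2 \<Longrightarrow> expandable c T"

text \<open>The hill dictates the joins: the right edges along \<open>w\<close> are joined except
  the last, the children are the left subtrees, and the final child is the last right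
  subtree.\<close>

lemma realize_Node:
  assumes "w \<in> hills c" "w \<noteq> []" "length ts = length w + 1" "\<forall>t\<in>set ts. valid c t"
  shows "\<exists>t. valid c t \<and> t \<noteq> Tip \<and> chain_word t = w \<and> (kids c t :: 'k::field hill_tree list) = map (realize c) ts"
  using assms
proof (induction w arbitrary: ts)
  case (Cons x w)
  obtain l ts' where ts: "ts = l # ts'" "length ts' = length w + 1"
    using Cons.prems(3) by (cases ts) auto
  show ?case
  proof (cases "w = []")
    case True
    then obtain r where "ts' = [r]" using ts(2) by (auto simp: length_Suc_conv)
    then show ?thesis
      using Cons.prems True ts by (intro exI[of _ "Br x False l r"]) (auto simp: hills_def cliffs_def)
  next
    case False
    obtain t where t: "valid c t" "t \<noteq> Tip" "chain_word t = w" "(kids c t :: 'k hill_tree list) = map (realize c) ts'"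
      using Cons.IH[of ts'] Cons.prems ts False by (auto simp: hills_def cliffs_def)
    moreover have "x \<le> top_label t"
      using hd_chain_word[OF t(2)] t(3) Cons.prems(1) by (auto simp: hills_def)
    ultimately show ?thesis
      using Cons.prems ts by (intro exI[of _ "Br x True l t"]) (auto simp: hills_def cliffs_def)
  qed
qed simp

text \<open>The labels for which the claim holds form a subspace in coordinates, and it contains
  every basis hill.\<close>

lemma expandable_root:
  fixes A :: "(nat list \<Rightarrow>\<^sub>0 'k::field) set"
  assumes A: "A \<in> elems (Hi c) (length ts)" and ts: "2 \<le> length ts" "\<forall>t\<in>set ts. valid c t"
  shows "expandable c (Node A (map (realize c) ts))"
proof -
  let ?n = "length ts" and ?Ts = "map (realize c) ts :: 'k hill_tree list"
  have lin: "linear_on (component (Hill c :: ('k, _) ns_operad) n) (component (Hi c) n) (fibre c n)" for n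
    by (rule linear_on_fibre)
  have comb: "expandable c (Node (fibre c ?n (scale a f + scale b g)) ?Ts)"
    if "keys f \<subseteq> hill_basis c ?n" "keys g \<subseteq> hill_basis c ?n"
      "expandable c (Node (fibre c ?n f) ?Ts)" "expandable c (Node (fibre c ?n g) ?Ts)" for a b and f g :: "nat list \<Rightarrow>\<^sub>0 'k"
  proof (rule expandable.linear[OF _ that(3,4)])
    have "fibre c ?n (scale a f + scale b g) =
        (a \<odot>\<^bsub>component (Hi c) ?n\<^esub> fibre c ?n f) \<oplus>\<^bsub>component (Hi c) ?n\<^esub> (b \<odot>\<^bsub>component (Hi c) ?n\<^esub> fibre c ?n g)"
      using linear_onD(2)[OF lin, of "scale a f" ?n "scale b g"] linear_onD(3)[OF lin, of f ?n a]
        linear_onD(3)[OF lin, of g ?n b] that by (simp add: keys_subset(3))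
    then show "linear_node (Hi c) a b (Node (fibre c ?n (scale a f + scale b g)) ?Ts)
        (Node (fibre c ?n f) ?Ts) (Node (fibre c ?n g) ?Ts)"
      using linear_node.root[of "component (Hi c) ?n" "Hi c" ?Ts "fibre c ?n f" "fibre c ?n g" a b] that
        linear_onD(1)[OF lin, of f ?n] linear_onD(1)[OF lin, of g ?n] by simp
  qed
  define H where "H = {g :: nat list \<Rightarrow>\<^sub>0 'k. keys g \<subseteq> hill_basis c ?n \<and> expandable c (Node (fibre c ?n g) ?Ts)}"
  have basis: "single w 1 \<in> H" if "w \<in> hill_basis c ?n" for w
  proof -
    have w: "w \<in> hills c" "arity w = ?n" using that by (auto simp: hill_basis_def)
    then obtain t where "valid c t" "t \<noteq> Tip" "chain_word t = w" "(kids c t :: 'k hill_tree list) = ?Ts"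
      using realize_Node[of w c ts, where ?'k = 'k] ts by (cases "w = []") (auto simp: arity_def)
    then have "realize c t = Node (fibre c ?n (single w 1)) ?Ts"
      using w by (simp add: realize_eq hill_elem_def)
    then show ?thesis
      using expandable.realize[OF \<open>valid c t\<close>, where ?'k = 'k] that by (simp add: H_def)
  qed
  \<comment> \<open>Some basis hill is needed to see that the label 0 is expandable, as 0 times that
    hill twice; the constant word 0 exists for every \<open>c\<close>.\<close>
  have zeros: "replicate (?n - 1) 0 \<in> hill_basis c ?n"
    using ts(1) by (auto simp: hill_basis_def hills_def cliffs_def arity_def)
  have "submodule H scalars (free_module (hill_basis c ?n))"
    unfolding submodule_free_module_iff
  proof (intro conjI ballI allI)
    show "0 \<in> H"
      using comb[of "single (replicate (?n - 1) 0) 1" "single (replicate (?n - 1) 0) 1" 0 0]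
        basis[OF zeros] by (simp add: H_def)
    show "f + g \<in> H" if "f \<in> H" "g \<in> H" for f g
      using comb[of f g 1 1] that by (simp add: H_def keys_subset(1))
    show "scale a f \<in> H" if "f \<in> H" for a f
      using comb[of f f a 0] that by (simp add: H_def keys_subset(3))
  qed (simp add: H_def)
  note H = submodule_free_module_closed(7)[OF this]
  obtain g where g: "A = fibre c ?n g" "keys g \<subseteq> hill_basis c ?n"
    using A by (auto simp: elems_Hi)
  have "lext (\<lambda>w. single w 1) g \<in> H"
    using g(2) basis by (intro H) auto
  then show ?thesis
    by (simp add: single_expansion[symmetric] H_def g(1))
qed

text \<open>Children are made realized from left to right: an inner induction on the expansion of
  the next child moves it into the prefix \<open>pre\<close>.\<close>

lemma expandable_Node:
  fixes A :: "(nat list \<Rightarrow>\<^sub>0 'k::field) set"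
  assumes "A \<in> elems (Hi c) (length (map (realize c) pre @ Ts))" "2 \<le> length (map (realize c) pre @ Ts)"
    and "\<forall>t\<in>set pre. valid c t" "\<forall>T\<in>set Ts. expandable c T"
  shows "expandable c (Node A (map (realize c) pre @ Ts))"
  using assms
proof (induction Ts arbitrary: pre)
  case Nil
  then show ?case using expandable_root[of A c pre] by simp
next
  case (Cons S Ss)
  have "expandable c S" using Cons.prems by simp
  then show ?case
  proof (induction rule: expandable.induct)
    case (realize t)
    then show ?case using Cons.IH[of "pre @ [t]"] Cons.prems by simp
  next
    case (linear a b T T1 T2)
    show ?case
      by (rule expandable.linear[OF linear_node.child[OF linear(1)] linear(4,5)])
  qed
qed

lemma expandable_typed:
  "typed (Hi c) (T :: 'k::field hill_tree) \<Longrightarrow> expandable c T"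
proof (induction T)
  case Leaf
  then show ?case using expandable.realize[of c Tip] by simp
next
  case (Node A Ts)
  then show ?case using expandable_Node[of A c "[]" Ts] by simp
qed

text \<open>The arity is \<open>Suc n\<close> because a binary tree with \<open>n\<close> letters
  has one more leaf than letters.\<close>

lemma expand_tree:
  assumes "expandable c (T :: 'k::field hill_tree)" "T \<in> bar_trees (Hi c) (Suc n) k"
  shows "\<exists>w. keys w \<subseteq> trees c n k \<and>
    single T 1 - push (realize c) w \<in> bar_null (Hi c) (Suc n) k"
  using assms
proof (induction rule: expandable.induct)
  interpret Hi: nonsymmetric_operad "Hi c :: ('k, _) ns_operad" by (rule nonsymmetric_operad_Hi)
  note null = submodule_free_module_closed[OF Hi.submodule_bar_null]
  {
    case (realize t)
    then show ?case
      using realize_bar_trees_iff[OF realize(1), where ?'a = 'k] null(1)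
      by (intro exI[of _ "single t 1"]) (simp add: trees_def)
  next
    case (linear a b T T1 T2)
    have "T1 \<in> bar_trees (Hi c) (Suc n) k" "T2 \<in> bar_trees (Hi c) (Suc n) k"
      using Hi.linear_node_typed[OF linear(1)] linear.prems by (auto simp: bar_trees_def)
    with linear obtain w1 w2 where w: "keys w1 \<subseteq> trees c n k" "keys w2 \<subseteq> trees c n k"
      "single T1 1 - push (realize c) w1 \<in> bar_null (Hi c) (Suc n) k"
      "single T2 1 - push (realize c) w2 \<in> bar_null (Hi c) (Suc n) k"
      by blast
    let ?w = "scale a w1 + scale b w2"
    have "single T 1 - push (realize c) ?w =
        (single T 1 - single T1 a - single T2 b) +
        (scale a (single T1 1 - push (realize c) w1) +
         scale b (single T2 1 - push (realize c) w2))"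
      by (simp add: push_add push_scale scale_diff)
    also have "\<dots> \<in> bar_null (Hi c) (Suc n) k"
      by (rule null(2)[OF Hi.bar_null_gen[OF linear(1) linear.prems] null(2)[OF null(3)[OF w(3)] null(3)[OF w(4)]]])
    finally have "single T 1 - push (realize c) ?w \<in> bar_null (Hi c) (Suc n) k" .
    moreover have "keys ?w \<subseteq> trees c n k"
      using w by (simp add: keys_subset)
    ultimately show ?case by (intro exI[of _ ?w] conjI)
  }
qed

lemma expand_bar:
  fixes z :: "'k::field hill_tree \<Rightarrow>\<^sub>0 'k"
  assumes "keys z \<subseteq> bar_trees (Hi c) (Suc n) k"
  shows "\<exists>w. keys w \<subseteq> trees c n k \<and> z - push (realize c) w \<in> bar_null (Hi c) (Suc n) k"
proof -
  interpret Hi: nonsymmetric_operad "Hi c :: ('k, _) ns_operad" by (rule nonsymmetric_operad_Hi)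
  have "\<exists>w. keys w \<subseteq> trees c n k \<and> single T (1::'k) - push (realize c) w \<in> bar_null (Hi c) (Suc n) k"
    if "T \<in> keys z" for T
  proof -
    have T: "T \<in> bar_trees (Hi c) (Suc n) k" using assms that by blast
    then have "expandable c T" by (intro expandable_typed) (simp add: bar_trees_def)
    from expand_tree[OF this T] show ?thesis .
  qed
  then show ?thesis
    unfolding push_def by (rule lext_approximation[OF Hi.submodule_bar_null])
qed

lemma blocks_le_bsize: "valid c t \<Longrightarrow> blocks t \<le> bsize t"
  by (induction t) auto

lemma leaves_pos: "typed P t \<Longrightarrow> 0 < leaves t"
proof (induction t)
  case (Node x ts)
  then obtain s ss where "ts = s # ss" by (cases ts) auto
  then show ?case using Node by auto
qed simp

text \<open>Spanning replaces \<open>z\<close> by a realized chain, independence turns its cycle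
  condition modulo \<open>bar_null\<close> into \<open>boundary w = 0\<close>, and the preimage
  found among binary trees is realized again.\<close>

lemma bar_acyclic_Hi:
  assumes "Suc k \<noteq> n"
  shows "bar_acyclic_at (Hi c :: ('k::field, _) ns_operad) n k"
  unfolding bar_acyclic_at_def
proof (intro ballI impI)
  interpret Hi: nonsymmetric_operad "Hi c :: ('k, _) ns_operad" by (rule nonsymmetric_operad_Hi)
  fix z :: "'k hill_tree \<Rightarrow>\<^sub>0 'k"
  assume z: "z \<in> carrier (free_module (bar_trees (Hi c) n k))" and dz: "bar_diff (Hi c) z \<in> bar_null (Hi c) n (k - 1)"
  show "\<exists>y\<in>carrier (free_module (bar_trees (Hi c) n (Suc k))). z - bar_diff (Hi c) y \<in> bar_null (Hi c) n k"
  proof (cases n)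
    case 0
    then have "bar_trees (Hi c :: ('k, _) ns_operad) n k = {}"
      using leaves_pos by (force simp: bar_trees_def)
    then have "z = 0" using z by simp
    then show ?thesis
      using submodule_free_module_closed(1)[OF Hi.submodule_bar_null]
      by (intro bexI[of _ 0]) (simp_all add: bar_diff_eq)
  next
    case (Suc m)
    obtain w where w: "keys w \<subseteq> trees c m k" "z - push (realize c) w \<in> bar_null (Hi c) n k"
      using expand_bar[of z c m k] z Suc by auto
    have valid: "trees c m k' \<subseteq> {t. valid c t}" for k' by (auto simp: trees_def)
    have "\<exists>y. keys y \<subseteq> trees c m (Suc k) \<and> w = boundary y"
    \<comment> \<open>Here \<open>m\<close> is the arity minus 1, so \<open>k = m\<close> is the
      excluded diagonal; for larger \<open>k\<close> there are no trees, as blocks never outnumber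
      letters.\<close>
    proof (cases "k < m")
      case True
      have cycle: "push (realize c) (boundary w) \<in> bar_null (Hi c) n (k - 1)"
      proof -
        have "bar_diff (Hi c) (push (realize c) w) = bar_diff (Hi c) z - bar_diff (Hi c) (z - push (realize c) w)"
          by (simp add: bar_diff_eq lext_diff)
        also have "\<dots> \<in> bar_null (Hi c) n (k - 1)"
          by (rule submodule_free_module_closed(5)[OF Hi.submodule_bar_null dz Hi.bar_diff_bar_null[OF w(2)]])
        finally show ?thesis
          using bar_diff_push_realize[OF order_trans[OF w(1) valid]] by simp
      qed
      \<comment> \<open>\<open>boundary_closed\<close> asks for a positive degree, while
        \<open>k\<close> may be 0; validity is all that the coefficients require.\<close>
      have keys_bw: "keys (boundary w) \<subseteq> {t. valid c t}"
        unfolding boundary_def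
      proof (rule lext_closed, rule order_trans[OF keys_alternating], rule subsetI, rule CollectI)
        fix t s assume "t \<in> keys w" "s \<in> set (contr t)"
        then show "valid c s" using contr_props[of c t s] subsetD[OF w(1)] by (simp add: trees_def)
      qed
      have "boundary w = 0"
      proof (rule poly_mapping_eqI)
        fix t
        show "lookup (boundary w) t = lookup 0 t"
        proof (cases "valid c t")
          case True
          then have "single () (lookup (boundary w) t) = 0"
            using coeff_map_bar_null[OF cycle, of t] coeff_map_push_realize[OF keys_bw True] by simp
          then have "lookup (single () (lookup (boundary w) t)) () = 0"
            by (simp only: lookup_zero)
          then show ?thesis by simp
        next
          case False
          then show ?thesis using subsetD[OF keys_bw, of t] by (auto simp: in_keys_iff)
        qed
      qed
      then show ?thesis by (rule boundary_acyclic[OF True w(1)])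
    next
      case False
      then have "m < k" using assms Suc by simp
      then have "trees c m k = {}" using blocks_le_bsize by (fastforce simp: trees_def)
      then have "w = 0" using w(1) by simp
      then show ?thesis by (intro exI[of _ 0]) (simp add: boundary_def)
    qed
    then obtain y where y: "keys y \<subseteq> trees c m (Suc k)" "w = boundary y" by blast
    have "realize c t \<in> bar_trees (Hi c :: ('k, _) ns_operad) n (Suc k)" if "t \<in> trees c m (Suc k)" for t
      using that realize_bar_trees_iff[of c t n "Suc k"] Suc by (auto simp: trees_def)
    then have "realize c ` keys y \<subseteq> bar_trees (Hi c :: ('k, _) ns_operad) n (Suc k)"
      using y(1) by blast
    then have "keys (push (realize c) y) \<subseteq> bar_trees (Hi c :: ('k, _) ns_operad) n (Suc k)"
      by (rule order_trans[OF keys_push])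
    moreover have "bar_diff (Hi c) (push (realize c) y) = push (realize c) w"
      using bar_diff_push_realize[OF order_trans[OF y(1) valid]] y(2) by simp
    ultimately show ?thesis
      using w(2) by (intro bexI[of _ "push (realize c) y"]) simp_all
  qed
qed

lemma koszul_Hi: "koszul (Hi c :: ('k::field, _) ns_operad)"
  unfolding koszul_def
proof (intro conjI allI impI nonsymmetric_operad_Hi bar_acyclic_Hi)
  interpret Hi: nonsymmetric_operad "Hi c :: ('k, _) ns_operad" by (rule nonsymmetric_operad_Hi)
  have unit_Hill: "ounit (Hill c :: ('k, _) ns_operad) \<in> elems (Hill c) 1"
    by (rule nonsymmetric_operad.ounit_closed[OF nonsymmetric_operad_Hill])
  have basis: "hill_basis c 0 = {}" "hill_basis c 1 = {[]}"
    by (auto simp: hill_basis_def arity_def hills_def cliffs_def)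
  show "elems (Hi c :: ('k, _) ns_operad) 0 = {\<zero>\<^bsub>component (Hi c) 0\<^esub>}"
    by (simp add: elems_Hi zero_Hi basis)
  have sub: "submodule (span_in (component (Hi c) 1) {ounit (Hi c :: ('k, _) ns_operad)}) scalars (component (Hi c) 1)"
    using Hi.ounit_closed by (intro submodule_span_in[OF Hi.component_module]) simp
  show "elems (Hi c :: ('k, _) ns_operad) 1 = span_in (component (Hi c) 1) {ounit (Hi c)}"
  proof
    show "elems (Hi c :: ('k, _) ns_operad) 1 \<subseteq> span_in (component (Hi c) 1) {ounit (Hi c)}"
    proof
      fix A :: "(nat list \<Rightarrow>\<^sub>0 'k) set" assume "A \<in> elems (Hi c) 1"
      then obtain g where g: "A = fibre c 1 g" "keys g \<subseteq> {[]}"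
        by (auto simp: elems_Hi basis simp del: One_nat_def)
      have "g = scale (lookup g []) (ounit (Hill c))"
        using g(2) by (intro poly_mapping_eqI) (auto simp: Hill_def lookup_single when_def in_keys_iff)
      then have "A = fibre c 1 (scale (lookup g []) (ounit (Hill c)))"
        using g(1) by simp
      also have "\<dots> = lookup g [] \<odot>\<^bsub>component (Hi c) 1\<^esub> ounit (Hi c)"
        using linear_onD(3)[OF linear_on_fibre, of "ounit (Hill c)" c 1 "lookup g []"]
          unit_Hill
        by (simp add: ounit_Hi)
      also have "\<dots> \<in> span_in (component (Hi c) 1) {ounit (Hi c)}"
        using sub span_in_superset[of "{ounit (Hi c)}" "component (Hi c) 1"]
        unfolding submodule_iff[OF Hi.component_module] by blast
      finally show "A \<in> span_in (component (Hi c) 1) {ounit (Hi c)}" .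
    qed
    show "span_in (component (Hi c) 1) {ounit (Hi c)} \<subseteq> elems (Hi c :: ('k, _) ns_operad) 1"
      using sub unfolding submodule_iff[OF Hi.component_module] by blast
  qed
  show "ounit (Hi c) \<noteq> \<zero>\<^bsub>component (Hi c :: ('k, _) ns_operad) 1\<^esub>"
  proof
    assume "ounit (Hi c) = \<zero>\<^bsub>component (Hi c :: ('k, _) ns_operad) 1\<^esub>"
    then have "ounit (Hill c) = (0 :: _ \<Rightarrow>\<^sub>0 'k)"
      using inj_onD[OF inj_on_fibre, of c 1 "ounit (Hill c)" "0 :: _ \<Rightarrow>\<^sub>0 'k"]
        unit_Hill
      by (simp add: ounit_Hi zero_Hi)
    then have "lookup (ounit (Hill c)) [] = (0 :: 'k)" by simp
    then show False by (simp add: Hill_def)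
  qed
qed

theorem theorem4p2p3:
  fixes c :: nat
  shows "minimal_generating_set (Hi c :: ('k::field_char_0, (nat list \<Rightarrow>\<^sub>0 'k) set) ns_operad)
           {(2, E_hi c [a]) | a. a \<in> {0..c}} \<and>
         (\<exists>\<phi>. canonical_hom (letters c) (\<lambda>_ a. E_hi c [a])
                 (Hi c :: ('k, (nat list \<Rightarrow>\<^sub>0 'k) set) ns_operad) \<phi> \<and>
              (\<forall>n. a_kernel (component (free_operad (letters c)) n)
                      (component (Hi c :: ('k, (nat list \<Rightarrow>\<^sub>0 'k) set) ns_operad) n) (\<phi> n) =
                   generated_ideal (free_operad (letters c)) (hill_relators c) n)) \<and>
         koszul (Hi c :: ('k, (nat list \<Rightarrow>\<^sub>0 'k) set) ns_operad)"
  by (intro conjI minimal_generating_set_Hi presentation_Hi koszul_Hi)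

end
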